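(* Let $K$ be an algebraically closed field of arbitrary characteristic. If $0\neq f\in\langle x,y\rangle\subset K[[x,y]]$ is Newton non-degenerate (NND), then $$\mu(f)=2\cdot\delta(f)-r(f)+1.$$
   Context: $\mu(f)=\dim_K K[[x,y]]/\langle f_x,f_y\rangle\in\mathbb{Z}_{\geq0}\cup\{\infty\}$ is the Milnor number. The delta invariant is $\delta(f)=\sum_{Q\to 0}\frac{m_Q(m_Q-1)}{2}\in\mathbb{Z}_{\geq0}\cup\{\infty\}$, where the sum runs over the infinitely near points $Q$ of the origin (including the origin) in a minimal resolution of the singularity obtained by successively blowing up points, and $m_Q$ is the multiplicity of the strict transform of $f$ at $Q$ (so $\delta(f)=\infty$ if $f$ is not reduced). $r(f)$ is the number of branches of $f$ counted with multiplicity, i.e. the number of irreducible factors of $f$ in $K[[x,y]]$ counted with multiplicity. The equation is understood in $\mathbb{Z}\cup\{\infty\}$. Write $f=\sum_\alpha a_\alpha x^{\alpha_1}y^{\alpha_2}$, $\operatorname{supp}(f)=\{\alpha\mid a_\alpha\neq 0\}$. The Newton diagram $\Gamma(f)$ is the union of the compact faces (vertices and edges) of the convex hull of $\bigcup_{\alpha\in\operatorname{supp}(f)}(\alpha+\mathbb{R}_{\geq0}^2)$. For a face $\Delta$ put $\operatorname{in}_\Delta(f)=\sum_{\alpha\in\Delta}a_\alpha x^{\alpha_1}y^{\alpha_2}$. $f$ is NND if for every face $\Delta$ (of any dimension) of $\Gamma(f)$ the partial derivatives of $\operatorname{in}_\Delta(f)$ have no common zero in $(K^* )^2$; it is not required that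 $\Gamma(f)$ meets the coordinate axes. *)

theory Defs
  imports "HOL-Analysis.Analysis" "HOL-Computational_Algebra.Computational_Algebra"
begin

text \<open>
  The ring \<open>K[[x,y]]\<close> is represented as \<open>K[[x]][[y]]\<close>: the outer variable is \<open>y\<close>, so the
  coefficient of \<open>x\<^sup>i y\<^sup>j\<close> in \<open>f\<close> is \<open>f $ j $ i\<close>.
\<close>

type_synonym 'k fps2 = "'k fps fps"

abbreviation coeff2 :: "'k fps2 \<Rightarrow> nat \<Rightarrow> nat \<Rightarrow> 'k" where
  "coeff2 f i j \<equiv> f $ j $ i"

definition const2 :: "'k::field \<Rightarrow> 'k fps2" where
  "const2 c = fps_const (fps_const c)"

definition X2 :: "'k::field fps2" where
  "X2 = fps_const fps_X"

definition Y2 :: "'k::field fps2" where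
  "Y2 = fps_X"

definition ideal2 :: "'k::field fps2 \<Rightarrow> 'k fps2 \<Rightarrow> 'k fps2 set" where
  "ideal2 g h = {a * g + b * h | a b. True}"


subsection \<open>Milnor number\<close>

definition deriv_x :: "'k::field fps2 \<Rightarrow> 'k fps2" where
  "deriv_x f = Abs_fps (\<lambda>j. fps_deriv (f $ j))"

definition deriv_y :: "'k::field fps2 \<Rightarrow> 'k fps2" where
  "deriv_y f = fps_deriv f"

text \<open>\<open>B\<close> is finite and its residue classes form a \<open>K\<close>-basis of \<open>K[[x,y]] / I\<close>.\<close>

definition quotient_basis :: "'k::field fps2 set \<Rightarrow> 'k fps2 set \<Rightarrow> bool" where
  "quotient_basis I B \<longleftrightarrow> finite B \<and>
     (\<forall>g. \<exists>!c :: 'k fps2 \<Rightarrow> 'k. (\<forall>b. b \<notin> B \<longrightarrow> c b = 0) \<and> g - (\<Sum>b\<in>B. const2 (c b) * b) \<in> I)"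

definition quotient_dim :: "'k::field fps2 set \<Rightarrow> enat" where
  "quotient_dim I =
     (if \<exists>B. quotient_basis I B then enat (card (SOME B. quotient_basis I B)) else \<infinity>)"

definition milnor_number :: "'k::field fps2 \<Rightarrow> enat" where
  "milnor_number f = quotient_dim (ideal2 (deriv_x f) (deriv_y f))"


subsection \<open>Delta invariant\<close>

text \<open>Only meaningful for nonzero series.\<close>

definition mult2 :: "'k::field fps2 \<Rightarrow> nat" where
  "mult2 f = (LEAST d. \<exists>i j. d = i + j \<and> coeff2 f i j \<noteq> 0)"

text \<open>
  The substitution \<open>f(g, h)\<close> for \<open>g\<close> and \<open>h\<close> without constant term. Then \<open>g\<^sup>i h\<^sup>j\<close> has order at
  least \<open>i + j\<close>, so only the terms with \<open>i + j \<le> p + q\<close> contribute to the coefficient of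
  \<open>x\<^sup>p y\<^sup>q\<close>.
\<close>

definition subst2 :: "'k::field fps2 \<Rightarrow> 'k fps2 \<Rightarrow> 'k fps2 \<Rightarrow> 'k fps2" where
  "subst2 f g h = Abs_fps (\<lambda>q. Abs_fps (\<lambda>p.
     \<Sum>(i, j) \<in> {(i, j). i + j \<le> p + q}. coeff2 f i j * coeff2 (g ^ i * h ^ j) p q))"

text \<open>
  The points of the exceptional curve of the blow-up of a point are the tangent directions there:
  \<open>Slope t\<close> is the line \<open>y = t x\<close> and \<open>Vertical\<close> is the line \<open>x = 0\<close>.
\<close>

datatype 'k direction = Slope 'k | Vertical

text \<open>
  Near the point \<open>Slope t\<close> the blow-up is \<open>(x, y) \<mapsto> (x, x (y + t))\<close> with exceptional curve
  \<open>x = 0\<close>, and near \<open>Vertical\<close> it is \<open>(x, y) \<mapsto> (x y, y)\<close> with exceptional curve \<open>y = 0\<close>.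
  The total transform is divisible by the power \<open>mult2 f\<close> of the equation of the exceptional curve;
  dividing is shifting the coefficients.
\<close>

fun strict_transform1 :: "'k::field fps2 \<Rightarrow> 'k direction \<Rightarrow> 'k fps2" where
  "strict_transform1 f (Slope t) =
     Abs_fps (\<lambda>j. fps_shift (mult2 f) (subst2 f X2 (X2 * (Y2 + const2 t)) $ j))"
| "strict_transform1 f Vertical = fps_shift (mult2 f) (subst2 f (X2 * Y2) Y2)"

text \<open>
  A point infinitely near to the origin is the sequence of directions leading to it, the direction
  at the origin first.
\<close>

definition strict_transform :: "'k::field fps2 \<Rightarrow> 'k direction list \<Rightarrow> 'k fps2" where
  "strict_transform f Q = foldl strict_transform1 f Q"

abbreviation mult_at :: "'k::field fps2 \<Rightarrow> 'k direction list \<Rightarrow> nat" where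
  "mult_at f Q \<equiv> mult2 (strict_transform f Q)"

text \<open>
  The infinitely near points on the strict transforms of \<open>f\<close> that occur when precisely the
  singular points are blown up.
\<close>

inductive_set resolution_points :: "'k::field fps2 \<Rightarrow> 'k direction list set"
  for f :: "'k fps2" where
  origin: "[] \<in> resolution_points f"
| blow_up: "Q \<in> resolution_points f \<Longrightarrow> mult_at f Q \<ge> 2 \<Longrightarrow> mult_at f (Q @ [d]) \<ge> 1
            \<Longrightarrow> Q @ [d] \<in> resolution_points f"

text \<open>Every family in \<open>enat\<close> is summable, so the following sum is never a default value.\<close>

definition delta_invariant :: "'k::field fps2 \<Rightarrow> enat" where
  "delta_invariant f =
     (\<Sum>\<^sub>\<infinity>Q\<in>resolution_points f. enat (mult_at f Q * (mult_at f Q - 1) div 2))"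


subsection \<open>Number of branches\<close>

definition irreducible_factorization :: "'k::field fps2 \<Rightarrow> 'k fps2 multiset \<Rightarrow> bool" where
  "irreducible_factorization f A \<longleftrightarrow>
     (\<forall>p\<in>#A. irreducible p) \<and> (\<exists>u. u dvd 1 \<and> f = u * prod_mset A)"

text \<open>Well-defined for \<open>f \<noteq> 0\<close> because \<open>K[[x,y]]\<close> is factorial.\<close>

definition num_branches :: "'k::field fps2 \<Rightarrow> nat" where
  "num_branches f = size (SOME A. irreducible_factorization f A)"


subsection \<open>Newton non-degeneracy\<close>

definition newton_polyhedron :: "'k::field fps2 \<Rightarrow> (real \<times> real) set" where
  "newton_polyhedron f =
     convex hull {(real i + s, real j + t) | i j s t. coeff2 f i j \<noteq> 0 \<and> 0 \<le> s \<and> 0 \<le> t}"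

text \<open>
  The vertices and edges of the Newton diagram. The library counts the empty set as a face.
\<close>

definition newton_faces :: "'k::field fps2 \<Rightarrow> (real \<times> real) set set" where
  "newton_faces f = {\<Delta>. \<Delta> face_of newton_polyhedron f \<and> compact \<Delta> \<and> \<Delta> \<noteq> {}}"

text \<open>
  For compact \<open>\<Delta>\<close> the sum is finite and gives a polynomial in \<open>K[x][y]\<close>.
\<close>

definition in_face :: "(real \<times> real) set \<Rightarrow> 'k::field fps2 \<Rightarrow> 'k poly poly" where
  "in_face \<Delta> f =
     (\<Sum>(i, j) \<in> {(i, j). (real i, real j) \<in> \<Delta>}. monom (monom (coeff2 f i j) i) j)"

definition eval2 :: "'k::field poly poly \<Rightarrow> 'k \<Rightarrow> 'k \<Rightarrow> 'k" where
  "eval2 p a b = poly (poly p [:b:]) a"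

definition NND :: "'k::field fps2 \<Rightarrow> bool" where
  "NND f \<longleftrightarrow> (\<forall>\<Delta>\<in>newton_faces f.
     \<not> (\<exists>a b. a \<noteq> 0 \<and> b \<noteq> 0 \<and>
          eval2 (map_poly pderiv (in_face \<Delta> f)) a b = 0 \<and>
          eval2 (pderiv (in_face \<Delta> f)) a b = 0))"

end

theory Submission
  imports Defs
begin

text \<open>
  Write \<open>f = x\<^sup>\<alpha> y\<^sup>\<beta> g\<close> with \<open>g\<close> divisible by neither \<open>x\<close> nor \<open>y\<close>. If \<open>\<alpha>\<close> or \<open>\<beta>\<close> exceeds 1, both
  \<open>\<mu>\<close> and \<open>\<delta>\<close> are infinite. Otherwise \<open>\<mu>(f)\<close> is expressed by the intersection number of
  \<open>F = x f\<^sub>x / (x\<^sup>\<alpha> y\<^sup>\<beta>)\<close> and \<open>G = y f\<^sub>y / (x\<^sup>\<alpha> y\<^sup>\<beta>)\<close>, which are supported in the Newton polyhedron of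
  \<open>g\<close> and whose restrictions to its compact faces have no common zero in the torus. For such pairs
  \<open>i(F, G) + r(g) = 2 \<delta>(g) + a + b\<close>, where \<open>a\<close> and \<open>b\<close> are the intersection numbers of \<open>g\<close> with the
  axes: both sides satisfy the same recursion under blowing up the origin. By Noether's formula \<open>i(F, G)\<close>
  loses the square of the multiplicity, and only the two torus-fixed points of the exceptional curve contribute further;
  the other tangents of \<open>g\<close> are simple, so there the strict transform is smooth and contributes one
  branch. The hypotheses pass to the strict transforms because a blow-up chart acts on exponents by
  a unimodular map.

  Noether's formula and the count of branches come from a single construction: by Weierstrass
  division, a series \<open>H\<close> in a chart of the blow-up that is not divisible by the exceptional equation
  is the strict transform of a series \<open>P\<close>, with \<open>P dvd A\<close> if and only if \<open>H\<close> divides the total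
  transform of \<open>A\<close>. The quotient by \<open>P\<close> then has finite colength in the quotient by \<open>H\<close>, so
  multiplication by \<open>A\<close> has cokernels of equal dimension on both.
\<close>

text \<open>The recursion runs on arbitrary pairs F, G because logarithmic derivatives are not
  preserved: at \<open>Slope 0\<close>, x g_x turns into x h_x - y h_y + m h, where h is the strict
  transform and m the multiplicity of g. What survives is nondegeneracy of the pair, together with
  the weaker condition that g, x g_x and y g_y have no common zero in the torus on any compact face.
  The latter makes the tangents off the axes simple, in every characteristic. The two sides match by
  a count. Let a = i(g, y) and b = i(g, x), let a0, b0 and a1, b1 be their analogues at
  \<open>Slope 0\<close> and \<open>Vertical\<close>, and N the number of other tangents. Then m =
  b0 + a1 + N, a = m + a0 and b = m + b1. The step adds m^2 to i(F, G), N to r and m(m-1) to 2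
  delta, and m^2 + N + b0 + a1 = m(m-1) + 2m. Branches are counted by building factorizations into
  prime elements, whose length is an invariant. The factors x and y are put back at the end, using
  additivity of intersection numbers and delta(FG) = delta(F) + delta(G) + i(F, G).\<close>

section \<open>Relative dimensions\<close>

text \<open>\<open>card\<close> is 0 on infinite sets, whereas an infinite codimension has to be
  recorded as such.\<close>

definition ecard :: "'a set \<Rightarrow> enat" where
  "ecard A = (if finite A then enat (card A) else \<infinity>)"

lemma ecard_bij: "bij_betw h A B \<Longrightarrow> ecard A = ecard B"
  unfolding ecard_def using bij_betw_finite bij_betw_same_card by metis

lemma ecard_Un_disjoint: "A \<inter> B = {} \<Longrightarrow> ecard (A \<union> B) = ecard A + ecard B"
  by (auto simp: ecard_def card_Un_disjoint)

locale relative_dimension = vector_space scale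
  for scale :: "'a::field \<Rightarrow> 'b::ab_group_add \<Rightarrow> 'b"
begin

text \<open>A stand-in for the quotient map from \<open>span C\<close> to \<open>span C\<close>
  modulo \<open>span B\<close>: the quotient is realized inside the space as the complement
  \<open>span (C - B)\<close>.\<close>

lemma exists_projection:
  assumes C: "independent C" and BC: "B \<subseteq> C"
  obtains g where "Vector_Spaces.linear scale scale g" "\<And>v. v \<in> span B \<Longrightarrow> g v = 0"
    "\<And>v. v \<in> span (C - B) \<Longrightarrow> g v = v" "g ` span C = span (C - B)"
    "\<And>v. v \<in> span C \<Longrightarrow> v - g v \<in> span B"
proof -
  interpret pair: vector_space_pair scale scale ..
  obtain g where g: "Vector_Spaces.linear scale scale g" "\<And>x. x \<in> C \<Longrightarrow> g x = (if x \<in> B then 0 else x)"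
    using pair.linear_independent_extend[OF C, of "\<lambda>x. if x \<in> B then 0 else x"] by auto
  have 1: "g v = 0" if "v \<in> span B" for v
    by (rule pair.linear_eq_on[OF g(1) pair.linear_zero that]) (use g(2) BC in auto)
  have 2: "g v = v" if "v \<in> span (C - B)" for v
    by (rule pair.linear_eq_on[OF g(1) linear_ident that]) (use g(2) in auto)
  have 3: "g ` span C \<subseteq> span (C - B)"
  proof -
    have "g ` span C = span (g ` C)" using pair.linear_span_image[OF g(1)] by simp
    also have "\<dots> \<subseteq> span (C - B)"
      by (rule span_minimal) (auto simp: g(2) span_zero intro: span_base)
    finally show ?thesis .
  qed
  have "span (C - B) \<subseteq> span C" by (rule span_mono) auto
  then have "span (C - B) \<subseteq> g ` span C" using 2 by (metis (no_types, lifting) rev_image_eqI subsetI subsetD)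
  with 3 have 4: "g ` span C = span (C - B)" by (rule subset_antisym)
  have 5: "v - g v \<in> span B" if "v \<in> span C" for v
  proof -
    have "v \<in> span (B \<union> (C - B))" using BC that by (simp add: Un_absorb1)
    then obtain a b where "v = a + b" "a \<in> span B" "b \<in> span (C - B)"
      unfolding span_Un by blast
    then show ?thesis using 1 2 pair.linear_add[OF g(1)] by auto
  qed
  from that[OF g(1) 1 2 4 5] show thesis by simp
qed

text \<open>The isomorphism theorem in terms of bases: \<open>span (C - B)\<close> meets the kernel
  only in 0, so h maps \<open>C - B\<close> injectively to another basis of
  \<open>span E\<close>.\<close>

lemma ecard_diff_eq_of_kernel:
  assumes h: "Vector_Spaces.linear scale scale h" and C: "independent C" and BC: "B \<subseteq> C"
    and E: "independent E" and img: "h ` span C = span E"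
    and ker: "\<And>v. v \<in> span C \<Longrightarrow> h v = 0 \<longleftrightarrow> v \<in> span B"
  shows "ecard (C - B) = ecard E"
proof -
  interpret pair: vector_space_pair scale scale ..
  obtain g where g: "Vector_Spaces.linear scale scale g" "\<And>v. v \<in> span B \<Longrightarrow> g v = 0"
    "\<And>v. v \<in> span (C - B) \<Longrightarrow> g v = v" using exists_projection[OF C BC] by metis
  have sub: "span (C - B) \<subseteq> span C" by (rule span_mono) auto
  have inj: "inj_on h (span (C - B))"
    unfolding pair.linear_inj_on_iff_eq_0[OF h subspace_span] using ker sub g by (metis subsetD)
  have ind: "independent (h ` (C - B))"
    by (rule pair.linear_independent_injective_image[OF h]) (use independent_mono[OF C] inj in auto)
  have "span E = span (h ` C)" using pair.linear_span_image[OF h] img by metis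
  also have "\<dots> = span (h ` (C - B))"
  proof (rule span_eq[THEN iffD2], intro conjI)
    show "h ` (C - B) \<subseteq> span (h ` C)" by (auto intro: span_base)
    show "h ` C \<subseteq> span (h ` (C - B))"
    proof safe
      fix x assume "x \<in> C"
      then show "h x \<in> span (h ` (C - B))"
        using ker[of x] by (cases "x \<in> B") (auto intro: span_base simp: span_zero span_base)
    qed
  qed
  finally obtain k where "bij_betw k (h ` (C - B)) E"
    using bij_if_span_eq_span_bases[OF ind E] by auto
  moreover have "bij_betw h (C - B) (h ` (C - B))"
    using inj_on_subset[OF inj span_superset] by (simp add: bij_betw_def)
  ultimately show ?thesis by (metis ecard_bij)
qed

text \<open>The dimension of V/U, possibly infinite, obtained without forming a quotient space. By
  \<open>rdim_eq\<close> the chosen bases do not matter.\<close>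

definition rdim :: "'b set \<Rightarrow> 'b set \<Rightarrow> enat" where
  "rdim U V = (SOME n. \<exists>B C. independent C \<and> B \<subseteq> C \<and> span B = U \<and> span C = V \<and> n = ecard (C - B))"

lemma rdim_eq:
  assumes "independent C" "B \<subseteq> C" "span B = U" "span C = V"
  shows "rdim U V = ecard (C - B)"
proof -
  have *: "ecard (C' - B') = ecard (C - B)"
    if "independent C'" "B' \<subseteq> C'" "span B' = U" "span C' = V" for B' C'
  proof -
    obtain g where g: "Vector_Spaces.linear scale scale g" "\<And>v. v \<in> span B \<Longrightarrow> g v = 0"
      "g ` span C = span (C - B)" "\<And>v. v \<in> span C \<Longrightarrow> v - g v \<in> span B"
      using exists_projection[OF assms(1,2)] by metis
    have eq: "span B' = span B" "span C' = span C" using that assms by auto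
    have "g v = 0 \<longleftrightarrow> v \<in> span B'" if "v \<in> span C'" for v
      using g(2)[of v] g(4)[of v] that eq by auto
    moreover have "independent (C - B)" using independent_mono[OF assms(1)] by auto
    ultimately show ?thesis
      using eq g(3) by (intro ecard_diff_eq_of_kernel[OF g(1) that(1,2)]) auto
  qed
  show ?thesis
    unfolding rdim_def
  proof (rule some_equality)
    show "\<exists>B' C'. independent C' \<and> B' \<subseteq> C' \<and> span B' = U \<and> span C' = V \<and> ecard (C - B) = ecard (C' - B')"
      using assms by blast
  next
    fix n
    assume "\<exists>B' C'. independent C' \<and> B' \<subseteq> C' \<and> span B' = U \<and> span C' = V \<and> n = ecard (C' - B')"
    then obtain B' C' where "independent C'" "B' \<subseteq> C'" "span B' = U" "span C' = V" "n = ecard (C' - B')"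
      by metis
    then show "n = ecard (C - B)" using *[of C' B'] by metis
  qed
qed

lemma exists_relative_basis:
  assumes "subspace U" "subspace V" "U \<subseteq> V"
  obtains B C where "independent C" "B \<subseteq> C" "span B = U" "span C = V"
proof -
  obtain B where B: "B \<subseteq> U" "independent B" "U \<subseteq> span B"
    using maximal_independent_subset by blast
  have "B \<subseteq> V" using B(1) assms(3) by (rule subset_trans)
  then obtain C where C: "B \<subseteq> C" "C \<subseteq> V" "independent C" "V \<subseteq> span C"
    by (rule maximal_independent_subset_extend[OF _ B(2)])
  show thesis
    using span_minimal[OF B(1)] span_minimal[OF C(2)] B C assms by (intro that[OF C(3,1)]) auto
qed

lemma rdim_trans:
  assumes "subspace U" "subspace V" "subspace W" "U \<subseteq> V" "V \<subseteq> W"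
  shows "rdim U W = rdim U V + rdim V W"
proof -
  obtain A B where AB: "independent B" "A \<subseteq> B" "span A = U" "span B = V"
    using exists_relative_basis[OF assms(1,2,4)] by metis
  have "B \<subseteq> W" using AB span_superset[of B] assms by auto
  then obtain C where C: "B \<subseteq> C" "C \<subseteq> W" "independent C" "W \<subseteq> span C"
    by (rule maximal_independent_subset_extend[OF _ AB(1)])
  have W: "span C = W" using span_minimal[OF C(2)] C assms by auto
  have "rdim U W = ecard (C - A)" using AB C W by (intro rdim_eq) auto
  also have "C - A = (B - A) \<union> (C - B)" using AB C by auto
  also have "ecard \<dots> = ecard (B - A) + ecard (C - B)" by (intro ecard_Un_disjoint) auto
  also have "ecard (B - A) = rdim U V" using AB by (intro rdim_eq[symmetric]) auto
  also have "ecard (C - B) = rdim V W" using AB C W by (intro rdim_eq[symmetric]) auto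
  finally show ?thesis .
qed

text \<open>The hypotheses say that h induces an isomorphism from V/U to V'/U'. Following h by the
  projection along U' makes the kernel on V equal to U. All comparisons of intersection numbers
  below are instances.\<close>

lemma rdim_map:
  assumes h: "Vector_Spaces.linear scale scale h" and sub: "subspace U" "subspace V" "subspace U'" "subspace V'"
    and le: "U \<subseteq> V" "U' \<subseteq> V'" and img: "\<And>v. v \<in> V \<Longrightarrow> h v \<in> V'"
    and surj: "\<And>w. w \<in> V' \<Longrightarrow> \<exists>v\<in>V. w - h v \<in> U'"
    and ker: "\<And>v. v \<in> V \<Longrightarrow> h v \<in> U' \<Longrightarrow> v \<in> U"
    and imgU: "\<And>v. v \<in> U \<Longrightarrow> h v \<in> U'"
  shows "rdim U V = rdim U' V'"
proof -
  interpret pair: vector_space_pair scale scale ..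
  obtain B C where C: "independent C" "B \<subseteq> C" "span B = U" "span C = V"
    using exists_relative_basis[OF sub(1,2) le(1)] by metis
  obtain B' C' where C': "independent C'" "B' \<subseteq> C'" "span B' = U'" "span C' = V'"
    using exists_relative_basis[OF sub(3,4) le(2)] by metis
  obtain g where g: "Vector_Spaces.linear scale scale g" "\<And>v. v \<in> span B' \<Longrightarrow> g v = 0"
      "g ` span C' = span (C' - B')" "\<And>v. v \<in> span C' \<Longrightarrow> v - g v \<in> span B'"
    using exists_projection[OF C'(1,2)] by metis
  have gh: "Vector_Spaces.linear scale scale (g \<circ> h)" using Vector_Spaces.linear_compose[OF h g(1)] .
  have "ecard (C - B) = ecard (C' - B')"
  proof (rule ecard_diff_eq_of_kernel[OF gh C(1,2)])
    show "independent (C' - B')" using independent_mono[OF C'(1)] by auto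
    have "g ` span C' \<subseteq> g ` h ` span C"
    proof safe
      fix w assume "w \<in> span C'"
      then obtain v where v: "v \<in> V" "w - h v \<in> U'" using surj C' by auto
      have "g w = g (h v)" using g(2)[of "w - h v"] v C' pair.linear_diff[OF g(1)] by auto
      then show "g w \<in> g ` h ` span C" using v C by auto
    qed
    moreover have "g ` h ` span C \<subseteq> g ` span C'" using img C C' by blast
    ultimately show "(g \<circ> h) ` span C = span (C' - B')" using g(3) by (auto simp: image_comp)
    fix v assume v: "v \<in> span C"
    then have "h v \<in> span C'" using img C C' by auto
    then have "g (h v) = 0 \<longleftrightarrow> h v \<in> span B'" using g(2) g(4)[of "h v"] by auto
    then show "(g \<circ> h) v = 0 \<longleftrightarrow> v \<in> span B"
      using v C C' ker imgU by auto
  qed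
  then show ?thesis using rdim_eq[OF C] rdim_eq[OF C'] by simp
qed

lemma rdim_same:
  assumes "subspace U" shows "rdim U U = 0"
proof -
  obtain B where B: "B \<subseteq> U" "independent B" "U \<subseteq> span B"
    using maximal_independent_subset by blast
  then have "span B = U" using span_minimal[of B U] assms by auto
  then show ?thesis using rdim_eq[OF B(2), of B U U] by (simp add: ecard_def zero_enat_def)
qed

lemma rdim_0_imp_eq:
  assumes "subspace U" "subspace V" "U \<subseteq> V" "rdim U V = 0" shows "U = V"
proof -
  obtain B C where C: "independent C" "B \<subseteq> C" "span B = U" "span C = V"
    using exists_relative_basis[OF assms(1-3)] by metis
  then have "ecard (C - B) = 0" using rdim_eq assms by metis
  then have "C - B = {}" by (auto simp: ecard_def zero_enat_def split: if_splits)
  then show ?thesis using C by auto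
qed

text \<open>The inclusion of a complement of I induces an isomorphism onto the quotient by
  I.\<close>

lemma rdim_eq_ecard_complement:
  assumes "subspace I" "independent B" and "\<And>v. v \<in> span B \<Longrightarrow> v \<in> I \<Longrightarrow> v = 0"
    and "\<And>v. \<exists>s\<in>span B. v - s \<in> I"
  shows "rdim I UNIV = ecard B"
proof -
  have "rdim {0} (span B) = rdim I UNIV"
  proof (rule rdim_map[of "\<lambda>v. v"])
    show "Vector_Spaces.linear scale scale (\<lambda>v. v)" by (rule linear_ident)
  qed (use assms subspace_0 in \<open>auto intro: subspace_UNIV subspace_single_0 span_zero\<close>)
  moreover have "rdim {0} (span B) = ecard (B - {})"
    by (rule rdim_eq) (use assms in auto)
  ultimately show ?thesis by simp
qed

lemma rdim_mono: "subspace U \<Longrightarrow> subspace V \<Longrightarrow> subspace W \<Longrightarrow> U \<subseteq> V \<Longrightarrow> V \<subseteq> W \<Longrightarrow> rdim V W \<le> rdim U W"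
  using rdim_trans[of U V W] by simp

end

section \<open>Power series in two variables\<close>

lemma fps2_eqI: "(\<And>i j. coeff2 f i j = coeff2 g i j) \<Longrightarrow> f = (g :: 'k::field fps2)"
  by (simp add: fps_eq_iff)

lemma coeff2_X2_power_mult [simp]:
  "coeff2 (X2 ^ n * f) i j = (if i < n then 0 else coeff2 f (i - n) j)"
  by (simp add: X2_def fps_const_power fps_X_power_mult_nth)

lemma coeff2_Y2_power_mult [simp]:
  "coeff2 (Y2 ^ n * f) i j = (if j < n then 0 else coeff2 f i (j - n))"
  by (simp add: Y2_def fps_X_power_mult_nth)

lemma coeff2_X2_mult [simp]: "coeff2 (X2 * f) i j = (if i = 0 then 0 else coeff2 f (i - 1) j)"
  using coeff2_X2_power_mult[of 1 f] by simp

lemma coeff2_Y2_mult [simp]: "coeff2 (Y2 * f) i j = (if j = 0 then 0 else coeff2 f i (j - 1))"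
  using coeff2_Y2_power_mult[of 1 f] by simp

lemma coeff2_const2_mult [simp]: "coeff2 (const2 c * f) i j = c * coeff2 f i j"
  by (simp add: const2_def)

lemma const2_simps [simp]: "const2 0 = 0" "const2 1 = 1" "const2 (a * b) = const2 a * const2 b"
    "const2 (a + b) = const2 a + const2 b"
  by (simp_all add: const2_def)

lemma X2_nonzero [simp]: "X2 \<noteq> (0 :: 'k::field fps2)" and Y2_nonzero [simp]: "Y2 \<noteq> (0 :: 'k::field fps2)"
  by (simp_all add: X2_def Y2_def)

lemma is_unit_fps2_iff: "(f :: 'k::field fps2) dvd 1 \<longleftrightarrow> coeff2 f 0 0 \<noteq> 0"
proof
  assume "f dvd 1"
  then obtain g where "1 = f * g" by (rule dvdE)
  then have "1 = coeff2 f 0 0 * coeff2 g 0 0" by (metis fps_mult_nth_0 fps_one_nth)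
  then show "coeff2 f 0 0 \<noteq> 0" by auto
next
  assume "coeff2 f 0 0 \<noteq> 0"
  then have "f $ 0 dvd 1" by simp
  then obtain y where "1 = f $ 0 * y" by (rule dvdE)
  then have "f * fps_right_inverse f y = 1" using fps_right_inverse[of f y] by simp
  then show "f dvd 1" by (metis dvd_triv_left)
qed

text \<open>The encoding as series in y over K[[x]] treats the variables differently. This exchange
  carries results about one axis or chart over to the other.\<close>

definition swap2 :: "'k::field fps2 \<Rightarrow> 'k fps2" where
  "swap2 f = Abs_fps (\<lambda>j. Abs_fps (\<lambda>i. coeff2 f j i))"

lemma coeff2_swap2 [simp]: "coeff2 (swap2 f) i j = coeff2 f j i"
  by (simp add: swap2_def)

lemma swap2_swap2 [simp]: "swap2 (swap2 f) = f"
  by (rule fps2_eqI) simp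

lemma swap2_mult: "swap2 (f * g) = swap2 f * swap2 g"
proof (rule fps2_eqI)
  fix i j :: nat
  have "coeff2 (swap2 (f * g)) i j = (\<Sum>a=0..i. \<Sum>b=0..j. coeff2 f b a * coeff2 g (j - b) (i - a))"
    by (simp add: fps_mult_nth fps_sum_nth)
  also have "\<dots> = (\<Sum>b=0..j. \<Sum>a=0..i. coeff2 f b a * coeff2 g (j - b) (i - a))"
    by (rule sum.swap)
  also have "\<dots> = coeff2 (swap2 f * swap2 g) i j"
    by (simp add: fps_mult_nth fps_sum_nth)
  finally show "coeff2 (swap2 (f * g)) i j = coeff2 (swap2 f * swap2 g) i j" .
qed

lemma swap2_add: "swap2 (f + g) = swap2 f + swap2 g"
  by (rule fps2_eqI) simp

lemma swap2_simps [simp]: "swap2 0 = 0" "swap2 1 = 1" "swap2 (const2 c) = const2 c" "swap2 X2 = Y2" "swap2 Y2 = X2"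
  by (auto intro!: fps2_eqI simp: const2_def X2_def Y2_def fps_X_def)

lemma swap2_power: "swap2 (f ^ n) = swap2 f ^ n"
  by (induction n) (simp_all add: swap2_mult)

definition at_x0 :: "'k::field fps2 \<Rightarrow> 'k fps" where
  "at_x0 f = Abs_fps (\<lambda>j. coeff2 f 0 j)"

definition at_y0 :: "'k::field fps2 \<Rightarrow> 'k fps" where
  "at_y0 f = f $ 0"

lemma at_x0_nth [simp]: "at_x0 f $ j = coeff2 f 0 j"
  by (simp add: at_x0_def)

lemma at_y0_swap2: "at_y0 (swap2 f) = at_x0 f" and at_x0_swap2: "at_x0 (swap2 f) = at_y0 f"
  by (simp_all add: at_y0_def fps_eq_iff)

lemma at_y0_simps [simp]: "at_y0 (f + g) = at_y0 f + at_y0 g" "at_y0 (f * g) = at_y0 f * at_y0 g"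
   "at_y0 0 = 0" "at_y0 1 = 1"
  by (simp_all add: at_y0_def)

lemma at_x0_simps [simp]: "at_x0 (f + g) = at_x0 f + at_x0 g" "at_x0 (f * g) = at_x0 f * at_x0 g"
   "at_x0 0 = 0" "at_x0 1 = 1"
  unfolding at_y0_swap2[symmetric] by (simp_all add: swap2_add swap2_mult)

lemma at_x0_eq_0_iff: "at_x0 f = 0 \<longleftrightarrow> X2 dvd f"
proof
  assume "at_x0 f = 0"
  then have *: "coeff2 f 0 j = 0" for j by (metis at_x0_nth fps_zero_nth)
  have "f = X2 * Abs_fps (\<lambda>j. fps_shift 1 (f $ j))"
    by (rule fps2_eqI) (use * in auto)
  then show "X2 dvd f" by (metis dvd_triv_left)
qed (auto simp: fps_eq_iff)

lemma X2_power_dvdI: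
  assumes "\<And>i j. i < n \<Longrightarrow> coeff2 f i j = 0"
  shows "f = X2 ^ n * Abs_fps (\<lambda>j. fps_shift n (f $ j))"
  by (rule fps2_eqI) (use assms in auto)

section \<open>Charts of the blow-up\<close>

text \<open>\<open>tform p f\<close> is \<open>f\<^sub>p(1, y)\<close> for the homogeneous part \<open>f\<^sub>p\<close> of degree \<open>p\<close>.\<close>

definition tform :: "nat \<Rightarrow> 'k::field fps2 \<Rightarrow> 'k poly" where
  "tform p f = (\<Sum>l\<le>p. monom (coeff2 f (p - l) l) l)"

lemma coeff_tform [simp]: "coeff (tform p f) l = (if l \<le> p then coeff2 f (p - l) l else 0)"
  by (simp add: tform_def coeff_sum if_distrib[of "\<lambda>x. x = _"] cong: if_cong)

text \<open>The auxiliary \<open>h f\<close> is f(x, x y), whose coefficient of x^p is f_p(1, y).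
  Since this substitution is multiplicative, the forms multiply by the Cauchy product.\<close>

lemma tform_mult: "tform p (f * g) = (\<Sum>a=0..p. tform a f * tform (p - a) g)"
proof -
  define h :: "'a fps2 \<Rightarrow> 'a fps2" where "h f = Abs_fps (\<lambda>j. fps_X ^ j * f $ j)" for f
  have mult: "h (f * g) = h f * h g"
  proof (rule fps_ext)
    fix n
    have *: "fps_X ^ n * (f $ i * g $ (n - i)) = fps_X ^ i * f $ i * (fps_X ^ (n - i) * g $ (n - i))"
      if "i \<in> {0..n}" for i
    proof -
      have "fps_X ^ n = fps_X ^ i * (fps_X ^ (n - i) :: 'a fps)"
        using that by (simp flip: power_add)
      then show ?thesis by (simp only: mult_ac)
    qed
    have "h (f * g) $ n = (\<Sum>i=0..n. fps_X ^ n * (f $ i * g $ (n - i)))"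
      by (simp add: h_def fps_mult_nth sum_distrib_left)
    also have "\<dots> = (\<Sum>i=0..n. fps_X ^ i * f $ i * (fps_X ^ (n - i) * g $ (n - i)))"
      using * by (rule sum.cong[OF refl])
    also have "\<dots> = (h f * h g) $ n"
      by (simp add: h_def fps_mult_nth)
    finally show "h (f * g) $ n = (h f * h g) $ n" .
  qed
  have eq: "swap2 (h f) $ p = fps_of_poly (tform p f)" for f p
    by (rule fps_ext) (auto simp: h_def fps_X_power_mult_nth)
  have "fps_of_poly (tform p (f * g)) = (swap2 (h f) * swap2 (h g)) $ p"
    by (simp add: mult swap2_mult flip: eq)
  also have "\<dots> = fps_of_poly (\<Sum>a=0..p. tform a f * tform (p - a) g)"
    by (simp add: fps_mult_nth eq fps_of_poly_sum fps_of_poly_mult)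
  finally show ?thesis by (simp only: fps_of_poly_eq_iff)
qed

lemma tform_add: "tform p (f + g) = tform p f + tform p g"
  by (rule poly_eqI) simp

lemma tform_smult: "tform p (const2 c * f) = smult c (tform p f)"
  by (rule poly_eqI) simp

text \<open>This is f(x, x (y + t)) collected by powers of x: the coefficient of x^p is the
  polynomial f_p(1, y + t) in y, so each coefficient is given by a finite expression.\<close>

definition slope_chart :: "'k::field \<Rightarrow> 'k fps2 \<Rightarrow> 'k fps2" where
  "slope_chart t f = swap2 (Abs_fps (\<lambda>p. fps_of_poly (pcompose (tform p f) [:t, 1:])))"

fun chart :: "'k::field direction \<Rightarrow> 'k fps2 \<Rightarrow> 'k fps2" where
  "chart (Slope t) f = slope_chart t f"
| "chart Vertical f = swap2 (slope_chart 0 (swap2 f))"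

declare chart.simps [simp del]

lemma chart_Vertical [simp]: "chart Vertical f = swap2 (chart (Slope 0) (swap2 f))"
  by (simp add: chart.simps)

fun exc :: "'k::field direction \<Rightarrow> 'k fps2" where
  "exc (Slope t) = X2"
| "exc Vertical = Y2"

fun on_exc :: "'k::field direction \<Rightarrow> 'k fps2 \<Rightarrow> 'k fps" where
  "on_exc (Slope t) f = at_x0 f"
| "on_exc Vertical f = at_y0 f"

lemma coeff2_chart_Slope: "coeff2 (chart (Slope t) f) i j = coeff (pcompose (tform i f) [:t, 1:]) j"
  by (simp add: chart.simps slope_chart_def)

lemma coeff2_chart_Slope_0: "coeff2 (chart (Slope 0) f) i j = (if j \<le> i then coeff2 f (i - j) j else 0)"
  by (simp add: coeff2_chart_Slope pcompose_idR)

lemma coeff2_chart_Vertical: "coeff2 (chart Vertical f) i j = (if i \<le> j then coeff2 f i (j - i) else 0)"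
  by (simp add: coeff2_chart_Slope pcompose_idR)

lemma chart_add: "chart d (f + g) = chart d f + chart d g"
proof -
  have "chart (Slope t) (f + g) = chart (Slope t) f + chart (Slope t) g" for t and f g :: "'a fps2"
    by (rule fps2_eqI) (simp add: coeff2_chart_Slope tform_add pcompose_add)
  then show ?thesis by (cases d) (simp_all add: swap2_add)
qed

lemma chart_const2_mult: "chart d (const2 c * f) = const2 c * chart d f"
proof -
  have "chart (Slope t) (const2 c * f) = const2 c * chart (Slope t) f" for t and f :: "'a fps2"
    by (rule fps2_eqI) (simp add: coeff2_chart_Slope tform_smult pcompose_smult)
  then show ?thesis by (cases d) (simp_all add: swap2_mult)
qed

lemma chart_mult: "chart d (f * g) = chart d f * chart d g"
proof -
  have "chart (Slope t) (f * g) = chart (Slope t) f * chart (Slope t) g" for t and f g :: "'a fps2"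
    unfolding chart.simps(1) slope_chart_def swap2_mult[symmetric]
    by (intro arg_cong[of _ _ swap2] fps_ext)
      (simp add: fps_mult_nth tform_mult pcompose_sum pcompose_mult fps_of_poly_sum fps_of_poly_mult)
  then show ?thesis by (cases d) (simp_all add: swap2_mult)
qed

lemma chart_0 [simp]: "chart d 0 = 0"
  using chart_const2_mult[of d 0 0] by simp

lemma chart_diff: "chart d (f - g) = chart d f - chart d g"
  using chart_add[of d "f - g" g] by (simp add: algebra_simps)

lemma chart_fps_const_Slope: "chart (Slope t) (fps_const w) = fps_const w"
proof (rule fps2_eqI)
  fix i j :: nat
  have "tform i (fps_const w) = [:w $ i:]"
    by (rule poly_eqI) (auto simp: coeff_pCons split: nat.splits)
  then show "coeff2 (chart (Slope t) (fps_const w)) i j = coeff2 (fps_const w) i j"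
    by (auto simp: coeff2_chart_Slope pcompose_pCons coeff_pCons split: nat.splits)
qed

lemma chart_1 [simp]: "chart d 1 = 1"
proof -
  have "chart (Slope t) 1 = (1 :: 'a fps2)" for t
    using chart_fps_const_Slope[of t 1] by simp
  then show ?thesis by (cases d) simp_all
qed

lemma chart_power: "chart d (f ^ n) = chart d f ^ n"
  by (induction n) (simp_all add: chart_mult)

lemma chart_Slope_X2 [simp]: "chart (Slope t) X2 = X2"
  unfolding X2_def by (rule chart_fps_const_Slope)

lemma chart_Slope_const2 [simp]: "chart (Slope t) (const2 c) = const2 c"
  unfolding const2_def by (rule chart_fps_const_Slope)

lemma chart_Slope_Y2 [simp]: "chart (Slope t) Y2 = X2 * (Y2 + const2 t)"
proof (rule fps2_eqI)
  fix i j :: nat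
  have "tform i Y2 = (if i = 1 then [:0, 1 :: 'a:] else 0)"
    by (rule poly_eqI) (auto simp: Y2_def fps_X_def coeff_pCons split: nat.splits)
  then show "coeff2 (chart (Slope t) Y2) i j = coeff2 (X2 * (Y2 + const2 t)) i j"
    by (auto simp: coeff2_chart_Slope pcompose_pCons Y2_def const2_def fps_X_def coeff_pCons split: nat.splits)
qed

lemma coeff2_Y2_plus_const2_power:
  "coeff2 ((Y2 + const2 t) ^ l) i j = (if i = 0 then coeff ([:t, 1:] ^ l) j else 0)"
proof (induction l arbitrary: j)
  case (Suc l)
  have "coeff2 ((Y2 + const2 t) ^ Suc l) i j
      = (if j = 0 then 0 else coeff2 ((Y2 + const2 t) ^ l) i (j - 1)) + t * coeff2 ((Y2 + const2 t) ^ l) i j"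
    by (simp add: distrib_right)
  also have "\<dots> = (if i = 0 then coeff ([:t, 1:] ^ Suc l) j else 0)"
    by (cases j) (simp_all add: Suc coeff_pCons mult_pCons_left)
  finally show ?case .
qed (simp add: coeff_1)

lemma pcompose_power: "pcompose (p ^ n) q = pcompose p q ^ n"
  by (induction n) (simp_all add: pcompose_mult pcompose_1)

text \<open>The monomial x^i y^j becomes x^(i + j) (y + t)^j, so only the homogeneous part of degree
  p contributes to x^p.\<close>

lemma subst2_Slope: "subst2 f X2 (X2 * (Y2 + const2 t)) = chart (Slope t) f"
proof (rule fps2_eqI)
  fix p q :: nat
  have "coeff2 (subst2 f X2 (X2 * (Y2 + const2 t))) p q
     = (\<Sum>(i, j) \<in> {(i, j). i + j \<le> p + q}. if i + j = p then coeff2 f i j * coeff ([:t, 1:] ^ j) q else 0)"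
  proof -
    have "X2 ^ i * (X2 * (Y2 + const2 t)) ^ j = X2 ^ (i + j) * (Y2 + const2 t) ^ j" for i j
      by (simp add: power_mult_distrib power_add)
    then show ?thesis
      by (auto simp: subst2_def coeff2_Y2_plus_const2_power intro!: sum.cong simp del: coeff2_X2_mult)
  qed
  also have "\<dots> = (\<Sum>(i, j) \<in> {(i, j). i + j = p}. coeff2 f i j * coeff ([:t, 1:] ^ j) q)"
  proof (rule sum.mono_neutral_cong_right)
    have "{(i, j). i + j \<le> p + q} \<subseteq> {..p+q} \<times> {..p+q}" by (auto intro: add_leD1 add_leD2)
    then show "finite {(i, j). i + j \<le> p + q}" by (rule finite_subset) auto
  qed (auto split: if_splits)
  also have "\<dots> = (\<Sum>l\<le>p. coeff2 f (p - l) l * coeff ([:t, 1:] ^ l) q)"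
    by (rule sum.reindex_bij_witness[of _ "\<lambda>l. (p - l, l)" snd]) auto
  also have "\<dots> = coeff (pcompose (tform p f) [:t, 1:]) q"
    by (simp add: tform_def pcompose_sum coeff_sum monom_altdef pcompose_smult pcompose_power pcompose_pCons)
  finally show "coeff2 (subst2 f X2 (X2 * (Y2 + const2 t))) p q = coeff2 (chart (Slope t) f) p q"
    by (simp add: coeff2_chart_Slope)
qed

lemma subst2_Vertical: "subst2 f (X2 * Y2) Y2 = chart Vertical f"
proof (rule fps2_eqI)
  fix p q :: nat
  have fin: "finite {(i, j). i + j \<le> p + q}"
  proof -
    have "{(i, j). i + j \<le> p + q} \<subseteq> {..p+q} \<times> {..p+q}" by (auto intro: add_leD1 add_leD2)
    then show ?thesis by (rule finite_subset) auto
  qed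
  have "coeff2 ((X2 * Y2) ^ i * Y2 ^ j) p q = (if p = i \<and> q = i + j then 1 else 0 :: 'a)" for i j
  proof -
    have "(X2 * Y2) ^ i * Y2 ^ j = X2 ^ i * (Y2 ^ (i + j) * (1 :: 'a fps2))"
      by (simp add: power_mult_distrib power_add)
    then show ?thesis by (auto simp del: mult_1_right)
  qed
  then have "coeff2 (subst2 f (X2 * Y2) Y2) p q
     = (\<Sum>(i, j) \<in> {(i, j). i + j \<le> p + q}. if p = i \<and> q = i + j then coeff2 f i j else 0)"
    by (auto simp: subst2_def intro!: sum.cong)
  also have "\<dots> = (\<Sum>x \<in> {(i, j). i + j \<le> p + q}. if x = (p, q - p) then (if p \<le> q then coeff2 f p (q - p) else 0) else 0)"
    by (rule sum.cong) (auto split: if_splits)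
  also have "\<dots> = (if p \<le> q then coeff2 f p (q - p) else 0)"
    using fin by (simp add: sum.delta)
  finally show "coeff2 (subst2 f (X2 * Y2) Y2) p q = coeff2 (chart Vertical f) p q"
    by (simp add: coeff2_chart_Vertical del: chart_Vertical)
qed

section \<open>Multiplicity and strict transforms\<close>

lemma mult2_le: "coeff2 f i j \<noteq> 0 \<Longrightarrow> mult2 f \<le> i + j"
  unfolding mult2_def by (rule Least_le) blast

lemma coeff2_below_mult2: "i + j < mult2 f \<Longrightarrow> coeff2 f i j = 0"
  by (metis mult2_le leD)

lemma tform_mult2_nonzero:
  assumes "f \<noteq> 0" shows "tform (mult2 f) f \<noteq> 0"
proof -
  have "\<exists>i j. coeff2 f i j \<noteq> 0" using assms fps2_eqI[of f 0] by auto
  then have "\<exists>d i j. d = i + j \<and> coeff2 f i j \<noteq> 0" by blast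
  then have "\<exists>i j. mult2 f = i + j \<and> coeff2 f i j \<noteq> 0"
    unfolding mult2_def by (rule LeastI_ex)
  then obtain i j where "mult2 f = i + j" "coeff2 f i j \<noteq> 0" by blast
  then have "coeff (tform (mult2 f) f) j \<noteq> 0" by simp
  then show ?thesis by (metis coeff_0)
qed

lemma coeff_tform_swap2: "l \<le> p \<Longrightarrow> coeff (tform p (swap2 f)) l = coeff (tform p f) (p - l)"
  by simp

lemma tform_swap2_eq_0_iff: "tform p (swap2 f) = 0 \<longleftrightarrow> tform p f = 0"
proof -
  have "tform p (swap2 f) = 0" if "tform p f = 0" for f :: "'a fps2"
    using that by (intro poly_eqI) (metis coeff_0 coeff_tform coeff_tform_swap2)
  from this[of f] this[of "swap2 f"] show ?thesis by auto
qed

lemma mult2_swap2: "mult2 (swap2 f) = mult2 f"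
  unfolding mult2_def coeff2_swap2 by (rule arg_cong[of _ _ Least]) (metis add.commute)

definition ord_ge :: "nat \<Rightarrow> 'k::field fps2 \<Rightarrow> bool" where
  "ord_ge m f \<longleftrightarrow> (\<forall>i j. i + j < m \<longrightarrow> coeff2 f i j = 0)"

lemma ord_ge_mult2: "ord_ge (mult2 f) f"
  by (simp add: ord_ge_def coeff2_below_mult2)

lemma ord_ge_swap2: "ord_ge m (swap2 f) \<longleftrightarrow> ord_ge m f"
  by (auto simp: ord_ge_def add.commute)

text \<open>The exponent m is free: F and G are divided by the power that belongs to the
  multiplicity of g, and one of them may vanish to higher order.\<close>

fun transform :: "nat \<Rightarrow> 'k::field direction \<Rightarrow> 'k fps2 \<Rightarrow> 'k fps2" where
  "transform m (Slope t) f = Abs_fps (\<lambda>j. fps_shift m (chart (Slope t) f $ j))"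
| "transform m Vertical f = fps_shift m (chart Vertical f)"

abbreviation st :: "'k::field direction \<Rightarrow> 'k fps2 \<Rightarrow> 'k fps2" where
  "st d f \<equiv> strict_transform1 f d"

lemma st_eq_transform: "st d f = transform (mult2 f) d f"
  by (cases d) (simp_all only: strict_transform1.simps transform.simps subst2_Slope subst2_Vertical)

declare strict_transform1.simps [simp del]

lemma coeff2_transform_Slope:
  "coeff2 (transform m (Slope t) f) i j = coeff (pcompose (tform (i + m) f) [:t, 1:]) j"
  by (simp add: coeff2_chart_Slope)

lemma transform_Vertical: "transform m Vertical f = swap2 (transform m (Slope 0) (swap2 f))"
  by (rule fps2_eqI) simp

declare transform.simps [simp del]

lemma st_Vertical: "st Vertical f = swap2 (st (Slope 0) (swap2 f))"
  by (simp add: st_eq_transform transform_Vertical mult2_swap2)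

lemma chart_eq_transform:
  assumes "ord_ge m f" shows "chart d f = exc d ^ m * transform m d f"
proof -
  have *: "chart (Slope t) f = X2 ^ m * transform m (Slope t) f" if "ord_ge m f" for t and f :: "'a fps2"
  proof (rule fps2_eqI)
    fix i j :: nat
    have "tform i f = 0" if "i < m"
      using \<open>ord_ge m f\<close> that by (intro poly_eqI) (auto simp: ord_ge_def)
    then show "coeff2 (chart (Slope t) f) i j = coeff2 (X2 ^ m * transform m (Slope t) f) i j"
      by (auto simp: coeff2_chart_Slope coeff2_transform_Slope)
  qed
  show ?thesis
    using *[OF assms] *[of "swap2 f" 0] assms
    by (cases d) (simp_all add: transform_Vertical ord_ge_swap2 swap2_mult swap2_power)
qed

lemma chart_eq_st: "chart d f = exc d ^ mult2 f * st d f"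
  by (simp add: st_eq_transform chart_eq_transform ord_ge_mult2)

lemma on_exc_simps [simp]: "on_exc d (f + g) = on_exc d f + on_exc d g" "on_exc d (f * g) = on_exc d f * on_exc d g"
   "on_exc d 0 = 0" "on_exc d 1 = 1"
  by (cases d; simp)+

lemma on_exc_power [simp]: "on_exc d (f ^ n) = on_exc d f ^ n"
  by (induction n) simp_all

lemma on_exc_exc [simp]: "on_exc d (exc d) = 0"
  by (cases d) (simp_all add: at_x0_eq_0_iff at_y0_def Y2_def)

lemma on_exc_Vertical: "on_exc Vertical f = on_exc (Slope 0) (swap2 f)"
  by (simp add: at_x0_swap2)

lemma on_exc_nth_0: "on_exc d f $ 0 = coeff2 f 0 0"
  by (cases d) (simp_all add: at_y0_def)

lemma exc_nonzero [simp]: "exc d \<noteq> 0"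
  by (cases d) simp_all

lemma exc_dvd_iff: "exc d dvd f \<longleftrightarrow> on_exc d f = 0"
proof (cases d)
  case Vertical
  have "Y2 dvd f \<longleftrightarrow> X2 dvd swap2 f"
    by (metis dvd_def swap2_mult swap2_simps(5) swap2_swap2)
  then show ?thesis using Vertical by (simp add: on_exc_Vertical at_x0_eq_0_iff del: on_exc.simps(2))
qed (simp add: at_x0_eq_0_iff)

lemma on_exc_transform_Slope:
  "on_exc (Slope t) (transform m (Slope t) f) = fps_of_poly (pcompose (tform m f) [:t, 1:])"
  by (rule fps_ext) (simp add: coeff2_transform_Slope)

lemma on_exc_transform_Vertical:
  "on_exc Vertical (transform m Vertical f) = fps_of_poly (tform m (swap2 f))"
  unfolding on_exc_Vertical transform_Vertical swap2_swap2 on_exc_transform_Slope by simp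

lemma on_exc_st_nonzero:
  assumes "f \<noteq> 0" shows "on_exc d (st d f) \<noteq> 0"
proof (cases d)
  case (Slope t)
  have "pcompose (tform (mult2 f) f) [:t, 1:] \<noteq> 0"
    using tform_mult2_nonzero[OF assms] pcompose_eq_0[of "tform (mult2 f) f" "[:t, 1:]"] by auto
  then show ?thesis unfolding Slope st_eq_transform on_exc_transform_Slope by simp
next
  case Vertical
  then show ?thesis
    unfolding Vertical st_eq_transform on_exc_transform_Vertical
    using tform_mult2_nonzero[OF assms] by (simp add: tform_swap2_eq_0_iff)
qed

lemma st_0_0_Slope: "coeff2 (st (Slope t) f) 0 0 = poly (tform (mult2 f) f) t"
  by (simp add: st_eq_transform coeff2_transform_Slope poly_0_coeff_0[symmetric] poly_pcompose)

lemma st_0_0_Vertical: "coeff2 (st Vertical f) 0 0 = coeff (tform (mult2 f) f) (mult2 f)"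
  by (simp add: st_eq_transform transform_Vertical coeff2_transform_Slope)

text \<open>If the two exponents of the exceptional equation differed, cancelling the smaller power
  would leave a series divisible by this equation where the restriction to the exceptional curve is
  nonzero. One such factorization of a total transform therefore determines both the multiplicity
  and the strict transform.\<close>

lemma strict_transform_unique:
  assumes "chart d f = exc d ^ n * B" "on_exc d B \<noteq> 0"
  shows "mult2 f = n" "st d f = B"
proof -
  let ?m = "mult2 f"
  have eq: "exc d ^ ?m * st d f = exc d ^ n * B" using assms chart_eq_st by metis
  have "B \<noteq> 0" using assms by auto
  then have "f \<noteq> 0" using assms by auto
  have "?m \<le> n"
  proof (rule ccontr)
    assume "\<not> ?m \<le> n"
    then have "exc d ^ ?m = exc d ^ n * exc d ^ Suc (?m - Suc n)"
      by (metis Suc_diff_Suc le_add_diff_inverse nat_le_linear not_le power_add)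
    then have "B = exc d ^ Suc (?m - Suc n) * st d f"
      using eq by (simp add: mult.assoc del: power_Suc)
    then show False using assms by simp
  qed
  moreover have "n \<le> ?m"
  proof (rule ccontr)
    assume "\<not> n \<le> ?m"
    then have "exc d ^ n = exc d ^ ?m * exc d ^ Suc (n - Suc ?m)"
      by (metis Suc_diff_Suc le_add_diff_inverse nat_le_linear not_le power_add)
    then have "st d f = exc d ^ Suc (n - Suc ?m) * B"
      using eq by (simp add: mult.assoc del: power_Suc)
    then have "on_exc d (st d f) = 0" by simp
    then show False using on_exc_st_nonzero[OF \<open>f \<noteq> 0\<close>] by blast
  qed
  ultimately show "mult2 f = n" by simp
  then show "st d f = B" using eq by simp
qed

lemma chart_eq_0_iff [simp]: "chart d f = 0 \<longleftrightarrow> f = 0"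
proof
  assume "chart d f = 0"
  then have "st d f = 0" unfolding chart_eq_st by simp
  then show "f = 0" using on_exc_st_nonzero[of f d] by auto
qed simp

lemma
  assumes "f \<noteq> 0" "g \<noteq> 0"
  shows mult2_mult: "mult2 (f * g) = mult2 f + mult2 g"
    and st_mult: "st d (f * g) = st d f * st d g"
proof -
  have "chart d (f * g) = exc d ^ (mult2 f + mult2 g) * (st d f * st d g)" for d
    by (simp add: chart_mult chart_eq_st[of d f] chart_eq_st[of d g] power_add mult_ac)
  moreover have "on_exc d (st d f * st d g) \<noteq> 0" for d
    using assms by (simp add: on_exc_st_nonzero)
  ultimately show "mult2 (f * g) = mult2 f + mult2 g" "st d (f * g) = st d f * st d g"
    using strict_transform_unique by blast+
qed

lemma st_dvd_1: "f dvd 1 \<Longrightarrow> st d f dvd 1"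
  using st_mult[of f _ d] strict_transform_unique(2)[of d 1 0 1]
  by (auto elim!: dvdE) (metis dvd_triv_left mult_zero_left mult_zero_right zero_neq_one)

lemma mult2_eq_0_iff: "f \<noteq> 0 \<Longrightarrow> mult2 f = 0 \<longleftrightarrow> f dvd 1"
proof -
  assume "f \<noteq> 0"
  have "coeff (tform 0 f) 0 \<noteq> 0" if "mult2 f = 0"
    using tform_mult2_nonzero[OF \<open>f \<noteq> 0\<close>] that by (auto simp: poly_eq_iff split: if_splits)
  then show ?thesis using mult2_le[of f 0 0] by (auto simp: is_unit_fps2_iff)
qed

section \<open>Weierstrass division\<close>

lemma X2_power_dvd_iff: "X2 ^ n dvd f \<longleftrightarrow> (\<forall>i j. i < n \<longrightarrow> coeff2 f i j = 0)"
  using X2_power_dvdI[of n f] by (metis coeff2_X2_power_mult dvdE dvd_triv_left)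

lemma eq_if_X2_power_dvd:
  assumes "\<And>n. X2 ^ n dvd f - g" shows "f = g"
proof (rule fps2_eqI)
  fix i j :: nat
  from assms[of "Suc i"] show "coeff2 f i j = coeff2 g i j"
    unfolding X2_power_dvd_iff by auto
qed

lemma contraction_fixpoint_unique:
  fixes \<Phi> :: "'k::field fps2 \<Rightarrow> 'k fps2"
  assumes contr: "\<And>n f g. X2 ^ n dvd f - g \<Longrightarrow> X2 ^ Suc n dvd \<Phi> f - \<Phi> g"
    and "\<Phi> f = f" "\<Phi> g = g"
  shows "f = g"
proof (rule eq_if_X2_power_dvd)
  fix n show "X2 ^ n dvd f - g"
    by (induction n) (use contr assms(2,3) in \<open>auto simp del: power_Suc, metis\<close>)
qed

text \<open>Completeness of K[[x,y]] in the x-adic topology: the iterates starting from 0 form a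
  Cauchy sequence.\<close>

lemma contraction_fixpoint_exists:
  fixes \<Phi> :: "'k::field fps2 \<Rightarrow> 'k fps2"
  assumes contr: "\<And>n f g. X2 ^ n dvd f - g \<Longrightarrow> X2 ^ Suc n dvd \<Phi> f - \<Phi> g"
  obtains Q where "\<Phi> Q = Q"
proof -
  define q where "q n = (\<Phi> ^^ n) 0" for n
  have q_Suc: "q (Suc n) = \<Phi> (q n)" for n by (simp add: q_def)
  have step: "X2 ^ n dvd q (Suc n) - q n" for n
    by (induction n) (simp_all add: q_Suc contr del: power_Suc)
  have le: "X2 ^ n dvd q m - q n" if "n \<le> m" for m n
    using that
  proof (induction m rule: dec_induct)
    case (step m)
    have "X2 ^ n dvd X2 ^ m" using step by (simp add: le_imp_power_dvd)
    then have "X2 ^ n dvd (q (Suc m) - q m) + (q m - q n)"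
      using \<open>\<And>n. X2 ^ n dvd q (Suc n) - q n\<close>[of m] step by (intro dvd_add) (auto intro: dvd_trans)
    then show ?case by simp
  qed simp
  \<comment> \<open>From the iterate i + 1 onwards the coefficient of x^i no longer changes.\<close>
  define Q where "Q = Abs_fps (\<lambda>j. Abs_fps (\<lambda>i. coeff2 (q (Suc i)) i j))"
  have Qq: "X2 ^ n dvd Q - q n" for n
    unfolding X2_power_dvd_iff
  proof (intro allI impI)
    fix i j assume "i < n"
    then have "X2 ^ Suc i dvd q n - q (Suc i)" by (intro le) simp
    then have "coeff2 (q n - q (Suc i)) i j = 0" unfolding X2_power_dvd_iff by blast
    then show "coeff2 (Q - q n) i j = 0" by (simp add: Q_def)
  qed
  have "\<Phi> Q = Q"
  proof (rule eq_if_X2_power_dvd)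
    fix n
    have n: "X2 ^ n dvd (X2 :: 'k fps2) ^ Suc n" by simp
    have "X2 ^ n dvd \<Phi> Q - q (Suc n)"
      using dvd_trans[OF n contr[OF Qq[of n]]] by (simp only: q_Suc)
    from dvd_diff[OF this dvd_trans[OF n Qq[of "Suc n"]]]
    have "X2 ^ n dvd (\<Phi> Q - q (Suc n)) - (Q - q (Suc n))" .
    then show "X2 ^ n dvd \<Phi> Q - Q" by simp
  qed
  then show thesis by (rule that)
qed

lemma fps_shift_Y2_power_mult [simp]: "fps_shift k (Y2 ^ k * f) = f"
  by (rule fps2_eqI) simp

lemma cutoff_plus_shift: "f = fps_cutoff k f + Y2 ^ k * fps_shift k f"
  by (rule fps2_eqI) auto

lemma X2_power_dvd_shift: "X2 ^ n dvd f \<Longrightarrow> X2 ^ n dvd fps_shift k f"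
  unfolding X2_power_dvd_iff by simp

context
  fixes H :: "'k::field fps2" and k :: nat
  assumes nz: "at_x0 H \<noteq> 0" and k: "k = subdegree (at_x0 H)"
begin

lemma shift_unit: "fps_shift k H dvd 1"
  unfolding is_unit_fps2_iff using nth_subdegree_nonzero[OF nz] k by simp

lemma low_coeffs: "j < k \<Longrightarrow> coeff2 H 0 j = 0"
  using nth_less_subdegree_zero[of j "at_x0 H"] by (simp add: k)

lemma X2_dvd_cutoff: "X2 dvd fps_cutoff k H"
proof -
  have "at_x0 (fps_cutoff k H) = 0"
    by (rule fps_ext) (simp add: low_coeffs)
  then show ?thesis by (simp add: at_x0_eq_0_iff)
qed

text \<open>With \<open>H = L + y\<^sup>k U\<close>, \<open>U\<close> a unit and \<open>x dvd L\<close>, the unknown \<open>Q U\<close> is the fixpoint of an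
  \<open>x\<close>-adic contraction.\<close>

lemma weierstrass_contraction:
  fixes A V :: "'k fps2"
  assumes "X2 ^ n dvd f - g"
  shows "X2 ^ Suc n dvd (A - fps_shift k (f * (V * fps_cutoff k H))) - (A - fps_shift k (g * (V * fps_cutoff k H)))"
proof -
  have "X2 ^ n dvd g - f" using assms dvd_minus_iff[of "X2 ^ n" "f - g"] by simp
  then have "X2 ^ n * X2 dvd (g - f) * (fps_cutoff k H * V)"
    using X2_dvd_cutoff by (intro mult_dvd_mono dvd_mult2)
  then have "X2 ^ Suc n dvd fps_shift k ((g - f) * (V * fps_cutoff k H))"
    by (intro X2_power_dvd_shift) (simp add: mult_ac)
  then show ?thesis by (simp add: left_diff_distrib fps_shift_diff del: power_Suc)
qed

text \<open>\<open>fps_shift k R = 0\<close> says that R is a polynomial in y of degree below k over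
  K[[x]], so this is division with remainder. The fixpoint is the quotient times the unit
  \<open>fps_shift k H\<close>; hence the quotient itself is \<open>Q * V\<close>.\<close>

lemma weierstrass_division:
  obtains Q where "fps_shift k (A - Q * H) = 0"
proof -
  obtain V where V: "fps_shift k H * V = 1" using shift_unit by (metis dvd_def)
  obtain Q where Q: "fps_shift k A - fps_shift k (Q * (V * fps_cutoff k H)) = Q"
    by (rule contraction_fixpoint_exists[of "\<lambda>Q. fps_shift k A - fps_shift k (Q * (V * fps_cutoff k H))"])
      (erule weierstrass_contraction)
  have "Q * V * H = Q * (V * fps_cutoff k H) + Y2 ^ k * (Q * (fps_shift k H * V))"
    by (subst (1) cutoff_plus_shift[of H k]) (simp add: algebra_simps)
  then have "fps_shift k (Q * V * H) = fps_shift k (Q * (V * fps_cutoff k H)) + Q"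
    by (simp only: V fps_shift_add fps_shift_Y2_power_mult mult_1_right)
  then have "fps_shift k (A - Q * V * H) = fps_shift k A - fps_shift k (Q * (V * fps_cutoff k H)) - Q"
    by (simp add: fps_shift_diff)
  then have "fps_shift k (A - Q * V * H) = 0" by (simp only: Q diff_self)
  then show thesis by (rule that)
qed

text \<open>The product of Q with the unit \<open>fps_shift k H\<close> and 0 are both fixpoints of
  the same contraction, the one belonging to dividend 0.\<close>

lemma weierstrass_division_unique:
  assumes "fps_shift k (Q * H) = 0" shows "Q = 0"
proof -
  obtain V where V: "fps_shift k H * V = 1" using shift_unit by (metis dvd_def)
  let ?Q = "Q * fps_shift k H"
  have "Q * H = ?Q * (V * fps_cutoff k H) + Y2 ^ k * ?Q"
  proof -
    have "?Q * (V * fps_cutoff k H) = Q * (fps_shift k H * V) * fps_cutoff k H" by (simp only: mult_ac)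
    also have "\<dots> = Q * fps_cutoff k H" by (simp add: V)
    finally show ?thesis
      by (subst (1) cutoff_plus_shift[of H k]) (simp add: algebra_simps)
  qed
  then have "fps_shift k (?Q * (V * fps_cutoff k H)) + ?Q = 0"
    using assms by (simp only: fps_shift_add fps_shift_Y2_power_mult)
  then have "0 - fps_shift k (?Q * (V * fps_cutoff k H)) = ?Q"
    by (simp add: add_eq_0_iff)
  then have "?Q = 0"
    by (rule contraction_fixpoint_unique[of "\<lambda>Q. 0 - fps_shift k (Q * (V * fps_cutoff k H))", rotated])
      (simp, erule weierstrass_contraction)
  moreover have "fps_shift k H \<noteq> 0" using V by auto
  ultimately show ?thesis by simp
qed

text \<open>Dividing y^k by H produces \<open>W = Q * H\<close>, monic of degree k in y. At x = 0
  the coefficient of y^k in W is Q(0, 0) times that of H, and it equals 1, so Q is a unit.\<close>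

lemma weierstrass_preparation:
  obtains V W where "V dvd 1" "W = V * H" "fps_shift k W = 1" "\<And>j. j < k \<Longrightarrow> coeff2 W 0 j = 0"
proof -
  obtain Q where Q: "fps_shift k (Y2 ^ k * 1 - Q * H) = 0" using weierstrass_division by blast
  define W where "W = Q * H"
  have W1: "fps_shift k W = 1" using Q unfolding W_def fps_shift_diff by (simp only: fps_shift_Y2_power_mult right_minus_eq)
  have low: "coeff2 W 0 j = 0" if "j < k" for j
  proof -
    have "at_x0 W $ j = (\<Sum>i=0..j. at_x0 Q $ i * at_x0 H $ (j - i))"
      unfolding W_def at_x0_simps fps_mult_nth ..
    also have "\<dots> = 0" using that low_coeffs by (intro sum.neutral) auto
    finally show ?thesis by simp
  qed
  have "at_x0 W $ k = (\<Sum>i=0..k. at_x0 Q $ i * at_x0 H $ (k - i))"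
    unfolding W_def at_x0_simps fps_mult_nth ..
  also have "\<dots> = (\<Sum>i\<in>{0}. at_x0 Q $ i * at_x0 H $ (k - i))"
    using low_coeffs by (intro sum.mono_neutral_right) auto
  also have "at_x0 W $ k = 1" using arg_cong[OF W1, of "\<lambda>f. coeff2 f 0 0"] by simp
  finally have "Q dvd 1" by (auto simp: is_unit_fps2_iff)
  then show thesis using that W_def W1 low by blast
qed

end

section \<open>Contracting series along a chart\<close>

lemma chart_sum: "chart d (sum f A) = (\<Sum>a\<in>A. chart d (f a))"
  by (induction A rule: infinite_finite_induct) (simp_all add: chart_add)

lemma polynomial_in_Y2:
  fixes R :: "'k::field fps2"
  assumes "\<And>j. j > k \<Longrightarrow> R $ j = 0"
  shows "R = (\<Sum>j\<le>k. fps_const (R $ j) * Y2 ^ j)"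
proof (rule fps_ext)
  fix n
  have "(\<Sum>j\<le>k. fps_const (R $ j) * Y2 ^ j) $ n = (\<Sum>j\<le>k. if j = n then R $ j else 0)"
    by (simp add: fps_sum_nth Y2_def fps_X_power_nth eq_commute if_distrib cong: if_cong)
  also have "\<dots> = R $ n" using assms[of n] by auto
  finally show "R $ n = (\<Sum>j\<le>k. fps_const (R $ j) * Y2 ^ j) $ n" by simp
qed

text \<open>\<open>x\<^sup>k R(x, y / x - t)\<close> for \<open>R\<close> of degree at most \<open>k\<close> in \<open>y\<close>.\<close>

definition homogenize :: "'k::field \<Rightarrow> nat \<Rightarrow> 'k fps2 \<Rightarrow> 'k fps2" where
  "homogenize t k R = (\<Sum>j\<le>k. fps_const (R $ j) * X2 ^ (k - j) * (Y2 - const2 t * X2) ^ j)"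

text \<open>The chart sends y - t x to x y, so every term of \<open>homogenize\<close> acquires the
  same factor x^k. This shows which series upstairs come from below after multiplication by
  x^k.\<close>

lemma chart_homogenize:
  fixes R :: "'k::field fps2"
  assumes "\<And>j. j > k \<Longrightarrow> R $ j = 0"
  shows "chart (Slope t) (homogenize t k R) = X2 ^ k * R"
proof -
  have "chart (Slope t) (Y2 - const2 t * X2) = X2 * Y2"
    by (simp add: chart_diff chart_mult distrib_left mult.left_commute mult.commute)
  then have "chart (Slope t) (homogenize t k R)
      = (\<Sum>j\<le>k. fps_const (R $ j) * X2 ^ (k - j) * (X2 * Y2) ^ j)"
    by (simp add: homogenize_def chart_sum chart_mult chart_power chart_fps_const_Slope)
  also have "\<dots> = (\<Sum>j\<le>k. X2 ^ k * (fps_const (R $ j) * Y2 ^ j))"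
  proof (rule sum.cong)
    fix j assume "j \<in> {..k}"
    then have "X2 ^ k = X2 ^ (k - j) * (X2 ^ j :: 'k fps2)" by (simp flip: power_add)
    then show "fps_const (R $ j) * X2 ^ (k - j) * (X2 * Y2) ^ j = X2 ^ k * (fps_const (R $ j) * Y2 ^ j)"
      by (simp only: power_mult_distrib mult_ac)
  qed simp
  also have "\<dots> = X2 ^ k * R"
    by (subst (2) polynomial_in_Y2[OF assms]) (simp_all add: sum_distrib_left)
  finally show ?thesis .
qed

text \<open>Substituting x (y + t) for y does not raise the degree in y. A remainder of a division
  below therefore stays a remainder above, where uniqueness of division applies.\<close>

lemma shift_chart_polynomial:
  fixes R :: "'k::field fps2"
  assumes "fps_shift k R = 0"
  shows "fps_shift k (chart (Slope t) R) = 0"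
proof (cases k)
  case 0
  then show ?thesis using assms by simp
next
  case (Suc k')
  have R: "R $ j = 0" if "j \<ge> k" for j
    using arg_cong[OF assms, of "\<lambda>f. f $ (j - k)"] that by simp
  have "R = (\<Sum>j\<le>k'. fps_const (R $ j) * Y2 ^ j)"
    by (rule polynomial_in_Y2) (use R Suc in auto)
  then have "chart (Slope t) R = (\<Sum>j\<le>k'. fps_const (R $ j) * (X2 ^ j * (Y2 + const2 t) ^ j))"
    by (metis (no_types, lifting) chart_Slope_Y2 chart_fps_const_Slope chart_mult chart_power chart_sum power_mult_distrib sum.cong)
  moreover have "(X2 ^ j * (Y2 + const2 t) ^ j) $ l = 0" if "j \<le> k'" "l \<ge> k" for j l
  proof (rule fps_ext)
    fix i
    have "degree ([:t, 1:] ^ j) < l"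
      using that Suc degree_power_le[of "[:t, 1:]" j] by auto
    then show "coeff2 (X2 ^ j * (Y2 + const2 t) ^ j) i l = 0 $ i"
      by (simp add: coeff2_Y2_plus_const2_power coeff_eq_0)
  qed
  ultimately have "chart (Slope t) R $ l = 0" if "l \<ge> k" for l
    using that by (simp add: fps_sum_nth)
  then show ?thesis by (intro fps_ext) simp
qed

text \<open>P is the homogenized Weierstrass polynomial W of H. If H divides the transform of A, so
  does W, and the transformed remainder of A modulo P is a multiple of W of degree below k, hence 0.
  Conversely, x^k times any remainder modulo W lies in the image of the chart. The form (y - t)^k of
  P says that its tangent cone is the line of slope t alone.\<close>

lemma descent_Slope:
  fixes H :: "'k::field fps2"
  assumes nz: "at_x0 H \<noteq> 0" and k: "k = subdegree (at_x0 H)"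
  obtains P W where "P \<noteq> 0" "mult2 P = k" "W = st (Slope t) P" "H dvd W" "W dvd H"
    "tform k P = [:- t, 1:] ^ k"
    "\<forall>A. H dvd chart (Slope t) A \<longrightarrow> P dvd A"
    "\<forall>B. \<exists>A Z. X2 ^ k * B = chart (Slope t) A + Z * H"
proof -
  obtain V W where VW: "V dvd 1" "W = V * H" "fps_shift k W = 1" "\<And>j. j < k \<Longrightarrow> coeff2 W 0 j = 0"
    using weierstrass_preparation[OF nz k] by metis
  have Wk: "W $ j = (if j = k then 1 else 0)" if "j \<ge> k" for j
    using arg_cong[OF VW(3), of "\<lambda>f. f $ (j - k)"] that by auto
  have dvd: "H dvd W" "W dvd H"
    using VW(1,2) by (simp_all add: dvd_mult_unit_iff' mult_unit_dvd_iff')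
  define P where "P = homogenize t k W"
  have chart_P: "chart (Slope t) P = X2 ^ k * W"
    unfolding P_def by (rule chart_homogenize) (use Wk in auto)
  have atW: "at_x0 W = fps_X ^ k"
  proof (rule fps_ext)
    fix n
    show "at_x0 W $ n = fps_X ^ k $ n"
      by (cases n k rule: linorder_cases) (simp_all add: fps_X_power_nth VW(4) Wk)
  qed
  have P: "mult2 P = k" "st (Slope t) P = W"
    using strict_transform_unique[of "Slope t" P k W] chart_P atW by simp_all
  have "P \<noteq> 0" using chart_P atW by auto
  have "fps_of_poly (pcompose (tform k P) [:t, 1:]) = fps_X ^ k"
    using on_exc_transform_Slope[of t k P] P atW by (simp add: st_eq_transform)
  also have "\<dots> = fps_of_poly (monom 1 k)" by (simp add: fps_of_poly_monom')
  finally have "pcompose (tform k P) [:t, 1:] = monom 1 k" by (simp only: fps_of_poly_eq_iff)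
  then have "pcompose (pcompose (tform k P) [:t, 1:]) [:- t, 1:] = [:- t, 1:] ^ k"
    by (simp add: monom_altdef pcompose_power pcompose_pCons)
  then have form: "tform k P = [:- t, 1:] ^ k"
    by (simp add: pcompose_assoc[symmetric] pcompose_pCons)
  \<comment> \<open>This makes P regular in y of order k, so Weierstrass division by P itself is
    available.\<close>
  have "coeff2 P 0 k = 1"
  proof -
    have "lead_coeff ([:- t, 1:] ^ k) = 1" by (subst lead_coeff_power) simp
    then have "coeff (tform k P) k = 1"
      unfolding form by (simp add: degree_power_eq)
    then show ?thesis by simp
  qed
  then have subP: "at_x0 P \<noteq> 0" "k = subdegree (at_x0 P)"
    using P by (metis at_x0_nth fps_zero_nth zero_neq_one)
      (rule subdegreeI[symmetric], use \<open>coeff2 P 0 k = 1\<close> P in \<open>simp_all add: coeff2_below_mult2\<close>)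
  have subW: "at_x0 W \<noteq> 0" "k = subdegree (at_x0 W)"
    unfolding atW by simp_all
  have "P dvd A" if "H dvd chart (Slope t) A" for A
  proof -
    obtain Q where Q: "fps_shift k (A - Q * P) = 0" using weierstrass_division[OF subP] by blast
    have "W dvd chart (Slope t) (A - Q * P)"
      using dvd_trans[OF dvd(2) that] by (simp add: chart_diff chart_mult chart_P)
    then obtain Z where Z: "chart (Slope t) (A - Q * P) = Z * W" by (metis dvd_def mult.commute)
    then have "fps_shift k (Z * W) = 0" using shift_chart_polynomial[OF Q, of t] by simp
    then have "Z = 0" by (rule weierstrass_division_unique[OF subW])
    then show ?thesis using Z by simp
  qed
  moreover have "\<exists>A Z. X2 ^ k * B = chart (Slope t) A + Z * H" for B
  proof -
    obtain Q where Q: "fps_shift k (B - Q * W) = 0" using weierstrass_division[OF subW] by blast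
    have "(B - Q * W) $ j = 0" if "j > k" for j
      using arg_cong[OF Q, of "\<lambda>f. f $ (j - k)"] that by simp
    then have "chart (Slope t) (homogenize t k (B - Q * W)) = X2 ^ k * (B - Q * W)"
      by (rule chart_homogenize)
    then have "X2 ^ k * B = chart (Slope t) (homogenize t k (B - Q * W)) + (X2 ^ k * Q * V) * H"
      unfolding VW(2) by (simp add: algebra_simps)
    then show ?thesis by blast
  qed
  ultimately show thesis using that[of P W] \<open>P \<noteq> 0\<close> P dvd form by blast
qed

text \<open>\<open>P\<close> is the series whose strict transform is \<open>H\<close> near the point \<open>d\<close> of the exceptional curve
  and does not meet it elsewhere.\<close>

lemma descent:
  fixes H :: "'k::field fps2"
  assumes nz: "on_exc d H \<noteq> 0" and k: "k = subdegree (on_exc d H)"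
  obtains P where "P \<noteq> 0" "mult2 P = k" "H dvd st d P" "st d P dvd H"
    "\<And>d'. d' \<noteq> d \<Longrightarrow> st d' P dvd 1"
    "\<And>A. H dvd chart d A \<Longrightarrow> P dvd A"
    "\<And>B. \<exists>A Z. exc d ^ k * B = chart d A + Z * H"
proof (cases d)
  case (Slope t)
  have "at_x0 H \<noteq> 0" "k = subdegree (at_x0 H)" using nz k Slope by simp_all
  then obtain P W where P: "P \<noteq> 0" "mult2 P = k" "W = st (Slope t) P" "H dvd W" "W dvd H"
    "tform k P = [:- t, 1:] ^ k"
    "\<forall>A. H dvd chart (Slope t) A \<longrightarrow> P dvd A"
    "\<forall>B. \<exists>A Z. X2 ^ k * B = chart (Slope t) A + Z * H"
    by (rule descent_Slope[where t = t])
  have "st d' P dvd 1" if "d' \<noteq> d" for d'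
  proof (cases d')
    case (Slope s)
    then show ?thesis using that \<open>d = Slope t\<close> P
      by (simp add: is_unit_fps2_iff st_0_0_Slope poly_power)
  next
    case Vertical
    have "lead_coeff ([:- t, 1:] ^ k) = 1" by (subst lead_coeff_power) simp
    then have "coeff ([:- t, 1:] ^ k) k = 1" by (simp add: degree_power_eq)
    then show ?thesis using Vertical P
      by (simp add: is_unit_fps2_iff st_0_0_Vertical del: coeff_tform)
  qed
  then show thesis using that[of P] P Slope by auto
next
  case Vertical
  have "at_x0 (swap2 H) \<noteq> 0" "k = subdegree (at_x0 (swap2 H))"
    using nz k Vertical by (simp_all add: at_x0_swap2)
  then obtain P W where P: "P \<noteq> 0" "mult2 P = k" "W = st (Slope 0) P" "swap2 H dvd W" "W dvd swap2 H"
    "tform k P = [:- 0, 1:] ^ k"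
    "\<forall>A. swap2 H dvd chart (Slope 0) A \<longrightarrow> P dvd A"
    "\<forall>B. \<exists>A Z. X2 ^ k * B = chart (Slope 0) A + Z * swap2 H"
    by (rule descent_Slope[where t = 0])
  have dvd_swap: "f dvd g \<longleftrightarrow> swap2 f dvd swap2 g" for f g :: "'k fps2"
    by (metis dvd_def swap2_mult swap2_swap2)
  have ne: "swap2 P \<noteq> 0" using P(1) by (metis swap2_simps(1) swap2_swap2)
  have m: "mult2 (swap2 P) = k" using P by (simp add: mult2_swap2)
  have st: "st Vertical (swap2 P) = swap2 W" using P by (simp add: st_Vertical)
  have "coeff (tform k P) k = 1" using P(6) by (simp add: monom_altdef[symmetric, of 1, simplified])
  then have c: "coeff2 P 0 k = 1" by simp
  have other: "st d' (swap2 P) dvd 1" if "d' \<noteq> d" for d'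
  proof (cases d')
    case (Slope s)
    have "tform k (swap2 P) = 1"
    proof (rule poly_eqI)
      fix l
      have "coeff (tform k P) l = (if l = k then 1 else 0)" for l
        using P(6) by (simp add: monom_altdef[symmetric, of 1, simplified])
      from this[of "k - l"] show "coeff (tform k (swap2 P)) l = coeff 1 l"
        by (auto simp: split: if_splits)
    qed
    then show ?thesis using Slope m by (simp add: is_unit_fps2_iff st_0_0_Slope)
  qed (use that Vertical in simp)
  have A: "swap2 P dvd A" if "H dvd chart Vertical A" for A
  proof -
    have "swap2 H dvd chart (Slope 0) (swap2 A)" using that dvd_swap[of H "chart Vertical A"] by simp
    then have "P dvd swap2 A" using P(7) by blast
    then show ?thesis using dvd_swap[of "swap2 P" A] by simp
  qed
  have B: "\<exists>A Z. Y2 ^ k * B = chart Vertical A + Z * H" for B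
  proof -
    obtain A Z where "X2 ^ k * swap2 B = chart (Slope 0) A + Z * swap2 H" using P(8) by blast
    then have "swap2 (X2 ^ k * swap2 B) = swap2 (chart (Slope 0) A + Z * swap2 H)" by simp
    then have "Y2 ^ k * B = chart Vertical (swap2 A) + swap2 Z * H"
      by (simp add: swap2_mult swap2_add swap2_power)
    then show ?thesis by blast
  qed
  have "H dvd swap2 W" "swap2 W dvd H" using P(4,5) dvd_swap[of H "swap2 W"] dvd_swap[of "swap2 W" H] by simp_all
  then show thesis using that[of "swap2 P"] ne m st other A B Vertical by auto
qed

section \<open>Intersection numbers\<close>

lemma ex1_imp_eq: "\<exists>!x. P x \<Longrightarrow> P a \<Longrightarrow> P b \<Longrightarrow> a = b"
  by auto

section \<open>Colengths in K[[x,y]] as relative dimensions\<close>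

interpretation R2: relative_dimension "\<lambda>c (f :: 'k::field fps2). const2 c * f"
  by unfold_locales (simp_all add: algebra_simps)

lemma R2_linear_iff:
  "Vector_Spaces.linear (\<lambda>c f. const2 c * f) (\<lambda>c f. const2 c * f) h \<longleftrightarrow>
    (\<forall>f g. h (f + g) = h f + h g) \<and> (\<forall>c f. h (const2 c * f) = const2 c * h (f :: 'k::field fps2))"
  by (simp add: Vector_Spaces.linear_iff R2.vector_space_axioms)

lemma R2_linear_mult: "Vector_Spaces.linear (\<lambda>c f. const2 c * f) (\<lambda>c f. const2 c * f) ((*) (g :: 'k::field fps2))"
  unfolding R2_linear_iff by (simp add: algebra_simps)

lemma R2_linear_chart: "Vector_Spaces.linear (\<lambda>c f. const2 c * f) (\<lambda>c f. const2 c * f) (chart (d :: 'k::field direction))"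
  by (simp add: R2_linear_iff chart_add chart_const2_mult del: chart_Vertical)

lemma R2_linear_swap2: "Vector_Spaces.linear (\<lambda>c f. const2 c * f) (\<lambda>c f. const2 c * f) (swap2 :: 'k::field fps2 \<Rightarrow> _)"
  by (simp add: R2_linear_iff swap2_add swap2_mult)

text \<open>Uniqueness of the coefficients of 0 makes the residue classes of a
  \<open>quotient_basis\<close> independent, so it spans a complement of I. Conversely, vectors
  extending a basis of I to one of the whole space form a \<open>quotient_basis\<close> if they are
  finitely many.\<close>

lemma quotient_dim_eq_rdim:
  fixes I :: "'k::field fps2 set"
  assumes I: "R2.subspace I" shows "quotient_dim I = R2.rdim I UNIV"
proof -
  have 1: "R2.rdim I UNIV = enat (card B)" if B: "quotient_basis I B" for B
  proof -
    have fin: "finite B" using B by (simp add: quotient_basis_def)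
    have uniq: "\<forall>b\<in>B. c b = 0" if "(\<Sum>b\<in>B. const2 (c b) * b) \<in> I" for c
    proof -
      let ?c = "\<lambda>b. if b \<in> B then c b else 0"
      let ?P = "\<lambda>c. (\<forall>b. b \<notin> B \<longrightarrow> c b = 0) \<and> 0 - (\<Sum>b\<in>B. const2 (c b) * b) \<in> I"
      have "\<exists>!c. ?P c" using B unfolding quotient_basis_def by blast
      moreover have "?P ?c" using R2.subspace_neg[OF I that] by simp
      moreover have "?P (\<lambda>_. 0)" using R2.subspace_0[OF I] by simp
      ultimately have "?c = (\<lambda>_. 0)" by (rule ex1_imp_eq[of ?P])
      then show ?thesis by (metis (mono_tags))
    qed
    have span: "\<exists>c. v = (\<Sum>b\<in>B. const2 (c b) * b)" if "v \<in> R2.span B" for v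
      using that unfolding R2.span_finite[OF fin] by blast
    have "R2.rdim I UNIV = ecard B"
    proof (rule R2.rdim_eq_ecard_complement[OF I])
      show "R2.independent B"
        unfolding R2.dependent_finite[OF fin] using uniq R2.subspace_0[OF I] by metis
      show "v = 0" if v: "v \<in> R2.span B" "v \<in> I" for v
      proof -
        obtain c where c: "v = (\<Sum>b\<in>B. const2 (c b) * b)" using span v by blast
        then have "\<forall>b\<in>B. c b = 0" using uniq v by blast
        then show ?thesis using c by simp
      qed
      show "\<exists>s\<in>R2.span B. v - s \<in> I" for v
        using B unfolding quotient_basis_def R2.span_finite[OF fin] by blast
    qed
    then show ?thesis using fin by (simp add: ecard_def)
  qed
  have 2: "\<exists>B. quotient_basis I B" if fin: "R2.rdim I UNIV \<noteq> \<infinity>"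
  proof -
    obtain A C where C: "R2.independent C" "A \<subseteq> C" "R2.span A = I" "R2.span C = UNIV"
      by (rule R2.exists_relative_basis[OF I R2.subspace_UNIV subset_UNIV])
    let ?B = "C - A"
    have finB: "finite ?B" using fin R2.rdim_eq[OF C] by (auto simp: ecard_def split: if_splits)
    obtain p where p: "\<And>v. v \<in> I \<Longrightarrow> p v = 0" "\<And>v. v \<in> R2.span ?B \<Longrightarrow> p v = v"
      "p ` UNIV = R2.span ?B" "\<And>v. v - p v \<in> I"
      using R2.exists_projection[OF C(1,2), unfolded C(3,4)] by (metis UNIV_I)
    have ind: "R2.independent ?B" using R2.independent_mono[OF C(1)] by auto
    have "\<exists>!c. (\<forall>b. b \<notin> ?B \<longrightarrow> c b = 0) \<and> g - (\<Sum>b\<in>?B. const2 (c b) * b) \<in> I" for g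
    proof (rule ex_ex1I)
      have "p g \<in> R2.span ?B" using p(3) by auto
      then obtain c where c: "p g = (\<Sum>b\<in>?B. const2 (c b) * b)"
        unfolding R2.span_finite[OF finB] by blast
      let ?c = "\<lambda>b. if b \<in> ?B then c b else 0"
      have "(\<Sum>b\<in>?B. const2 (?c b) * b) = p g" unfolding c by (rule sum.cong) auto
      then show "\<exists>c. (\<forall>b. b \<notin> ?B \<longrightarrow> c b = 0) \<and> g - (\<Sum>b\<in>?B. const2 (c b) * b) \<in> I"
        using p(4)[of g] by (intro exI[of _ ?c]) simp
    next
      fix c c'
      assume c: "(\<forall>b. b \<notin> ?B \<longrightarrow> c b = 0) \<and> g - (\<Sum>b\<in>?B. const2 (c b) * b) \<in> I"
        and c': "(\<forall>b. b \<notin> ?B \<longrightarrow> c' b = 0) \<and> g - (\<Sum>b\<in>?B. const2 (c' b) * b) \<in> I"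
      have cc: "const2 (a - b) = const2 a - const2 b" for a b :: 'k
        by (simp add: const2_def)
      let ?s = "\<Sum>b\<in>?B. const2 (c' b - c b) * b"
      have "?s = (g - (\<Sum>b\<in>?B. const2 (c b) * b)) - (g - (\<Sum>b\<in>?B. const2 (c' b) * b))"
        by (simp add: cc left_diff_distrib sum_subtractf)
      also have "\<dots> \<in> I" using c c' by (blast intro: R2.subspace_diff[OF I])
      finally have "?s \<in> I" .
      moreover have "?s \<in> R2.span ?B" by (intro R2.span_sum R2.span_scale R2.span_base)
      ultimately have s0: "?s = 0" using p(1)[of ?s] p(2)[of ?s] by simp
      have "\<forall>b\<in>?B. c' b - c b = 0"
      proof (rule contrapos_np)
        assume "\<not> (\<forall>b\<in>?B. c' b - c b = 0)"
        then have "\<exists>b\<in>?B. c' b - c b \<noteq> 0" by blast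
        with s0 show "R2.dependent ?B"
          unfolding R2.dependent_finite[OF finB] by (intro exI[of _ "\<lambda>b. c' b - c b"] conjI)
      qed (rule ind)
      then show "c = c'" using c c' by (intro ext) (metis eq_iff_diff_eq_0)
    qed
    then show ?thesis using finB unfolding quotient_basis_def by blast
  qed
  show ?thesis
  proof (cases "\<exists>B. quotient_basis I B")
    case True
    then have "quotient_basis I (SOME B. quotient_basis I B)" by (rule someI_ex)
    then show ?thesis using True 1 by (simp add: quotient_dim_def)
  next
    case False
    then have "R2.rdim I UNIV = \<infinity>" using 2 by blast
    then show ?thesis using False by (simp add: quotient_dim_def)
  qed
qed

section \<open>Ideals with two generators and intersection numbers\<close>

lemma ideal2I: "f = a * g + b * h \<Longrightarrow> f \<in> ideal2 g h"
  by (auto simp: ideal2_def)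

lemma ideal2E:
  assumes "f \<in> ideal2 g h" obtains a b where "f = a * g + b * h"
  using assms by (auto simp: ideal2_def)

lemma ideal2_commute: "ideal2 g h = ideal2 h g"
  by (auto simp: ideal2_def) (metis add.commute)+

lemma ideal2_mono: "(\<And>a b. a * g + b * h \<in> ideal2 g' h') \<Longrightarrow> ideal2 g h \<subseteq> ideal2 g' h'"
  by (auto simp: ideal2_def)

lemma subspace_ideal2: "R2.subspace (ideal2 g h)"
  unfolding R2.subspace_def
proof (intro conjI allI ballI)
  show "0 \<in> ideal2 g h" by (rule ideal2I[of _ 0 _ 0]) simp
next
  fix x y assume "x \<in> ideal2 g h" "y \<in> ideal2 g h"
  then obtain a b a' b' where "x = a * g + b * h" "y = a' * g + b' * h" by (metis ideal2E)
  then show "x + y \<in> ideal2 g h" by (intro ideal2I[of _ "a + a'" _ "b + b'"]) (simp add: algebra_simps)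
next
  fix c x assume "x \<in> ideal2 g h"
  then obtain a b where "x = a * g + b * h" by (metis ideal2E)
  then show "const2 c * x \<in> ideal2 g h"
    by (intro ideal2I[of _ "const2 c * a" _ "const2 c * b"]) (simp add: algebra_simps)
qed

text \<open>The intersection number dim_K K[[x,y]]/(g, h) at the origin.\<close>

definition imult :: "'k::field fps2 \<Rightarrow> 'k fps2 \<Rightarrow> enat" where
  "imult g h = R2.rdim (ideal2 g h) UNIV"

lemma milnor_number_eq_imult: "milnor_number f = imult (deriv_x f) (deriv_y f)"
  by (simp add: milnor_number_def imult_def quotient_dim_eq_rdim subspace_ideal2)

lemma imult_commute: "imult g h = imult h g"
  by (simp add: imult_def ideal2_commute)

lemma imult_add_mult: "imult g (h + z * g) = imult g h"
proof -
  have *: "ideal2 g (h + z * g) \<subseteq> ideal2 g h" for h z :: "'a fps2"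
  proof (rule ideal2_mono)
    fix a b
    show "a * g + b * (h + z * g) \<in> ideal2 g h"
      by (rule ideal2I[of _ "a + b * z" _ b]) (simp add: algebra_simps)
  qed
  show ?thesis using *[of h z] *[of "h + z * g" "- z"] by (simp add: imult_def)
qed

lemma imult_mono: "ideal2 g h \<subseteq> ideal2 g' h' \<Longrightarrow> imult g' h' \<le> imult g h"
  unfolding imult_def by (intro R2.rdim_mono subspace_ideal2 R2.subspace_UNIV) auto

lemma ideal2_dvd_mono:
  assumes "g' dvd g" "h' dvd h" shows "ideal2 g h \<subseteq> ideal2 g' h'"
proof (rule ideal2_mono)
  fix a b
  obtain u v where "g = g' * u" "h = h' * v" using assms by (metis dvdE)
  then show "a * g + b * h \<in> ideal2 g' h'"
    by (intro ideal2I[of _ "a * u" _ "b * v"]) (simp add: algebra_simps)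
qed

lemma imult_unit:
  assumes "g dvd 1" shows "imult g h = 0"
proof -
  obtain u where "1 = g * u" using assms by (rule dvdE)
  then have "f \<in> ideal2 g h" for f by (intro ideal2I[of _ "f * u" _ 0]) (simp add: mult_ac)
  then have "ideal2 g h = UNIV" by auto
  then show ?thesis unfolding imult_def by (simp add: R2.rdim_same R2.subspace_UNIV)
qed

text \<open>A Nakayama argument. The ideals \<open>J n\<close>, generated by g, h and z^n, decrease
  and have bounded codimension, so two consecutive ones coincide. Then z^n (1 - z r) lies in the
  ideal for some r, and 1 - z r is a unit.\<close>

lemma power_in_ideal2:
  assumes fin: "imult g h \<noteq> \<infinity>" and z: "coeff2 z 0 0 = 0"
  obtains N where "z ^ N \<in> ideal2 g h"
proof -
  let ?I = "ideal2 g h"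
  define J where "J n = {i + z ^ n * r | i r. i \<in> ?I}" for n
  have sub: "R2.subspace (J n)" for n
    unfolding R2.subspace_def
  proof (intro conjI allI ballI)
    show "0 \<in> J n" unfolding J_def using R2.subspace_0[OF subspace_ideal2[of g h]]
      by (intro CollectI exI[of _ 0]) simp
  next
    fix x y assume "x \<in> J n" "y \<in> J n"
    then obtain i r i' r' where "x = i + z ^ n * r" "y = i' + z ^ n * r'" "i \<in> ?I" "i' \<in> ?I"
      unfolding J_def by blast
    then show "x + y \<in> J n" unfolding J_def using R2.subspace_add[OF subspace_ideal2, of i g h i']
      by (intro CollectI exI[of _ "i + i'"] exI[of _ "r + r'"]) (simp add: algebra_simps)
  next
    fix c x assume "x \<in> J n"
    then obtain i r where "x = i + z ^ n * r" "i \<in> ?I" unfolding J_def by blast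
    then show "const2 c * x \<in> J n" unfolding J_def using R2.subspace_scale[OF subspace_ideal2, of i g h c]
      by (intro CollectI exI[of _ "const2 c * i"] exI[of _ "const2 c * r"]) (simp add: algebra_simps)
  qed
  have IJ: "?I \<subseteq> J n" for n
  proof
    fix i assume "i \<in> ?I" then show "i \<in> J n"
      unfolding J_def by (intro CollectI exI[of _ i] exI[of _ 0]) simp
  qed
  have JJ: "J (Suc n) \<subseteq> J n" for n
  proof
    fix x assume "x \<in> J (Suc n)"
    then obtain i r where "x = i + z ^ Suc n * r" "i \<in> ?I" unfolding J_def by blast
    then show "x \<in> J n" unfolding J_def by (intro CollectI exI[of _ i] exI[of _ "z * r"]) (simp add: algebra_simps)
  qed
  have "\<exists>n. J (Suc n) = J n"
  proof (rule ccontr)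
    assume "\<nexists>n. J (Suc n) = J n"
    then have ne: "R2.rdim (J (Suc n)) (J n) \<noteq> 0" for n
      using R2.rdim_0_imp_eq[OF sub sub JJ] by blast
    have "enat n \<le> R2.rdim (J n) UNIV" for n
    proof (induction n)
      case (Suc n)
      have "R2.rdim (J (Suc n)) UNIV = R2.rdim (J (Suc n)) (J n) + R2.rdim (J n) UNIV"
        by (rule R2.rdim_trans[OF sub sub R2.subspace_UNIV JJ]) simp
      moreover have "1 \<le> R2.rdim (J (Suc n)) (J n)" using ne[of n] by (simp add: ileI1 one_eSuc zero_less_iff_neq_zero)
      ultimately show ?case using Suc add_mono[of 1 _ "enat n"] by (metis eSuc_enat plus_1_eSuc(1))
    qed (simp add: zero_enat_def[symmetric])
    moreover have "R2.rdim (J n) UNIV \<le> imult g h" for n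
      unfolding imult_def by (rule R2.rdim_mono[OF subspace_ideal2 sub R2.subspace_UNIV IJ]) simp
    ultimately have "enat n \<le> imult g h" for n using order_trans by blast
    then show False using fin by (metis Suc_ile_eq enat.exhaust linorder_not_less order_refl)
  qed
  then obtain n where n: "J (Suc n) = J n" by blast
  have "z ^ n \<in> J n" unfolding J_def using R2.subspace_0[OF subspace_ideal2[of g h]]
    by (intro CollectI exI[of _ 0] exI[of _ 1]) simp
  then obtain i r where ir: "i \<in> ?I" "z ^ n = i + z ^ Suc n * r" unfolding n[symmetric] by (auto simp: J_def)
  have "(1 - z * r) dvd 1" using z by (simp add: is_unit_fps2_iff)
  then obtain v where v: "1 = (1 - z * r) * v" by (rule dvdE)
  obtain a b where ab: "i = a * g + b * h" using ir by (metis ideal2E)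
  have "i = z ^ n * (1 - z * r)" using ir(2) by (simp add: algebra_simps)
  then have "i * v = z ^ n" using v by (metis mult.assoc mult_1_right)
  then have "z ^ n = (v * a) * g + (v * b) * h" unfolding ab by (simp add: algebra_simps)
  then show thesis by (intro that ideal2I)
qed

text \<open>Finite colength makes h a non-zero-divisor modulo g. Some powers of x and y lie in the
  ideal, so g divides both x^M b and y^N b; as x^M and y^N have no common factor, g divides
  b.\<close>

lemma dvd_mult_cancel_finite:
  assumes fin: "imult g h \<noteq> \<infinity>" and dvd: "g dvd h * b" shows "g dvd b"
proof -
  have *: "\<exists>N c. z ^ N * b = g * c" if z: "coeff2 z 0 0 = 0" for z
  proof -
    obtain N a c where "z ^ N = a * g + c * h"
      using power_in_ideal2[OF fin z] by (metis ideal2E)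
    then have "z ^ N * b = a * b * g + c * (h * b)" by (simp add: algebra_simps)
    then have "g dvd z ^ N * b" using dvd by simp
    then show ?thesis by (metis dvd_def)
  qed
  obtain M c where c: "X2 ^ M * b = g * c" using *[of X2] by (auto simp: X2_def)
  obtain N c' where c': "Y2 ^ N * b = g * c'" using *[of Y2] by (auto simp: Y2_def)
  show ?thesis
  proof (cases "g = 0")
    case True
    then show ?thesis using c by simp
  next
    case False
    have "g * (Y2 ^ N * c) = g * (X2 ^ M * c')"
      using c c' by (metis mult.left_commute)
    then have "X2 ^ M dvd Y2 ^ N * c" using False by simp
    then have "coeff2 (Y2 ^ N * c) i (j + N) = 0" if "i < M" for i j
      unfolding X2_power_dvd_iff using that by blast
    then have "X2 ^ M dvd c" unfolding X2_power_dvd_iff by simp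
    then obtain e where "c = X2 ^ M * e" by (rule dvdE)
    then have "X2 ^ M * b = X2 ^ M * (g * e)" using c by (simp add: mult_ac)
    then have "b = g * e" by simp
    then show ?thesis by simp
  qed
qed

text \<open>In the chain from (f, g h) through (f, g) to the whole ring, multiplication by g
  identifies K[[x,y]]/(f, h) with the lower quotient. Injectivity uses finiteness of i(f, g);
  otherwise both sides are infinite.\<close>

lemma imult_mult: "imult f (g * h) = imult f g + imult f h"
proof -
  have le: "ideal2 f (g * h) \<subseteq> ideal2 f g" by (rule ideal2_dvd_mono) auto
  have eq: "imult f (g * h) = R2.rdim (ideal2 f (g * h)) (ideal2 f g) + imult f g"
    unfolding imult_def by (rule R2.rdim_trans) (auto simp: subspace_ideal2 R2.subspace_UNIV le)
  show ?thesis
  proof (cases "imult f g = \<infinity>")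
    case False
    have "R2.rdim (ideal2 f h) UNIV = R2.rdim (ideal2 f (g * h)) (ideal2 f g)"
    proof (rule R2.rdim_map[OF R2_linear_mult[of g]])
      show "g * v \<in> ideal2 f g" for v by (rule ideal2I[of _ 0 _ v]) simp
      show "\<exists>v\<in>UNIV. w - g * v \<in> ideal2 f (g * h)" if w: "w \<in> ideal2 f g" for w
      proof -
        obtain a b where "w = a * f + b * g" using w by (rule ideal2E)
        then have "w - g * b \<in> ideal2 f (g * h)" by (intro ideal2I[of _ a _ 0]) simp
        then show ?thesis by blast
      qed
      show "v \<in> ideal2 f h" if v: "g * v \<in> ideal2 f (g * h)" for v
      proof -
        obtain a b where "g * v = a * f + b * (g * h)" using v by (rule ideal2E)
        then have "g * (v - b * h) = f * a" by (simp add: algebra_simps)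
        then have "f dvd g * (v - b * h)" by simp
        then have "f dvd v - b * h" by (rule dvd_mult_cancel_finite[OF False])
        then obtain u where "v - b * h = f * u" by (rule dvdE)
        then show ?thesis by (intro ideal2I[of _ u _ b]) (simp add: algebra_simps)
      qed
      show "g * v \<in> ideal2 f (g * h)" if v: "v \<in> ideal2 f h" for v
      proof -
        obtain a b where "v = a * f + b * h" using v by (rule ideal2E)
        then show ?thesis by (intro ideal2I[of _ "g * a" _ b]) (simp add: algebra_simps)
      qed
    qed (auto simp: subspace_ideal2 R2.subspace_UNIV le)
    then show ?thesis using eq by (simp add: imult_def add.commute)
  qed (simp add: eq)
qed

lemma imult_mult_left: "imult (f * g) h = imult f h + imult g h"
  using imult_mult[of h f g] by (simp add: imult_commute)

lemma imult_power: "imult f (g ^ n) = enat n * imult f g"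
  by (induction n) (simp_all add: imult_mult imult_unit[of 1] imult_commute[of f 1] distrib_right zero_enat_def[symmetric] eSuc_enat[symmetric] mult_eSuc)

lemma imult_swap2: "imult (swap2 g) (swap2 h) = imult g h"
proof -
  have *: "swap2 v \<in> ideal2 (swap2 g) (swap2 h)" if "v \<in> ideal2 g h" for v g h :: "'a fps2"
  proof -
    obtain a b where "v = a * g + b * h" using \<open>v \<in> _\<close> by (rule ideal2E)
    then show ?thesis by (intro ideal2I[of _ "swap2 a" _ "swap2 b"]) (simp add: swap2_add swap2_mult)
  qed
  have "R2.rdim (ideal2 g h) UNIV = R2.rdim (ideal2 (swap2 g) (swap2 h)) UNIV"
  proof (rule R2.rdim_map[OF R2_linear_swap2])
    show "\<exists>v\<in>UNIV. w - swap2 v \<in> ideal2 (swap2 g) (swap2 h)" for w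
      by (rule bexI[of _ "swap2 w"]) (auto intro: ideal2I[of _ 0 _ 0])
    show "v \<in> ideal2 g h" if "swap2 v \<in> ideal2 (swap2 g) (swap2 h)" for v
      using *[OF that] by simp
  qed (use * in \<open>auto simp: subspace_ideal2 R2.subspace_UNIV\<close>)
  then show ?thesis by (simp add: imult_def)
qed

lemma imult_X2_Y2: "imult X2 (Y2 :: 'k::field fps2) = 1"
proof -
  have I: "f \<in> ideal2 X2 Y2 \<longleftrightarrow> coeff2 f 0 0 = 0" for f :: "'k fps2"
  proof
    assume "coeff2 f 0 0 = 0"
    then have "f = X2 * Abs_fps (\<lambda>j. if j = 0 then fps_shift 1 (f $ 0) else 0) + Y2 * fps_shift 1 f"
      by (intro fps2_eqI) (auto simp: not_less)
    then show "f \<in> ideal2 X2 Y2" by (metis ideal2I mult.commute)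
  qed (auto elim!: ideal2E simp: X2_def Y2_def)
  have "R2.rdim (ideal2 X2 (Y2 :: 'k fps2)) UNIV = ecard {1 :: 'k fps2}"
  proof (rule R2.rdim_eq_ecard_complement[OF subspace_ideal2])
    show "R2.independent {1 :: 'k fps2}" by simp
    show "v = 0" if v: "v \<in> R2.span {1}" "v \<in> ideal2 X2 Y2" for v :: "'k fps2"
    proof -
      obtain c where "v = const2 c * 1" using v(1) unfolding R2.span_singleton by blast
      then show ?thesis using v(2) by (simp add: I const2_def)
    qed
    show "\<exists>s\<in>R2.span {1}. v - s \<in> ideal2 X2 Y2" for v :: "'k fps2"
      using R2.span_scale[OF R2.span_base[of 1 "{1}"], of "coeff2 v 0 0"]
      by (intro bexI[of _ "const2 (coeff2 v 0 0)"]) (auto simp: I const2_def)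
  qed
  then show ?thesis by (simp add: imult_def ecard_def one_enat_def)
qed

text \<open>Modulo x, the series H is y^k times a unit, where k is the order of H(0, y).\<close>

lemma imult_X2:
  assumes "at_x0 H \<noteq> 0" shows "imult X2 H = enat (subdegree (at_x0 H))"
proof -
  let ?k = "subdegree (at_x0 H)"
  obtain z where z: "fps_cutoff ?k H = X2 * z" using X2_dvd_cutoff[OF assms refl] by (rule dvdE)
  have "imult X2 H = imult X2 (Y2 ^ ?k * fps_shift ?k H + z * X2)"
    using cutoff_plus_shift[of H ?k] z by (simp add: algebra_simps)
  also have "\<dots> = enat ?k + imult X2 (fps_shift ?k H)"
    by (simp add: imult_add_mult imult_mult imult_power imult_X2_Y2)
  also have "imult X2 (fps_shift ?k H) = 0"
    using shift_unit[OF assms refl] by (metis imult_commute imult_unit)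
  finally show ?thesis by simp
qed

lemma imult_exc:
  assumes "on_exc d H \<noteq> 0" shows "imult (exc d) H = enat (subdegree (on_exc d H))"
proof (cases d)
  case Vertical
  then have "imult (exc d) H = imult X2 (swap2 H)"
    using imult_swap2[of X2 "swap2 H"] by simp
  then show ?thesis using assms Vertical imult_X2[of "swap2 H"] by (simp add: at_x0_swap2)
qed (use assms imult_X2 in simp)

section \<open>Intersection numbers across a chart\<close>

lemma unit2_mult_iff: "f * g dvd 1 \<longleftrightarrow> f dvd 1 \<and> g dvd (1 :: 'k::field fps2)"
  by (simp add: is_unit_fps2_iff)

text \<open>C is the preimage of the image of K[[x,y]]/(P) in K[[x,y]]/(H), and D that of its
  multiples by the transform of G. The chart identifies the quotient by (P, G) with C/D. Computing
  the codimension of D once through C and once through the ideal of H and the transform of G gives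
  the claim, because multiplication by that transform identifies the quotient by C with the quotient
  of this ideal by D.\<close>

lemma imult_eq_imult_chart:
  assumes k: "on_exc d H \<noteq> 0"
    and HP: "H dvd chart d P" and PA: "\<And>A. H dvd chart d A \<Longrightarrow> P dvd A"
    and cond: "\<And>B. \<exists>A Z. exc d ^ k * B = chart d A + Z * H"
  shows "imult P G = imult H (chart d G)"
proof -
  let ?g = "chart d G"
  define C where "C = {chart d A + Z * H | A Z. True}"
  define D where "D = {?g * c + Z * H | c Z. c \<in> C}"
  have CI: "chart d A + Z * H \<in> C" for A Z unfolding C_def by blast
  have DI: "c \<in> C \<Longrightarrow> ?g * c + Z * H \<in> D" for c Z unfolding D_def by blast
  have C: "R2.subspace C"
    unfolding R2.subspace_def
  proof (intro conjI allI ballI)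
    show "0 \<in> C" using CI[of 0 0] by simp
  next
    fix x y assume "x \<in> C" "y \<in> C"
    then obtain A Z A' Z' where "x = chart d A + Z * H" "y = chart d A' + Z' * H" unfolding C_def by blast
    then show "x + y \<in> C" using CI[of "A + A'" "Z + Z'"] by (simp add: chart_add algebra_simps del: chart_Vertical)
  next
    fix c x assume "x \<in> C"
    then obtain A Z where "x = chart d A + Z * H" unfolding C_def by blast
    then show "const2 c * x \<in> C" using CI[of "const2 c * A" "const2 c * Z"]
      by (simp add: chart_const2_mult distrib_left mult.assoc del: chart_Vertical)
  qed
  have D: "R2.subspace D"
    unfolding R2.subspace_def
  proof (intro conjI allI ballI)
    show "0 \<in> D" using DI[OF R2.subspace_0[OF C], of 0] by simp
  next
    fix x y assume "x \<in> D" "y \<in> D"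
    then obtain c Z c' Z' where "x = ?g * c + Z * H" "y = ?g * c' + Z' * H" "c \<in> C" "c' \<in> C" unfolding D_def by blast
    then show "x + y \<in> D" using DI[OF R2.subspace_add[OF C, of c c'], of "Z + Z'"] by (simp add: algebra_simps)
  next
    fix e x assume "x \<in> D"
    then obtain c Z where "x = ?g * c + Z * H" "c \<in> C" unfolding D_def by blast
    then show "const2 e * x \<in> D" using DI[OF R2.subspace_scale[OF C, of c e], of "const2 e * Z"]
      by (simp add: algebra_simps)
  qed
  have DC: "D \<subseteq> C"
  proof
    fix x assume "x \<in> D"
    then obtain c Z where x: "x = ?g * c + Z * H" "c \<in> C" unfolding D_def by blast
    then obtain A Z' where "c = chart d A + Z' * H" unfolding C_def by blast
    then have "x = chart d (G * A) + (?g * Z' + Z) * H"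
      using x by (simp add: chart_mult algebra_simps del: chart_Vertical)
    then show "x \<in> C" using CI by simp
  qed
  have DH: "D \<subseteq> ideal2 H ?g"
  proof
    fix x assume "x \<in> D"
    then obtain c Z where "x = ?g * c + Z * H" unfolding D_def by blast
    then show "x \<in> ideal2 H ?g" by (intro ideal2I[of _ Z _ c]) (simp add: algebra_simps)
  qed
  \<comment> \<open>C contains an ideal of finite colength, so its codimension may be cancelled in
    \<open>enat\<close>.\<close>
  have "ideal2 H (exc d ^ k) \<subseteq> C"
  proof
    fix x assume "x \<in> ideal2 H (exc d ^ k)"
    then obtain a b where x: "x = a * H + b * exc d ^ k" by (rule ideal2E)
    obtain A Z where "exc d ^ k * b = chart d A + Z * H" using cond by blast
    then have "x = chart d A + (a + Z) * H" using x by (simp add: algebra_simps)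
    then show "x \<in> C" using CI by simp
  qed
  then have le: "R2.rdim C UNIV \<le> imult H (exc d ^ k)"
    unfolding imult_def by (intro R2.rdim_mono subspace_ideal2 C R2.subspace_UNIV) auto
  have "imult H (exc d ^ k) \<noteq> \<infinity>"
    using k by (simp add: imult_power imult_commute[of H] imult_exc)
  with le have Cfin: "R2.rdim C UNIV \<noteq> \<infinity>" by (metis enat_ord_simps(5))
  have step1: "imult P G = R2.rdim D C"
    unfolding imult_def
  proof (rule R2.rdim_map[OF R2_linear_chart[of d]])
    show "chart d v \<in> C" for v using CI[of v 0] by simp
    show "\<exists>v\<in>UNIV. w - chart d v \<in> D" if w: "w \<in> C" for w
    proof -
      obtain A Z where "w = chart d A + Z * H" using w unfolding C_def by blast
      then have "w - chart d A \<in> D" using DI[OF R2.subspace_0[OF C], of Z] by simp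
      then show ?thesis by blast
    qed
    show "v \<in> ideal2 P G" if v: "chart d v \<in> D" for v
    proof -
      obtain c Z where cZ: "chart d v = ?g * c + Z * H" "c \<in> C" using v unfolding D_def by blast
      then obtain A Z' where "c = chart d A + Z' * H" unfolding C_def by blast
      then have "chart d (v - G * A) = H * (?g * Z' + Z)"
        using cZ by (simp add: chart_mult chart_diff algebra_simps del: chart_Vertical)
      then have "P dvd v - G * A" by (intro PA) simp
      then obtain u where "v - G * A = P * u" by (rule dvdE)
      then show ?thesis by (intro ideal2I[of _ u _ A]) (simp add: algebra_simps)
    qed
    show "chart d v \<in> D" if v: "v \<in> ideal2 P G" for v
    proof -
      obtain a b where "v = a * P + b * G" using v by (rule ideal2E)
      moreover obtain e where "chart d P = H * e" using HP by (rule dvdE)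
      ultimately have "chart d v = ?g * (chart d b + 0 * H) + (chart d a * e) * H"
        by (simp add: chart_add chart_mult algebra_simps del: chart_Vertical)
      then show ?thesis using DI[OF CI] by metis
    qed
  qed (auto simp: subspace_ideal2 R2.subspace_UNIV C D DC)
  have step2: "R2.rdim D C + R2.rdim C UNIV = R2.rdim D (ideal2 H ?g) + imult H ?g"
    unfolding imult_def
    using R2.rdim_trans[OF D C R2.subspace_UNIV DC] R2.rdim_trans[OF D subspace_ideal2 R2.subspace_UNIV DH]
    by simp
  show ?thesis
  \<comment> \<open>If this number is infinite, finiteness of the codimension of C forces C/D to be
    infinite as well. Cancelling the transform of G modulo H is possible in the finite case.\<close>
  proof (cases "imult H ?g = \<infinity>")
    case True
    then show ?thesis using step1 step2 Cfin by (cases "R2.rdim D C") auto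
  next
    case False
    have "R2.rdim C UNIV = R2.rdim D (ideal2 H ?g)"
    proof (rule R2.rdim_map[OF R2_linear_mult[of ?g]])
      show "?g * v \<in> ideal2 H ?g" for v by (rule ideal2I[of _ 0 _ v]) simp
      show "\<exists>v\<in>UNIV. w - ?g * v \<in> D" if w: "w \<in> ideal2 H ?g" for w
      proof -
        obtain a b where "w = a * H + b * ?g" using w by (rule ideal2E)
        then have "w - ?g * b \<in> D" using DI[OF R2.subspace_0[OF C], of a] by simp
        then show ?thesis by blast
      qed
      show "v \<in> C" if v: "?g * v \<in> D" for v
      proof -
        obtain c Z where cZ: "?g * v = ?g * c + Z * H" "c \<in> C" using v unfolding D_def by blast
        then have "?g * (v - c) = H * Z" by (simp add: algebra_simps)
        then have "H dvd ?g * (v - c)" by simp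
        then have "H dvd v - c" by (rule dvd_mult_cancel_finite[OF False])
        then obtain u where "v - c = H * u" by (rule dvdE)
        then have "v = c + (chart d 0 + u * H)" by (simp add: algebra_simps)
        then show ?thesis using R2.subspace_add[OF C cZ(2) CI] by metis
      qed
      show "?g * v \<in> D" if "v \<in> C" for v using DI[OF that, of 0] by simp
    qed (auto simp: subspace_ideal2 R2.subspace_UNIV C D DH)
    then show ?thesis using step1 step2 Cfin by (auto simp: add.commute enat_add_left_cancel)
  qed
qed

text \<open>A factor H of a strict transform descends to a factor P of F. With the whole strict
  transform as H this separates the tangents of F; with one of its prime factors it isolates a
  branch.\<close>

lemma descent_factor:
  fixes F :: "'k::field fps2"
  assumes F: "F \<noteq> 0" and HF: "H dvd st d F"
  obtains P F' where "F = P * F'" "mult2 P = subdegree (on_exc d H)" "H dvd st d P" "st d P dvd H"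
    "\<forall>d'. d' \<noteq> d \<longrightarrow> st d' P dvd 1"
    "\<forall>A. H dvd chart d A \<longrightarrow> P dvd A"
    "\<forall>G. imult P G = imult H (chart d G)"
proof -
  have "on_exc d H \<noteq> 0"
    using on_exc_st_nonzero[OF F, of d] HF by (auto elim!: dvdE)
  then obtain P where P: "P \<noteq> 0" "mult2 P = subdegree (on_exc d H)" "H dvd st d P" "st d P dvd H"
    "\<And>d'. d' \<noteq> d \<Longrightarrow> st d' P dvd 1"
    "\<And>A. H dvd chart d A \<Longrightarrow> P dvd A"
    "\<And>B. \<exists>A Z. exc d ^ subdegree (on_exc d H) * B = chart d A + Z * H"
    using descent[OF _ refl, of d H] by metis
  have "H dvd chart d F" "H dvd chart d P"
    unfolding chart_eq_st using HF P(3) by simp_all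
  moreover from this have "P dvd F" by (intro P(6))
  then obtain F' where "F = P * F'" by (rule dvdE)
  moreover have "imult P G = imult H (chart d G)" for G
    using imult_eq_imult_chart[OF \<open>on_exc d H \<noteq> 0\<close> \<open>H dvd chart d P\<close>] P(6,7) by metis
  ultimately show thesis using that P by metis
qed

section \<open>Tangents and Noether's formula\<close>

text \<open>The only use of algebraic closedness: a form of positive degree has a zero on the projective line.\<close>

lemma exists_tangent:
  fixes F :: "'k::alg_closed_field fps2"
  assumes F: "F \<noteq> 0" "\<not> F dvd 1"
  obtains d where "\<not> st d F dvd 1"
proof -
  let ?m = "mult2 F" and ?p = "tform (mult2 F) F"
  have m: "?m \<noteq> 0" using mult2_eq_0_iff F by blast
  have p: "?p \<noteq> 0" by (rule tform_mult2_nonzero[OF F(1)])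
  show thesis
  proof (cases "degree ?p = 0")
    case True
    then have "coeff ?p ?m = 0" using m by (simp add: coeff_eq_0 del: coeff_tform)
    then show thesis by (intro that[of Vertical]) (simp add: is_unit_fps2_iff st_0_0_Vertical del: coeff_tform)
  next
    case False
    then obtain t where "poly ?p t = 0" using alg_closed_imp_poly_has_root by blast
    then show thesis by (intro that[of "Slope t"]) (simp add: is_unit_fps2_iff st_0_0_Slope)
  qed
qed

text \<open>P collects the part of F with tangent d: its strict transform at d is associated to that
  of F, which leaves a unit for the cofactor. The multiplicity of P is positive since
  \<open>st d F\<close> is not a unit, so F' has smaller multiplicity; this drives the inductions
  below.\<close>

lemma split_tangent:
  fixes F :: "'k::alg_closed_field fps2"
  assumes F: "F \<noteq> 0" "\<not> F dvd 1"
  obtains d P F' where "F = P * F'" "P \<noteq> 0" "F' \<noteq> 0" "mult2 F' < mult2 F" "\<not> st d F dvd 1"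
    "mult2 P = subdegree (on_exc d (st d F))" "st d F dvd st d P" "st d P dvd st d F" "st d F' dvd 1"
    "\<forall>d'. d' \<noteq> d \<longrightarrow> st d' P dvd 1"
    "\<forall>G. imult P G = imult (st d F) (chart d G)"
proof -
  obtain d where d: "\<not> st d F dvd 1" using exists_tangent[OF F] by blast
  obtain P F' where P: "F = P * F'" "mult2 P = subdegree (on_exc d (st d F))" "st d F dvd st d P" "st d P dvd st d F"
    "\<forall>d'. d' \<noteq> d \<longrightarrow> st d' P dvd 1"
    "\<forall>G. imult P G = imult (st d F) (chart d G)"
    using descent_factor[OF F(1) dvd_refl, of d] by metis
  have nz: "P \<noteq> 0" "F' \<noteq> 0" using P F by auto
  have "subdegree (on_exc d (st d F)) \<noteq> 0"
    using d on_exc_st_nonzero[OF F(1), of d]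
    by (simp only: subdegree_eq_0_iff on_exc_nth_0) (simp add: is_unit_fps2_iff)
  then have "mult2 F' < mult2 F" using P mult2_mult[OF nz] by simp
  moreover have "st d F' dvd 1"
  proof -
    have st0: "st d P \<noteq> 0" using on_exc_st_nonzero[OF nz(1), of d] by auto
    have "st d P * st d F' dvd st d P" using P(3) st_mult[OF nz, of d] P(1) by simp
    then have "st d P * st d F' dvd st d P * 1" by simp
    then show ?thesis using st0 by (simp only: dvd_mult_cancel_left) simp
  qed
  ultimately show thesis using that P nz d by metis
qed

lemma finite_tangents:
  fixes F :: "'k::alg_closed_field fps2"
  assumes "F \<noteq> 0" shows "\<exists>S. finite S \<and> (\<forall>d. d \<notin> S \<longrightarrow> st d F dvd 1)"
  using assms
proof (induction "mult2 F" arbitrary: F rule: less_induct)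
  case less
  show ?case
  proof (cases "F dvd 1")
    case True
    then show ?thesis using st_dvd_1 by (intro exI[of _ "{}"]) auto
  next
    case False
    obtain d P F' where P: "F = P * F'" "P \<noteq> 0" "F' \<noteq> 0" "mult2 F' < mult2 F"
      "\<forall>d'. d' \<noteq> d \<longrightarrow> st d' P dvd 1"
      using split_tangent[OF less.prems False] by metis
    obtain S where S: "finite S" "\<forall>d. d \<notin> S \<longrightarrow> st d F' dvd 1"
      using less.hyps P by blast
    have "st d' F dvd 1" if "d' \<notin> insert d S" for d'
      using that P S by (simp add: st_mult unit2_mult_iff)
    then show ?thesis using S(1) by (intro exI[of _ "insert d S"]) auto
  qed
qed

text \<open>Noether's formula, in terms of total transforms of the second series.\<close>

lemma
  fixes F :: "'k::alg_closed_field fps2"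
  assumes "F \<noteq> 0" "finite S" "\<And>d. d \<notin> S \<Longrightarrow> st d F dvd 1"
  shows imult_eq_sum_chart: "imult F G = (\<Sum>d\<in>S. imult (st d F) (chart d G))"
    and mult2_eq_sum: "mult2 F = (\<Sum>d\<in>S. subdegree (on_exc d (st d F)))"
proof -
  have "imult F G = (\<Sum>d\<in>S. imult (st d F) (chart d G)) \<and> mult2 F = (\<Sum>d\<in>S. subdegree (on_exc d (st d F)))"
    using assms(1,3)
  proof (induction "mult2 F" arbitrary: F rule: less_induct)
    case less
    show ?case
    proof (cases "F dvd 1")
      case True
      have "subdegree (on_exc d (st d F)) = 0" for d
        using st_dvd_1[OF True, of d] by (simp add: is_unit_fps2_iff on_exc_nth_0)
      then show ?thesis using True st_dvd_1[OF True] mult2_eq_0_iff[OF less.prems(1)] by (simp add: imult_unit)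
    next
      case False
      obtain d P F' where P: "F = P * F'" "P \<noteq> 0" "F' \<noteq> 0" "mult2 F' < mult2 F" "\<not> st d F dvd 1"
        "mult2 P = subdegree (on_exc d (st d F))" "st d F dvd st d P" "st d P dvd st d F" "st d F' dvd 1"
        "\<forall>d'. d' \<noteq> d \<longrightarrow> st d' P dvd 1"
        "\<forall>G. imult P G = imult (st d F) (chart d G)"
        by (rule split_tangent[OF less.prems(1) False])
      have dS: "d \<in> S" using P less.prems by blast
      have "st d' F' dvd 1" if "d' \<notin> S" for d'
        using less.prems(2)[OF that] P(1) by (simp add: st_mult[OF P(2,3)] unit2_mult_iff)
      then have IH: "imult F' G = (\<Sum>d\<in>S. imult (st d F') (chart d G))"
        "mult2 F' = (\<Sum>d\<in>S. subdegree (on_exc d (st d F')))"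
        using less.hyps[OF P(4,3)] by blast+
      have other: "imult (st d' F) h = imult (st d' F') h" "subdegree (on_exc d' (st d' F)) = subdegree (on_exc d' (st d' F'))"
        if "d' \<noteq> d" for d' h
      proof -
        have u: "st d' P dvd 1" using P that by blast
        then show "imult (st d' F) h = imult (st d' F') h"
          by (simp add: P(1) st_mult[OF P(2,3)] imult_mult_left imult_unit)
        have "on_exc d' (st d' P) dvd 1" using u by (simp add: is_unit_fps2_iff on_exc_nth_0)
        then have "subdegree (on_exc d' (st d' P)) = 0" by simp
        then show "subdegree (on_exc d' (st d' F)) = subdegree (on_exc d' (st d' F'))"
          using on_exc_st_nonzero[OF P(2), of d'] on_exc_st_nonzero[OF P(3), of d']
          by (simp add: P(1) st_mult[OF P(2,3)])
      qed
      have u0: "subdegree (on_exc d (st d F')) = 0" "imult (st d F') h = 0" for h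
        using P(9) by (simp_all add: is_unit_fps2_iff on_exc_nth_0 imult_unit)
      have "imult F G = imult P G + imult F' G" by (simp add: P(1) imult_mult_left)
      also have "\<dots> = imult (st d F) (chart d G) + (\<Sum>d\<in>S - {d}. imult (st d F') (chart d G))"
        using P(11) IH(1) u0(2) sum.remove[OF assms(2) dS, of "\<lambda>d. imult (st d F') (chart d G)"] by simp
      also have "\<dots> = imult (st d F) (chart d G) + (\<Sum>d\<in>S - {d}. imult (st d F) (chart d G))"
        using other(1) by (intro arg_cong2[of _ _ _ _ "(+)"] sum.cong) auto
      also have "\<dots> = (\<Sum>d\<in>S. imult (st d F) (chart d G))"
        by (rule sum.remove[OF assms(2) dS, symmetric])
      finally have 1: "imult F G = (\<Sum>d\<in>S. imult (st d F) (chart d G))" .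
      have "mult2 F = mult2 P + mult2 F'" unfolding P(1) by (rule mult2_mult[OF P(2,3)])
      also have "\<dots> = subdegree (on_exc d (st d F)) + (\<Sum>d\<in>S - {d}. subdegree (on_exc d (st d F')))"
        using P(6) IH(2) u0(1) sum.remove[OF assms(2) dS, of "\<lambda>d. subdegree (on_exc d (st d F'))"] by simp
      also have "\<dots> = subdegree (on_exc d (st d F)) + (\<Sum>d\<in>S - {d}. subdegree (on_exc d (st d F)))"
        using other(2) by (intro arg_cong2[of _ _ _ _ "(+)"] sum.cong) auto
      also have "\<dots> = (\<Sum>d\<in>S. subdegree (on_exc d (st d F)))"
        by (rule sum.remove[OF assms(2) dS, symmetric])
      finally show ?thesis using 1 by blast
    qed
  qed
  then show "imult F G = (\<Sum>d\<in>S. imult (st d F) (chart d G))" "mult2 F = (\<Sum>d\<in>S. subdegree (on_exc d (st d F)))"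
    by blast+
qed

text \<open>Each of the n exceptional factors split off from the total transform of G meets
  \<open>st d F\<close> with the order of its restriction to the exceptional curve. By
  \<open>mult2_eq_sum\<close> these orders add up to the multiplicity of F.\<close>

lemma imult_transform:
  fixes F :: "'k::alg_closed_field fps2"
  assumes F: "F \<noteq> 0" and S: "finite S" "\<And>d. d \<notin> S \<Longrightarrow> st d F dvd 1" and G: "ord_ge n G"
  shows "imult F G = enat (n * mult2 F) + (\<Sum>d\<in>S. imult (st d F) (transform n d G))"
proof -
  have "imult F G = (\<Sum>d\<in>S. imult (st d F) (exc d ^ n * transform n d G))"
    using imult_eq_sum_chart[OF F S, of G] chart_eq_transform[OF G] by (simp del: chart_Vertical)
  also have "\<dots> = (\<Sum>d\<in>S. enat (n * subdegree (on_exc d (st d F))) + imult (st d F) (transform n d G))"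
    by (simp add: imult_mult imult_power imult_commute[of _ "exc _"] imult_exc on_exc_st_nonzero[OF F])
  also have "\<dots> = enat (n * mult2 F) + (\<Sum>d\<in>S. imult (st d F) (transform n d G))"
  proof -
    have "(\<Sum>d\<in>S. enat (h d)) = enat (\<Sum>d\<in>S. h d)" for h
      using S(1) by (induction S rule: finite_induct) (simp_all add: zero_enat_def)
    moreover have "n * mult2 F = (\<Sum>d\<in>S. n * subdegree (on_exc d (st d F)))"
      using mult2_eq_sum[OF F S] by (simp add: sum_distrib_left)
    ultimately show ?thesis by (simp add: sum.distrib)
  qed
  finally show ?thesis .
qed

section \<open>Branches\<close>

text \<open>Primality of the factors makes n an invariant of f, and primality is what descends along
  a chart.\<close>

definition prime_product :: "'k::field fps2 \<Rightarrow> nat \<Rightarrow> bool" where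
  "prime_product f n \<longleftrightarrow> (\<exists>A u. size A = n \<and> (\<forall>p\<in>#A. prime_elem p) \<and> u dvd 1 \<and> f = u * prod_mset A)"

lemma prime_imp_irreducible_fps2:
  assumes p: "prime_elem (p :: 'k::field fps2)" shows "irreducible p"
proof (rule irreducibleI)
  show "p \<noteq> 0" "\<not> p dvd 1" using p by (auto simp: prime_elem_def)
  have *: "b dvd 1" if ab: "p = a * b" "p dvd a" for a b
  proof -
    obtain c where "a = p * c" using ab(2) by (rule dvdE)
    then have "p * (c * b) = p * 1" by (metis ab(1) mult.assoc mult_1_right)
    then have "c * b = 1" using \<open>p \<noteq> 0\<close> by (simp only: mult_cancel_left) simp
    then show ?thesis by (metis dvd_triv_right)
  qed
  fix a b assume ab: "p = a * b"
  then have "p dvd a \<or> p dvd b" using p unfolding prime_elem_def by (metis dvd_refl)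
  then show "a dvd 1 \<or> b dvd 1" using *[of a b] *[of b a] ab by (auto simp: mult.commute)
qed

lemma prime_dvd_prod_mset:
  "prime_elem (p :: 'k::field fps2) \<Longrightarrow> p dvd prod_mset A \<Longrightarrow> \<exists>q\<in>#A. p dvd q"
proof (induction A)
  case empty
  then show ?case by (simp add: prime_elem_def)
next
  case (add q A)
  then have "p dvd q \<or> p dvd prod_mset A" by (simp add: prime_elem_def)
  then show ?case using add by auto
qed

text \<open>\<open>num_branches\<close> selects an arbitrary factorization into irreducibles, so a
  prime factorization is compared with an irreducible one: each prime divides some irreducible
  factor and is then associated to it.\<close>

lemma size_factorization_unique:
  fixes u v :: "'k::field fps2"
  assumes "\<forall>p\<in>#A. prime_elem p" "\<forall>q\<in>#B. irreducible q" "u dvd 1" "v dvd 1"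
    "u * prod_mset A = v * prod_mset B"
  shows "size A = size B"
  using assms
proof (induction A arbitrary: B u v)
  case empty
  then have unit: "prod_mset B dvd 1" by (simp add: unit2_mult_iff)
  have "B = {#}"
  proof (rule ccontr)
    assume "B \<noteq> {#}"
    then obtain q where q: "q \<in># B" by blast
    then have "q dvd prod_mset B" by (rule dvd_prod_mset)
    then have "q dvd 1" using unit by (rule dvd_trans)
    then show False using empty.prems(2) q by (auto simp: irreducible_def)
  qed
  then show ?case by simp
next
  case (add p A)
  have p: "prime_elem p" "p \<noteq> 0" "\<not> p dvd 1" using add.prems(1) by (auto simp: prime_elem_def)
  have "p dvd u * prod_mset (add_mset p A)" by simp
  then have "p dvd v * prod_mset B" unfolding add.prems(5) .
  then have "p dvd v \<or> p dvd prod_mset B" using p(1) by (simp add: prime_elem_def)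
  moreover have "\<not> p dvd v" using dvd_trans[OF _ add.prems(4)] p(3) by blast
  ultimately obtain q where q: "q \<in># B" "p dvd q" using prime_dvd_prod_mset[OF p(1)] by blast
  then obtain w where w: "q = p * w" by (metis dvdE)
  have "p dvd 1 \<or> w dvd 1" using add.prems(2) q(1) w by (simp add: irreducible_def)
  then have "w dvd 1" using p(3) by blast
  obtain B' where B': "B = add_mset q B'" using q(1) by (metis mset_add)
  have "p * (u * prod_mset A) = p * ((v * w) * prod_mset B')"
    using add.prems(5) w by (simp add: B' mult_ac)
  then have "u * prod_mset A = (v * w) * prod_mset B'" using p(2) by simp
  then have "size A = size B'"
    using add.prems \<open>w dvd 1\<close> by (intro add.IH[of B' u "v * w"]) (auto simp: B' unit2_mult_iff)
  then show ?case by (simp add: B')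
qed

lemma num_branches_eq:
  assumes "prime_product f n" shows "num_branches f = n"
proof -
  obtain A u where A: "size A = n" "\<forall>p\<in>#A. prime_elem p" "u dvd 1" "f = u * prod_mset A"
    using assms by (auto simp: prime_product_def)
  then have "irreducible_factorization f A"
    unfolding irreducible_factorization_def using prime_imp_irreducible_fps2 by blast
  then have "irreducible_factorization f (SOME A. irreducible_factorization f A)" by (rule someI)
  then obtain v where "\<forall>p\<in>#(SOME A. irreducible_factorization f A). irreducible p" "v dvd 1"
     "f = v * prod_mset (SOME A. irreducible_factorization f A)"
    unfolding irreducible_factorization_def by blast
  then have "size A = size (SOME A. irreducible_factorization f A)"
    using A by (intro size_factorization_unique[of A _ u v]) auto
  then show ?thesis using A(1) by (simp add: num_branches_def)
qed

lemma prime_product_unit: "u dvd 1 \<Longrightarrow> prime_product u 0"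
  unfolding prime_product_def by (intro exI[of _ "{#}"] exI[of _ u]) simp

lemma prime_product_0_iff: "prime_product u 0 \<longleftrightarrow> u dvd 1"
  by (auto simp: prime_product_def)

lemma prime_product_prime_mult: "prime_elem p \<Longrightarrow> prime_product f n \<Longrightarrow> prime_product (p * f) (Suc n)"
  unfolding prime_product_def
  by (elim exE conjE, rule_tac x = "add_mset p A" in exI, rule_tac x = u in exI) (simp add: mult_ac)

lemma prime_product_mult_unit: "u dvd 1 \<Longrightarrow> prime_product f n \<Longrightarrow> prime_product (u * f) n"
  unfolding prime_product_def
  by (elim exE conjE, rule_tac x = A in exI, rule_tac x = "u * ua" in exI) (simp add: mult_ac unit2_mult_iff)

lemma prime_product_cancel_unit:
  assumes u: "u dvd 1" and f: "prime_product (u * f) n" shows "prime_product f n"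
proof -
  obtain v where v: "1 = u * v" using u by (rule dvdE)
  then have "v dvd 1" by (metis dvd_triv_right)
  then have "prime_product (v * (u * f)) n" using f by (rule prime_product_mult_unit)
  moreover have "v * (u * f) = f" using v by (metis mult.assoc mult.commute mult_1)
  ultimately show ?thesis by simp
qed

text \<open>Induction on the total number of prime factors of the strict transforms. A prime p at d
  descends to some P such that P divides a series if and only if p divides its total transform,
  hence P is prime; dividing F by P removes one factor at d. Once none is left, F has no tangent and
  is a unit.\<close>

lemma prime_product_sum:
  fixes F :: "'k::alg_closed_field fps2"
  assumes "F \<noteq> 0" "finite S" "\<And>d. d \<notin> S \<Longrightarrow> st d F dvd 1" "\<And>d. d \<in> S \<Longrightarrow> prime_product (st d F) (r d)"
  shows "prime_product F (\<Sum>d\<in>S. r d)"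
  using assms(1,3,4)
proof (induction "\<Sum>d\<in>S. r d" arbitrary: F r)
  case 0
  then have "r d = 0" if "d \<in> S" for d using that assms(2) by simp
  then have "st d F dvd 1" for d using 0 by (metis prime_product_0_iff)
  then have "F dvd 1" using exists_tangent[OF 0(2)] by blast
  then show ?case using 0 by (simp add: prime_product_unit)
next
  case (Suc N)
  have "\<exists>d\<in>S. r d \<noteq> 0" using Suc(2) by (metis sum.neutral nat.distinct(1))
  then obtain d n where d: "d \<in> S" "r d = Suc n" by (metis not0_implies_Suc)
  obtain A u where A: "size A = Suc n" "\<forall>p\<in>#A. prime_elem p" "u dvd 1" "st d F = u * prod_mset A"
    using Suc.prems(3)[OF d(1)] unfolding d(2) prime_product_def by blast
  then obtain p A' where A': "A = add_mset p A'" by (metis size_eq_Suc_imp_eq_union)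
  have p: "prime_elem p" "p \<noteq> 0" "\<not> p dvd 1" using A(2) A' by (auto simp: prime_elem_def)
  have "p dvd st d F" using A(4) A' by simp
  then obtain P F' where P: "F = P * F'" "mult2 P = subdegree (on_exc d p)" "p dvd st d P" "st d P dvd p"
    "\<forall>d'. d' \<noteq> d \<longrightarrow> st d' P dvd 1" "\<forall>A. p dvd chart d A \<longrightarrow> P dvd A"
    using descent_factor[OF Suc.prems(1)] by metis
  have nz: "P \<noteq> 0" "F' \<noteq> 0" using P Suc.prems by auto
  obtain w where w: "st d P = p * w" using P(3) by (rule dvdE)
  obtain w' where "p = st d P * w'" using P(4) by (rule dvdE)
  then have "p * (w * w') = p * 1" using w by (simp add: mult_ac)
  then have ww: "w * w' = 1" using p(2) by (simp only: mult_cancel_left) simp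
  then have wu: "w dvd 1" by (metis dvd_triv_left)
  have "prime_elem P"
    unfolding prime_elem_def
  proof (intro conjI allI impI)
    show "P \<noteq> 0" by fact
    have "\<not> st d P dvd 1" unfolding w using p(3) by (simp add: unit2_mult_iff)
    then show "\<not> P dvd 1" using st_dvd_1 by blast
    fix a b assume "P dvd a * b"
    then obtain c where "a * b = P * c" by (rule dvdE)
    then have "chart d (a * b) = chart d (P * c)" by (rule arg_cong)
    then have "chart d a * chart d b = p * (exc d ^ mult2 P * w * chart d c)"
      unfolding chart_mult chart_eq_st[of d P] w by (simp only: mult_ac)
    then have "p dvd chart d a * chart d b" by simp
    then have "p dvd chart d a \<or> p dvd chart d b" using p(1) by (simp add: prime_elem_def del: chart_Vertical)
    then show "P dvd a \<or> P dvd b" using P(6) by blast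
  qed
  define r' where "r' = r(d := n)"
  have sum: "(\<Sum>d\<in>S. r d) = Suc (\<Sum>d\<in>S. r' d)"
  proof -
    have "(\<Sum>d\<in>S. r d) = r d + (\<Sum>e\<in>S - {d}. r e)" "(\<Sum>d\<in>S. r' d) = r' d + (\<Sum>e\<in>S - {d}. r' e)"
      using sum.remove[OF assms(2) d(1)] by blast+
    moreover have "(\<Sum>e\<in>S - {d}. r e) = (\<Sum>e\<in>S - {d}. r' e)" by (rule sum.cong) (auto simp: r'_def)
    moreover have "r' d = n" by (simp add: r'_def)
    ultimately show ?thesis using d(2) by presburger
  qed
  have st': "st e F = st e P * st e F'" for e unfolding P(1) by (rule st_mult[OF nz])
  have "prime_product F' (\<Sum>d\<in>S. r' d)"
  proof (rule Suc.hyps(1))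
    show "N = (\<Sum>d\<in>S. r' d)" using Suc.hyps(2) sum by simp
    show "F' \<noteq> 0" by fact
    show "st e F' dvd 1" if "e \<notin> S" for e using Suc.prems(2)[OF that] by (simp add: st' unit2_mult_iff)
    show "prime_product (st e F') (r' e)" if e: "e \<in> S" for e
    proof (cases "e = d")
      case True
      have "p * (w * st d F') = p * (u * prod_mset A')"
        using A(4) by (simp add: st' w A' mult_ac)
      then have "w * st d F' = u * prod_mset A'" using p(2) by simp
      moreover have "prime_product (u * prod_mset A') n"
        unfolding prime_product_def using A A' by auto
      ultimately show ?thesis using prime_product_cancel_unit[OF wu] True by (simp add: r'_def)
    next
      case False
      then show ?thesis
        using Suc.prems(3)[OF e] prime_product_cancel_unit[of "st e P" "st e F'"] P(5)
        by (simp add: st' r'_def)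
    qed
  qed
  then have "prime_product F (Suc (\<Sum>d\<in>S. r' d))"
    unfolding P(1) by (rule prime_product_prime_mult[OF \<open>prime_elem P\<close>])
  then show ?case unfolding sum .
qed

section \<open>The delta invariant\<close>

lemma strict_transform_Nil [simp]: "strict_transform f [] = f"
  by (simp add: strict_transform_def)

lemma strict_transform_Cons [simp]: "strict_transform f (d # Q) = strict_transform (st d f) Q"
  by (simp add: strict_transform_def)

lemma strict_transform_snoc: "strict_transform f (Q @ [d]) = st d (strict_transform f Q)"
  by (simp add: strict_transform_def)

lemma st_nonzero: "f \<noteq> 0 \<Longrightarrow> st d f \<noteq> 0"
  using on_exc_st_nonzero[of f d] by auto

lemma resolution_points_smooth:
  assumes "mult2 f \<le> 1" shows "resolution_points f = {[]}"
proof -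
  have "Q = []" if "Q \<in> resolution_points f" for Q
    using that by induction (use assms in auto)
  then show ?thesis using resolution_points.origin by blast
qed

text \<open>The inductive definition appends the last direction; recursion over the first blow-up
  needs the first direction split off.\<close>

lemma resolution_points_singular:
  assumes m: "mult2 f \<ge> 2"
  shows "resolution_points f = insert [] (\<Union>d\<in>{d. mult2 (st d f) \<ge> 1}. Cons d ` resolution_points (st d f))"
    (is "_ = ?R")
proof (intro subset_antisym subsetI)
  fix Q assume "Q \<in> resolution_points f"
  then show "Q \<in> ?R"
  proof induction
    case (blow_up Q d)
    show ?case
    proof (cases Q)
      case Nil
      then show ?thesis using blow_up resolution_points.origin[of "st d f"] by auto
    next
      case (Cons e Q')
      then have "Q' @ [d] \<in> resolution_points (st e f)"
        using blow_up by (intro resolution_points.blow_up) auto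
      then show ?thesis using Cons blow_up by auto
    qed
  qed simp
next
  fix Q assume "Q \<in> ?R"
  moreover have "d # Q' \<in> resolution_points f" if d: "mult2 (st d f) \<ge> 1" and "Q' \<in> resolution_points (st d f)" for d Q'
    using that(2)
  proof induction
    case origin
    then show ?case using resolution_points.blow_up[OF resolution_points.origin, of f d] m d by simp
  next
    case (blow_up Q e)
    then show ?case using resolution_points.blow_up[of "d # Q" f e] by simp
  qed
  ultimately show "Q \<in> resolution_points f" by (auto intro: resolution_points.origin)
qed

lemma delta_smooth:
  assumes "mult2 f \<le> 1" shows "delta_invariant f = 0"
proof -
  have "mult2 f * (mult2 f - 1) div 2 = 0" using assms by (cases "mult2 f") auto
  then show ?thesis
    unfolding delta_invariant_def resolution_points_smooth[OF assms]
    by (simp only: infsum_finite finite.intros sum.insert sum.empty strict_transform_Nil empty_iff zero_enat_def add_0_right) simp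
qed

lemma infsum_UNION_enat:
  fixes h :: "'a \<Rightarrow> enat"
  assumes "finite T" "\<And>d e. d \<in> T \<Longrightarrow> e \<in> T \<Longrightarrow> d \<noteq> e \<Longrightarrow> B d \<inter> B e = {}"
  shows "infsum h (\<Union>d\<in>T. B d) = (\<Sum>d\<in>T. infsum h (B d))"
  using assms
proof (induction T rule: finite_induct)
  case (insert d T)
  have "infsum h (B d \<union> (\<Union>d\<in>T. B d)) = infsum h (B d) + infsum h (\<Union>d\<in>T. B d)"
    using insert by (intro infsum_Un_disjoint) (simp_all, blast)
  then show ?case using insert by simp
qed simp

lemma mult2_le_subdegree:
  assumes "on_exc d f \<noteq> 0" shows "mult2 f \<le> subdegree (on_exc d f)"
proof (cases d)
  case (Slope t)
  then show ?thesis
    using nth_subdegree_nonzero[OF assms] mult2_le[of f "subdegree (on_exc d f)" 0]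
      mult2_le[of f 0 "subdegree (on_exc d f)"] by simp
next
  case Vertical
  then show ?thesis
    using nth_subdegree_nonzero[OF assms] mult2_le[of f "subdegree (on_exc d f)" 0]
      mult2_le[of f 0 "subdegree (on_exc d f)"] by (simp add: at_y0_def)
qed

lemma mult2_st_le:
  fixes F :: "'k::alg_closed_field fps2"
  assumes "F \<noteq> 0" shows "mult2 (st d F) \<le> mult2 F"
proof -
  obtain S where S: "finite S" "\<And>d. d \<notin> S \<Longrightarrow> st d F dvd 1" using finite_tangents[OF assms] by metis
  have "mult2 (st d F) \<le> subdegree (on_exc d (st d F))"
    by (rule mult2_le_subdegree[OF on_exc_st_nonzero[OF assms]])
  also have "\<dots> \<le> mult2 F"
    using mult2_eq_sum[OF assms, of "insert d S"] S by (simp add: sum.insert_remove)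
  finally show ?thesis .
qed

text \<open>The formula also holds where the resolution stops: multiplicities do not increase under
  blowing up, so for multiplicity at most 1 all terms vanish.\<close>

lemma delta_eq_sum:
  fixes F :: "'k::alg_closed_field fps2"
  assumes F: "F \<noteq> 0" and S: "finite S" "\<And>d. d \<notin> S \<Longrightarrow> st d F dvd 1"
  shows "delta_invariant F = enat (mult2 F * (mult2 F - 1) div 2) + (\<Sum>d\<in>S. delta_invariant (st d F))"
proof (cases "mult2 F \<le> 1")
  case True
  then have "delta_invariant (st d F) = 0" for d
    using mult2_st_le[OF F, of d] by (intro delta_smooth) simp
  moreover have "mult2 F * (mult2 F - 1) div 2 = 0"
    using True by (cases "mult2 F") auto
  ultimately show ?thesis using delta_smooth[OF True] by (simp add: zero_enat_def[symmetric])
next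
  case False
  let ?w = "\<lambda>f Q. enat (mult_at f Q * (mult_at f Q - 1) div 2)"
  let ?T = "{d. mult2 (st d F) \<ge> 1}"
  have TS: "?T \<subseteq> S" using S(2) mult2_eq_0_iff[OF st_nonzero[OF F]] by force
  then have finT: "finite ?T" using S(1) finite_subset by blast
  have rest: "delta_invariant (st d F) = 0" if "d \<notin> ?T" for d
    using that by (intro delta_smooth) simp
  have "delta_invariant F = infsum (?w F) (insert [] (\<Union>d\<in>?T. Cons d ` resolution_points (st d F)))"
    using False by (simp only: delta_invariant_def) (simp add: resolution_points_singular)
  also have "\<dots> = ?w F [] + infsum (?w F) (\<Union>d\<in>?T. Cons d ` resolution_points (st d F))"
    by (rule infsum_insert) auto
  also have "infsum (?w F) (\<Union>d\<in>?T. Cons d ` resolution_points (st d F))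
      = (\<Sum>d\<in>?T. infsum (?w F) (Cons d ` resolution_points (st d F)))"
    by (rule infsum_UNION_enat[OF finT]) auto
  also have "\<dots> = (\<Sum>d\<in>?T. delta_invariant (st d F))"
    by (rule sum.cong) (simp_all add: infsum_reindex delta_invariant_def o_def)
  also have "\<dots> = (\<Sum>d\<in>S. delta_invariant (st d F))"
    by (rule sum.mono_neutral_left[OF S(1) TS]) (use rest in auto)
  finally show ?thesis by simp
qed

lemma delta_mult_unit:
  assumes f: "f \<noteq> 0" and u: "u dvd 1" shows "delta_invariant (u * f) = delta_invariant f"
proof -
  have u0: "u \<noteq> 0" using u by auto
  have mult: "mult_at (u * f) Q = mult_at f Q" for Q
    using u u0 f
  proof (induction Q arbitrary: u f)
    case Nil
    then show ?case using mult2_eq_0_iff[OF Nil(2)] by (simp add: mult2_mult)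
  next
    case (Cons d Q)
    then show ?case using Cons.IH[of "st d u" "st d f"] by (simp add: st_mult st_dvd_1 st_nonzero)
  qed
  have "Q \<in> resolution_points g" if "Q \<in> resolution_points f" "\<And>Q. mult_at f Q = mult_at g Q" for f g Q
    using that(1) by induction (auto intro: resolution_points.intros simp: that(2))
  then have "resolution_points (u * f) = resolution_points f" using mult by (metis subset_antisym subsetI)
  then show ?thesis by (simp add: delta_invariant_def mult)
qed

lemma triangular_add: "(m + n) * (m + n - 1) div 2 = m * (m - 1) div 2 + n * (n - 1) div 2 + m * (n :: nat)"
proof -
  have "even (k * (k - 1))" for k :: nat by (cases k) auto
  then obtain a b where ab: "m * (m - 1) = 2 * a" "n * (n - 1) = 2 * b" by (metis evenE)
  have "(m + n) * (m + n - 1) = m * (m - 1) + n * (n - 1) + 2 * (m * n)"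
    by (cases m; cases n) (simp_all add: algebra_simps)
  then have "(m + n) * (m + n - 1) = 2 * (a + b + m * n)" unfolding ab by simp
  then show ?thesis unfolding ab by simp
qed

text \<open>Blowing up the origin adds the product of the two multiplicities to both sides, by
  \<open>triangular_add\<close> and by Noether's formula. If both series are non-units, this product
  is positive, so the intersection numbers of the strict transforms are smaller and induction
  applies.\<close>

lemma delta_mult:
  fixes F G :: "'k::alg_closed_field fps2"
  assumes "F \<noteq> 0" "G \<noteq> 0" "imult F G = enat n"
  shows "delta_invariant (F * G) = delta_invariant F + delta_invariant G + imult F G"
  using assms
proof (induction n arbitrary: F G rule: less_induct)
  case (less n)
  consider "F dvd 1" | "G dvd 1" | "\<not> F dvd 1" "\<not> G dvd 1" by blast
  then show ?case
  proof cases
    case 1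
    then have "delta_invariant F = 0" using mult2_eq_0_iff[OF less.prems(1)] by (simp add: delta_smooth)
    then show ?thesis using delta_mult_unit[OF less.prems(2) 1] 1 by (simp add: imult_unit)
  next
    case 2
    then have "delta_invariant G = 0" using mult2_eq_0_iff[OF less.prems(2)] by (simp add: delta_smooth)
    then show ?thesis using delta_mult_unit[OF less.prems(1) 2] 2 imult_unit[OF 2, of F]
      by (simp add: imult_commute[of F G] mult.commute[of F G])
  next
    case 3
    let ?m = "mult2 F" and ?n = "mult2 G"
    have pos: "?m > 0" "?n > 0" using 3 less.prems mult2_eq_0_iff by blast+
    obtain S1 S2 where S12: "finite S1" "\<And>d. d \<notin> S1 \<Longrightarrow> st d F dvd 1" "finite S2" "\<And>d. d \<notin> S2 \<Longrightarrow> st d G dvd 1"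
      using finite_tangents less.prems by metis
    define S where "S = S1 \<union> S2"
    have S: "finite S" "\<And>d. d \<notin> S \<Longrightarrow> st d F dvd 1" "\<And>d. d \<notin> S \<Longrightarrow> st d G dvd 1"
      using S12 by (auto simp: S_def)
    have eq: "imult F G = enat (?n * ?m) + (\<Sum>d\<in>S. imult (st d F) (st d G))"
      using imult_transform[OF less.prems(1) S(1,2) ord_ge_mult2[of G]] by (simp add: st_eq_transform)
    have IH: "delta_invariant (st d F * st d G) = delta_invariant (st d F) + delta_invariant (st d G) + imult (st d F) (st d G)"
      if d: "d \<in> S" for d
    proof -
      have "imult (st d F) (st d G) \<le> (\<Sum>d\<in>S. imult (st d F) (st d G))"
        by (rule member_le_sum[OF d]) (use S in auto)
      moreover have "(\<Sum>d\<in>S. imult (st d F) (st d G)) \<noteq> \<infinity>"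
        using eq less.prems(3) by (metis enat.distinct(1) plus_enat_simps(3))
      then obtain s where s: "(\<Sum>d\<in>S. imult (st d F) (st d G)) = enat s" by auto
      ultimately obtain k where k: "imult (st d F) (st d G) = enat k" "k \<le> s"
        by (cases "imult (st d F) (st d G)") auto
      have "n = ?n * ?m + s" using eq less.prems(3) s by simp
      then have "k < n" using k pos by (metis add_less_cancel_right add_0 le_less_trans nat_0_less_mult_iff)
      then show ?thesis using less.IH k less.prems st_nonzero by blast
    qed
    have FG: "F * G \<noteq> 0" using less.prems by simp
    have "delta_invariant (F * G)
        = enat (mult2 (F * G) * (mult2 (F * G) - 1) div 2) + (\<Sum>d\<in>S. delta_invariant (st d (F * G)))"
      by (rule delta_eq_sum[OF FG S(1)]) (use S less.prems in \<open>simp add: st_mult unit2_mult_iff\<close>)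
    also have "(\<Sum>d\<in>S. delta_invariant (st d (F * G)))
        = (\<Sum>d\<in>S. delta_invariant (st d F)) + (\<Sum>d\<in>S. delta_invariant (st d G)) + (\<Sum>d\<in>S. imult (st d F) (st d G))"
      using IH less.prems by (simp add: st_mult flip: sum.distrib)
    also have "enat (mult2 (F * G) * (mult2 (F * G) - 1) div 2)
        = enat (?m * (?m - 1) div 2) + enat (?n * (?n - 1) div 2) + enat (?n * ?m)"
      by (simp only: mult2_mult[OF less.prems(1,2)] triangular_add plus_enat_simps(1) mult.commute[of ?n ?m])
    finally have "delta_invariant (F * G) = enat (?m * (?m - 1) div 2) + enat (?n * (?n - 1) div 2) + enat (?n * ?m)
      + ((\<Sum>d\<in>S. delta_invariant (st d F)) + (\<Sum>d\<in>S. delta_invariant (st d G)) + (\<Sum>d\<in>S. imult (st d F) (st d G)))" .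
    moreover have "delta_invariant F = enat (?m * (?m - 1) div 2) + (\<Sum>d\<in>S. delta_invariant (st d F))"
      by (rule delta_eq_sum) (use less.prems S in auto)
    moreover have "delta_invariant G = enat (?n * (?n - 1) div 2) + (\<Sum>d\<in>S. delta_invariant (st d G))"
      by (rule delta_eq_sum) (use less.prems S in auto)
    ultimately show ?thesis by (simp only: eq ac_simps)
  qed
qed

text \<open>The curve z = 0 reproduces itself at d, so its square divides the strict transform at
  every point of the infinite sequence d, d, ... and each of them contributes at least 1.\<close>

lemma delta_infinite:
  fixes z :: "'k::alg_closed_field fps2"
  assumes z: "z \<noteq> 0" "mult2 z = 1" "st d z = z" and f: "f \<noteq> 0" "z ^ 2 dvd f"
  shows "delta_invariant f = \<infinity>"
proof -
  have ge: "mult2 g \<ge> 2" if g: "g \<noteq> 0" "z ^ 2 dvd g" for g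
  proof -
    obtain h where h: "g = z * (z * h)" using g(2) by (metis dvdE power2_eq_square mult.assoc)
    then have "h \<noteq> 0" using g by auto
    then show ?thesis using z by (simp add: h mult2_mult)
  qed
  define Q where "Q n = replicate n d" for n
  have Q: "Q n \<in> resolution_points f \<and> strict_transform f (Q n) \<noteq> 0 \<and> z ^ 2 dvd strict_transform f (Q n)" for n
  proof (induction n)
    case 0
    then show ?case using f by (simp add: Q_def resolution_points.origin)
  next
    case (Suc n)
    let ?g = "strict_transform f (Q n)"
    have QS: "Q (Suc n) = Q n @ [d]" by (simp add: Q_def replicate_append_same)
    have nz: "st d ?g \<noteq> 0" using Suc st_nonzero by blast
    obtain h where h: "?g = z * (z * h)" using Suc by (metis dvdE power2_eq_square mult.assoc)
    then have "h \<noteq> 0" using Suc by auto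
    then have "st d ?g = z ^ 2 * st d h" using z by (simp add: h st_mult power2_eq_square mult.assoc)
    then have dvd: "z ^ 2 dvd st d ?g" by simp
    have "Q n @ [d] \<in> resolution_points f"
      using Suc ge[of ?g] ge[OF nz dvd] by (intro resolution_points.blow_up) (auto simp: strict_transform_snoc)
    then show ?case using nz dvd by (simp add: QS strict_transform_snoc)
  qed
  let ?w = "\<lambda>Q. enat (mult_at f Q * (mult_at f Q - 1) div 2)"
  have "inj Q" by (rule injI) (metis Q_def length_replicate)
  then have inf: "infinite (range Q)" by (simp add: finite_image_iff)
  have "1 \<le> ?w (Q n)" for n
  proof -
    have "mult_at f (Q n) \<ge> 2" using ge Q by blast
    then have "2 * 1 \<le> mult_at f (Q n) * (mult_at f (Q n) - 1)" by (intro mult_mono) auto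
    then show ?thesis by (simp add: one_enat_def)
  qed
  then have "infsum ?w (range Q) = \<infinity>"
    using infsum_superconst_infinite_enat[of "range Q" 1 ?w] inf by auto
  moreover have "resolution_points f = range Q \<union> (resolution_points f - range Q)" using Q by auto
  then have "delta_invariant f = infsum ?w (range Q) + infsum ?w (resolution_points f - range Q)"
    unfolding delta_invariant_def by (subst (1) \<open>resolution_points f = _\<close>) (rule infsum_Un_disjoint, auto)
  ultimately show ?thesis by simp
qed

section \<open>Nondegeneracy with respect to weights\<close>

text \<open>Unlike a partial derivative, x d/dx multiplies each monomial by an exponent. It keeps
  supports inside the Newton polyhedron and is compatible with monomial substitutions.\<close>

definition theta_x :: "'k::field fps2 \<Rightarrow> 'k fps2" where
  "theta_x f = X2 * deriv_x f"

definition theta_y :: "'k::field fps2 \<Rightarrow> 'k fps2" where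
  "theta_y f = Y2 * deriv_y f"

lemma coeff2_theta_x [simp]: "coeff2 (theta_x f) i j = of_nat i * coeff2 f i j"
  by (cases i) (simp_all add: theta_x_def deriv_x_def)

lemma coeff2_theta_y [simp]: "coeff2 (theta_y f) i j = of_nat j * coeff2 f i j"
proof (cases j)
  case (Suc k)
  have "(of_nat (Suc k) * f $ Suc k) $ i = of_nat (Suc k) * f $ Suc k $ i"
    by (simp add: fps_of_nat[symmetric] del: of_nat_Suc)
  then show ?thesis using Suc by (simp add: theta_y_def deriv_y_def)
qed (simp add: theta_y_def Y2_def)

definition weight_sum :: "nat \<Rightarrow> nat \<Rightarrow> nat \<Rightarrow> 'k::field fps2 \<Rightarrow> 'k \<Rightarrow> 'k \<Rightarrow> 'k" where
  "weight_sum u v n f a b = (\<Sum>(i, j) \<in> {(i, j). u * i + v * j = n}. coeff2 f i j * a ^ i * b ^ j)"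

definition weight :: "nat \<Rightarrow> nat \<Rightarrow> 'k::field fps2 \<Rightarrow> nat" where
  "weight u v f = (LEAST n. \<exists>i j. coeff2 f i j \<noteq> 0 \<and> n = u * i + v * j)"

text \<open>For positive weights \<open>(u, v)\<close> the terms of weight \<open>weight u v g\<close> are those on a compact face
  of the Newton polyhedron of \<open>g\<close>, and every compact face arises in this way. The series in \<open>L\<close> are
  supported in this polyhedron and their restrictions to its compact faces have no common zero in the torus.\<close>

definition nondegenerate :: "'k::field fps2 \<Rightarrow> 'k fps2 set \<Rightarrow> bool" where
  "nondegenerate g L \<longleftrightarrow> (\<forall>u>0. \<forall>v>0.
     (\<forall>h\<in>L. \<forall>i j. coeff2 h i j \<noteq> 0 \<longrightarrow> weight u v g \<le> u * i + v * j) \<and>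
     (\<forall>a b. a \<noteq> 0 \<longrightarrow> b \<noteq> 0 \<longrightarrow> (\<exists>h\<in>L. weight_sum u v (weight u v g) h a b \<noteq> 0)))"

lemma nondegenerate_le:
  assumes "nondegenerate g L" "h \<in> L" "coeff2 h i j \<noteq> 0" "u > 0" "v > 0"
  shows "weight u v g \<le> u * i + v * j"
  using assms(1)[unfolded nondegenerate_def, rule_format, OF assms(4,5), THEN conjunct1, rule_format, OF assms(2,3)] .

lemma nondegenerate_weight_sum:
  assumes "nondegenerate g L" "u > 0" "v > 0" "a \<noteq> 0" "b \<noteq> 0"
  obtains h where "h \<in> L" "weight_sum u v (weight u v g) h a b \<noteq> 0"
  using assms(1)[unfolded nondegenerate_def, rule_format, OF assms(2,3), THEN conjunct2, rule_format, OF assms(4,5)] by blast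

lemma finite_weight: "u > 0 \<Longrightarrow> v > 0 \<Longrightarrow> finite {(i :: nat, j :: nat). u * i + v * j = n}"
proof (rule finite_subset[of _ "{..n} \<times> {..n}"])
  assume uv: "u > 0" "v > 0"
  show "{(i, j). u * i + v * j = n} \<subseteq> {..n} \<times> {..n}"
  proof clarify
    fix i j assume "n = u * i + v * j"
    moreover have "i \<le> u * i" "j \<le> v * j" using uv by simp_all
    ultimately show "i \<in> {..u * i + v * j} \<and> j \<in> {..u * i + v * j}"
      by (simp add: trans_le_add1 trans_le_add2)
  qed
qed simp

lemma weight_le: "coeff2 f i j \<noteq> 0 \<Longrightarrow> weight u v f \<le> u * i + v * j"
  unfolding weight_def by (rule Least_le) blast

lemma weight_witness:
  assumes "f \<noteq> 0" obtains i j where "coeff2 f i j \<noteq> 0" "weight u v f = u * i + v * j"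
proof -
  have "\<exists>i j. coeff2 f i j \<noteq> 0" using assms fps2_eqI[of f 0] by auto
  then have "\<exists>n i j. coeff2 f i j \<noteq> 0 \<and> n = u * i + v * j" by blast
  then have "\<exists>i j. coeff2 f i j \<noteq> 0 \<and> weight u v f = u * i + v * j"
    unfolding weight_def by (rule LeastI_ex)
  then show thesis using that by blast
qed

lemma weight_eqI:
  "coeff2 f i j \<noteq> 0 \<Longrightarrow> (\<And>i' j'. coeff2 f i' j' \<noteq> 0 \<Longrightarrow> u * i + v * j \<le> u * i' + v * j')
    \<Longrightarrow> weight u v f = u * i + v * j"
  unfolding weight_def by (rule Least_equality) blast+

lemma weight_1_1: "weight 1 1 f = mult2 f"
  unfolding weight_def mult2_def by (rule arg_cong[of _ _ Least]) (auto simp: fun_eq_iff)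

lemma weight_swap2: "weight u v (swap2 f) = weight v u f"
  unfolding weight_def coeff2_swap2 by (subst ex_comm) (simp only: add.commute)

lemma weight_sum_swap2: "weight_sum u v n (swap2 f) a b = weight_sum v u n f b a"
  unfolding weight_sum_def
  by (rule sum.reindex_bij_witness[of _ prod.swap prod.swap]) (auto simp: mult_ac add.commute)

lemma weight_sum_add: "weight_sum u v n (f + g) a b = weight_sum u v n f a b + weight_sum u v n g a b"
  by (simp add: weight_sum_def case_prod_unfold distrib_right sum.distrib)

lemma weight_sum_diff: "weight_sum u v n (f - g) a b = weight_sum u v n f a b - weight_sum u v n g a b"
  by (simp add: weight_sum_def case_prod_unfold left_diff_distrib sum_subtractf)

lemma weight_sum_const2_mult: "weight_sum u v n (const2 c * f) a b = c * weight_sum u v n f a b"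
  by (simp add: weight_sum_def case_prod_unfold sum_distrib_left mult.assoc)

text \<open>For the weights (1, 1), vanishing of the initial form at the torus point (1, t) means
  that t is the slope of a tangent.\<close>

lemma weight_sum_1_1: "weight_sum 1 1 m f 1 t = poly (tform m f) t"
proof -
  have "weight_sum 1 1 m f 1 t = (\<Sum>l\<le>m. coeff2 f (m - l) l * t ^ l)"
    unfolding weight_sum_def by (rule sum.reindex_bij_witness[of _ "\<lambda>l. (m - l, l)" snd]) auto
  then show ?thesis by (simp add: tform_def poly_sum poly_monom)
qed

lemma nondegenerate_swap2:
  assumes "nondegenerate g L" shows "nondegenerate (swap2 g) (swap2 ` L)"
  unfolding nondegenerate_def
proof (intro allI impI conjI ballI)
  fix u v :: nat assume uv: "u > 0" "v > 0"
  show "weight u v (swap2 g) \<le> u * i + v * j" if h: "h \<in> swap2 ` L" "coeff2 h i j \<noteq> 0" for h i j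
  proof -
    obtain f where f: "f \<in> L" "coeff2 f j i \<noteq> 0" using h by auto
    then have "weight v u g \<le> v * j + u * i" using assms uv by (intro nondegenerate_le)
    then show ?thesis by (simp add: weight_swap2 add.commute)
  qed
  fix a b :: 'a assume ab: "a \<noteq> 0" "b \<noteq> 0"
  then obtain f where f: "f \<in> L" "weight_sum v u (weight v u g) f b a \<noteq> 0"
    using nondegenerate_weight_sum[OF assms uv(2,1)] by blast
  then show "\<exists>h\<in>swap2 ` L. weight_sum u v (weight u v (swap2 g)) h a b \<noteq> 0"
    by (intro bexI[of _ "swap2 f"]) (auto simp: weight_swap2 weight_sum_swap2)
qed

lemma nondegenerate_ord_ge: "nondegenerate g L \<Longrightarrow> h \<in> L \<Longrightarrow> ord_ge (mult2 g) h"
  unfolding ord_ge_def weight_1_1[symmetric]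
  using nondegenerate_le[of g L h _ _ 1 1] by (force simp: not_le[symmetric])

section \<open>Nondegeneracy under blowing up\<close>

lemma coeff2_transform_Slope_0:
  "coeff2 (transform m (Slope 0) f) i j = (if j \<le> i + m then coeff2 f (i + m - j) j else 0)"
  by (simp add: coeff2_transform_Slope)

lemma coeff2_eq_transform:
  assumes "ord_ge m f" "coeff2 f i j \<noteq> 0"
  shows "m \<le> i + j" "coeff2 (transform m (Slope 0) f) (i + j - m) j = coeff2 f i j"
proof -
  show le: "m \<le> i + j" using assms by (auto simp: ord_ge_def not_less[symmetric])
  then show "coeff2 (transform m (Slope 0) f) (i + j - m) j = coeff2 f i j"
    by (simp add: coeff2_transform_Slope_0)
qed

text \<open>The chart moves the exponent (i, j) to (i + j - m, j) and the torus point (a, b) to (a,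
  a b). The weights (u, v) above thus correspond to (u, u + v) below, with a shift by u m.\<close>

lemma weight_sum_transform:
  assumes f: "ord_ge m f" and uv: "u > 0" "v > 0"
  shows "a ^ m * weight_sum u v n (transform m (Slope 0) f) a b = weight_sum u (u + v) (n + u * m) f a (a * b)"
proof -
  let ?h = "transform m (Slope 0) f"
  let ?A = "{(i, j). u * i + v * j = n \<and> j \<le> i + m}"
  let ?B = "{(i, j). u * i + (u + v) * j = n + u * m \<and> m \<le> i + j}"
  have "weight_sum u v n ?h a b = (\<Sum>(i, j) \<in> ?A. coeff2 ?h i j * a ^ i * b ^ j)"
    unfolding weight_sum_def
    by (rule sum.mono_neutral_right[OF finite_weight[OF uv]]) (auto simp: coeff2_transform_Slope_0 split: if_splits)
  then have "a ^ m * weight_sum u v n ?h a b = (\<Sum>(i, j) \<in> ?A. coeff2 f (i + m - j) j * a ^ (i + m) * b ^ j)"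
    by (simp add: sum_distrib_left case_prod_unfold coeff2_transform_Slope_0 power_add mult_ac cong: sum.cong)
      (rule sum.cong, auto simp: mult_ac)
  also have "\<dots> = (\<Sum>(i, j) \<in> ?B. coeff2 f i j * a ^ i * (a * b) ^ j)"
  proof (rule sum.reindex_bij_witness[of _ "\<lambda>(i, j). (i + j - m, j)" "\<lambda>(i, j). (i + m - j, j)"], goal_cases)
    case (2 p)
    then obtain i j where p: "p = (i, j)" "u * i + v * j = n" "j \<le> i + m" by blast
    have "u * (i + m - j) + (u + v) * j = u * ((i + m - j) + j) + v * j" by (simp only: distrib_left distrib_right)
    also have "\<dots> = n + u * m" using p by (simp add: distrib_left)
    finally show ?case using p by simp
  next
    case (4 p)
    then obtain i j where p: "p = (i, j)" "u * i + (u + v) * j = n + u * m" "m \<le> i + j" by blast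
    have "u * (i + j - m) + v * j + u * m = u * ((i + j - m) + m) + v * j" by (simp add: distrib_left)
    also have "\<dots> = n + u * m" using p by (simp add: distrib_left distrib_right)
    finally show ?case using p by simp
  next
    case (5 p)
    then obtain i j where p: "p = (i, j)" "u * i + v * j = n" "j \<le> i + m" by blast
    then have "a ^ (i + m) = a ^ (i + m - j) * a ^ j" by (simp flip: power_add)
    then show ?case using p by (simp add: power_mult_distrib mult_ac)
  qed auto
  also have "\<dots> = weight_sum u (u + v) (n + u * m) f a (a * b)"
    unfolding weight_sum_def
    by (rule sum.mono_neutral_left[OF finite_weight]) (use uv in \<open>auto dest: coeff2_eq_transform(1)[OF f]\<close>)
  finally show ?thesis .
qed

lemma weight_transform:
  assumes g: "g \<noteq> 0"
  shows "weight u (u + v) g = weight u v (st (Slope 0) g) + u * mult2 g"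
proof -
  let ?m = "mult2 g" and ?h = "transform (mult2 g) (Slope 0) g"
  obtain i j where ij: "coeff2 g i j \<noteq> 0" "weight u (u + v) g = u * i + (u + v) * j"
    by (rule weight_witness[OF g])
  have le: "?m \<le> i + j" and nz: "coeff2 ?h (i + j - ?m) j \<noteq> 0"
    using coeff2_eq_transform[OF ord_ge_mult2 ij(1)] ij(1) by simp_all
  have w: "u * (i + j - ?m) + v * j + u * ?m = weight u (u + v) g"
  proof -
    have "u * (i + j - ?m) + u * ?m = u * (i + j)" using le by (simp flip: distrib_left)
    then show ?thesis using ij(2) by (simp add: distrib_left distrib_right)
  qed
  have "weight u v ?h = u * (i + j - ?m) + v * j"
  proof (rule weight_eqI[OF nz])
    fix i' j' assume "coeff2 ?h i' j' \<noteq> 0"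
    then have "j' \<le> i' + ?m" "coeff2 g (i' + ?m - j') j' \<noteq> 0"
      by (auto simp: coeff2_transform_Slope_0 split: if_splits)
    then have "weight u (u + v) g \<le> u * (i' + ?m - j') + (u + v) * j'" by (intro weight_le)
    also have "\<dots> = u * ((i' + ?m - j') + j') + v * j'" by (simp only: distrib_left distrib_right)
    also have "\<dots> = u * i' + v * j' + u * ?m" using \<open>j' \<le> i' + ?m\<close> by (simp add: distrib_left)
    finally show "u * (i + j - ?m) + v * j \<le> u * i' + v * j'" using w by simp
  qed
  then show ?thesis using w by (simp add: st_eq_transform)
qed

text \<open>Positive weights (u, v) above correspond to positive weights (u, u + v) below, where the
  hypothesis on g applies.\<close>

lemma nondegenerate_transform:
  assumes g: "g \<noteq> 0" and nd: "nondegenerate g L"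
  shows "nondegenerate (st (Slope 0) g) (transform (mult2 g) (Slope 0) ` L)"
  unfolding nondegenerate_def
proof (intro allI impI conjI ballI)
  let ?m = "mult2 g"
  fix u v :: nat assume uv: "u > 0" "v > 0"
  then have uv': "u + v > 0" by simp
  show "weight u v (st (Slope 0) g) \<le> u * i + v * j"
    if h: "h \<in> transform ?m (Slope 0) ` L" "coeff2 h i j \<noteq> 0" for h i j
  proof -
    obtain f where f: "f \<in> L" "h = transform ?m (Slope 0) f" using h(1) by blast
    have "j \<le> i + ?m" "coeff2 f (i + ?m - j) j \<noteq> 0"
      using h(2) by (auto simp: f coeff2_transform_Slope_0 split: if_splits)
    then have "weight u (u + v) g \<le> u * (i + ?m - j) + (u + v) * j"
      using nd f(1) uv(1) uv' by (intro nondegenerate_le)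
    also have "\<dots> = u * ((i + ?m - j) + j) + v * j" by (simp only: distrib_left distrib_right)
    also have "\<dots> = u * i + v * j + u * ?m" using \<open>j \<le> i + ?m\<close> by (simp add: distrib_left)
    finally show ?thesis by (simp add: weight_transform[OF g])
  qed
  fix a b :: 'a assume ab: "a \<noteq> 0" "b \<noteq> 0"
  then have "a * b \<noteq> 0" by simp
  then obtain f where f: "f \<in> L" "weight_sum u (u + v) (weight u (u + v) g) f a (a * b) \<noteq> 0"
    using nondegenerate_weight_sum[OF nd uv(1) uv' ab(1)] by blast
  then have "a ^ ?m * weight_sum u v (weight u v (st (Slope 0) g)) (transform ?m (Slope 0) f) a b \<noteq> 0"
    using weight_sum_transform[OF nondegenerate_ord_ge[OF nd f(1)] uv] by (simp add: weight_transform[OF g])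
  then show "\<exists>h\<in>transform ?m (Slope 0) ` L. weight_sum u v (weight u v (st (Slope 0) g)) h a b \<noteq> 0"
    using f(1) by auto
qed

lemma nondegenerate_transform_Vertical:
  assumes g: "g \<noteq> 0" and nd: "nondegenerate g L"
  shows "nondegenerate (st Vertical g) (transform (mult2 g) Vertical ` L)"
proof -
  have "swap2 g \<noteq> 0" using g by (metis swap2_simps(1) swap2_swap2)
  then have "nondegenerate (st (Slope 0) (swap2 g)) (transform (mult2 (swap2 g)) (Slope 0) ` swap2 ` L)"
    using nondegenerate_swap2[OF nd] by (rule nondegenerate_transform)
  from nondegenerate_swap2[OF this] show ?thesis
    by (simp add: st_Vertical image_image transform_Vertical mult2_swap2)
qed

text \<open>The initial forms of g have no singular zero in the torus. Including g itself makes the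
  condition stable under blowing up.\<close>

abbreviation weakly_nondegenerate :: "'k::field fps2 \<Rightarrow> bool" where
  "weakly_nondegenerate g \<equiv> nondegenerate g {g, theta_x g, theta_y g}"

lemma weakly_nondegenerate_swap2: "weakly_nondegenerate g \<Longrightarrow> weakly_nondegenerate (swap2 g)"
proof -
  assume "weakly_nondegenerate g"
  then have "nondegenerate (swap2 g) (swap2 ` {g, theta_x g, theta_y g})" by (rule nondegenerate_swap2)
  moreover have "swap2 (theta_x g) = theta_y (swap2 g)" "swap2 (theta_y g) = theta_x (swap2 g)"
    by (rule fps2_eqI, simp)+
  ultimately show ?thesis by (simp add: insert_commute)
qed

lemma weakly_nondegenerate_st:
  assumes g: "g \<noteq> 0" and nd: "weakly_nondegenerate g"
  shows "weakly_nondegenerate (st (Slope 0) g)"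
proof -
  let ?m = "mult2 g" and ?h = "st (Slope 0) g"
  have nd': "nondegenerate ?h {?h, transform ?m (Slope 0) (theta_x g), transform ?m (Slope 0) (theta_y g)}"
    using nondegenerate_transform[OF g nd] by (simp add: st_eq_transform)
  \<comment> \<open>The monomial x^i y^j of the strict transform comes from the x-exponent i + m - j
    of g.\<close>
  have tx: "transform ?m (Slope 0) (theta_x g) = theta_x ?h - theta_y ?h + const2 (of_nat ?m) * ?h"
    by (rule fps2_eqI) (auto simp: st_eq_transform coeff2_transform_Slope_0 of_nat_diff algebra_simps)
  have ty: "transform ?m (Slope 0) (theta_y g) = theta_y ?h"
    by (rule fps2_eqI) (auto simp: st_eq_transform coeff2_transform_Slope_0)
  show ?thesis
    unfolding nondegenerate_def
  proof (intro allI impI conjI ballI)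
    fix u v :: nat assume uv: "u > 0" "v > 0"
    show "weight u v ?h \<le> u * i + v * j" if "f \<in> {?h, theta_x ?h, theta_y ?h}" "coeff2 f i j \<noteq> 0" for f i j
      using that by (intro weight_le) auto
    fix a b :: 'a assume ab: "a \<noteq> 0" "b \<noteq> 0"
    then have "\<exists>f\<in>{?h, transform ?m (Slope 0) (theta_x g), transform ?m (Slope 0) (theta_y g)}. weight_sum u v (weight u v ?h) f a b \<noteq> 0"
      using nondegenerate_weight_sum[OF nd' uv] by blast
    then show "\<exists>f\<in>{?h, theta_x ?h, theta_y ?h}. weight_sum u v (weight u v ?h) f a b \<noteq> 0"
      unfolding tx ty by (auto simp: weight_sum_add weight_sum_diff weight_sum_const2_mult)
  qed
qed

lemma weakly_nondegenerate_st_Vertical: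
  assumes g: "g \<noteq> 0" and nd: "weakly_nondegenerate g"
  shows "weakly_nondegenerate (st Vertical g)"
proof -
  have "swap2 g \<noteq> 0" using g by (metis swap2_simps(1) swap2_swap2)
  then have "weakly_nondegenerate (st (Slope 0) (swap2 g))"
    using weakly_nondegenerate_swap2[OF nd] by (rule weakly_nondegenerate_st)
  then show ?thesis unfolding st_Vertical by (rule weakly_nondegenerate_swap2)
qed

text \<open>By Euler's relation \<open>theta_x g\<close> and \<open>theta_y g\<close> have opposite
  values at a zero of the form of degree m. Hence one of them is nonzero only if
  \<open>theta_y g\<close> is, which says that t is a simple root.\<close>

lemma simple_torus_tangent:
  assumes g: "g \<noteq> 0" and nd: "weakly_nondegenerate g" and t: "t \<noteq> 0" "\<not> st (Slope t) g dvd 1"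
  shows "subdegree (at_x0 (st (Slope t) g)) = 1"
proof -
  let ?m = "mult2 g" and ?p = "tform (mult2 g) g"
  have 0: "poly ?p t = 0" using t(2) by (simp add: is_unit_fps2_iff st_0_0_Slope)
  have g0: "weight_sum 1 1 ?m g 1 t = 0" unfolding weight_sum_1_1 by (rule 0)
  have y: "weight_sum 1 1 ?m (theta_y g) 1 t = t * poly (pderiv ?p) t"
  proof -
    have "tform ?m (theta_y g) = pCons 0 (pderiv ?p)"
      by (rule poly_eqI) (auto simp: coeff_pCons coeff_pderiv split: nat.splits)
    then show ?thesis unfolding weight_sum_1_1 by simp
  qed
  have x: "weight_sum 1 1 ?m (theta_x g) 1 t = - weight_sum 1 1 ?m (theta_y g) 1 t"
  proof -
    have "tform ?m (theta_x g) + tform ?m (theta_y g) = smult (of_nat ?m) ?p"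
      by (rule poly_eqI) (auto simp: of_nat_diff algebra_simps)
    then have "poly (tform ?m (theta_x g) + tform ?m (theta_y g)) t = poly (smult (of_nat ?m) ?p) t" by simp
    then show ?thesis unfolding weight_sum_1_1 using 0 by (simp add: add_eq_0_iff2)
  qed
  obtain h where h: "h \<in> {g, theta_x g, theta_y g}" "weight_sum 1 1 ?m h 1 t \<noteq> 0"
    using nondegenerate_weight_sum[OF nd zero_less_one zero_less_one one_neq_zero t(1)] unfolding weight_1_1 by blast
  then have "poly (pderiv ?p) t \<noteq> 0" using x y g0 by auto
  moreover have "coeff (pcompose ?p [:t, 1:]) 1 = poly (pderiv ?p) t"
  proof -
    have "coeff (pcompose ?p [:t, 1:]) 1 = poly (pderiv (pcompose ?p [:t, 1:])) 0"
      by (simp add: poly_0_coeff_0 coeff_pderiv)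
    then show ?thesis by (simp add: pderiv_pcompose poly_pcompose pderiv_pCons)
  qed
  moreover have "coeff (pcompose ?p [:t, 1:]) 0 = 0"
    using 0 by (simp add: poly_0_coeff_0[symmetric] poly_pcompose)
  moreover have "at_x0 (st (Slope t) g) = fps_of_poly (pcompose ?p [:t, 1:])"
    using on_exc_transform_Slope[of t ?m g] by (simp add: st_eq_transform)
  ultimately show ?thesis by (intro subdegreeI) simp_all
qed

text \<open>Weierstrass division by h leaves remainders in K[[x]], so the quotient by h is the
  domain K[[x]].\<close>

lemma prime_elem_of_subdegree_1:
  assumes h: "subdegree (at_x0 h) = 1" shows "prime_elem (h :: 'k::field fps2)"
proof -
  have nz: "at_x0 h \<noteq> 0" using h by auto
  show ?thesis
    unfolding prime_elem_def
  proof (intro conjI allI impI)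
    show "h \<noteq> 0" using nz by auto
    have "at_x0 h $ 0 = 0" using h by (intro nth_less_subdegree_zero) simp
    then show "\<not> h dvd 1" by (simp add: is_unit_fps2_iff)
    fix a b assume ab: "h dvd a * b"
    have rem: "\<exists>q r. f = q * h + fps_const r" for f
    proof -
      obtain q where q: "fps_shift 1 (f - q * h) = 0" using weierstrass_division[OF nz h[symmetric]] by blast
      have "f - q * h = fps_const ((f - q * h) $ 0)"
      proof (rule fps_ext)
        fix n show "(f - q * h) $ n = fps_const ((f - q * h) $ 0) $ n"
          using arg_cong[OF q, of "\<lambda>f. f $ (n - 1)"] by (cases n) simp_all
      qed
      then show ?thesis by (metis add.commute diff_add_cancel)
    qed
    obtain q r q' r' where qr: "a = q * h + fps_const r" "b = q' * h + fps_const r'" using rem by metis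
    have "a * b = h * (q * q' * h + q * fps_const r' + q' * fps_const r) + fps_const (r * r')"
      unfolding qr by (simp add: algebra_simps flip: fps_const_mult)
    then have "h dvd fps_const (r * r')" using ab dvd_add_right_iff by (metis dvd_triv_left)
    then obtain z where z: "fps_const (r * r') = z * h" by (metis dvd_def mult.commute)
    have "fps_shift 1 (z * h) = 0" unfolding z[symmetric] by (rule fps_ext) simp
    then have "z = 0" by (rule weierstrass_division_unique[OF nz h[symmetric]])
    then have "fps_const (r * r') = 0" using z by simp
    then have "r = 0 \<or> r' = 0" by simp
    then show "h dvd a \<or> h dvd b" unfolding qr by auto
  qed
qed

text \<open>At a slope t other than 0 the transforms of F and G do not both vanish, since (1, t) is
  a torus point for the weights (1, 1). F must have exactly the order of g, so that dividing by that
  power yields its strict transform; G may have higher order.\<close>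

lemma imult_nondegenerate:
  fixes g F G :: "'k::alg_closed_field fps2"
  assumes nd: "nondegenerate g {F, G}" and F: "F \<noteq> 0" "mult2 F = mult2 g"
  shows "imult F G = enat (mult2 g * mult2 g)
    + imult (transform (mult2 g) (Slope 0) F) (transform (mult2 g) (Slope 0) G)
    + imult (transform (mult2 g) Vertical F) (transform (mult2 g) Vertical G)"
proof -
  let ?m = "mult2 g"
  obtain S' where S': "finite S'" "\<And>d. d \<notin> S' \<Longrightarrow> st d F dvd 1" using finite_tangents[OF F(1)] by metis
  define S where "S = S' \<union> {Slope 0, Vertical}"
  let ?i = "\<lambda>d. imult (st d F) (transform ?m d G)"
  have S: "finite S" "\<And>d. d \<notin> S \<Longrightarrow> st d F dvd 1" "{Slope 0, Vertical} \<subseteq> S"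
    using S' by (auto simp: S_def)
  have zero: "?i d = 0" if d: "d \<in> S - {Slope 0, Vertical}" for d
  proof -
    obtain t where t: "d = Slope t" "t \<noteq> 0" using d by (cases d) auto
    show ?thesis
    proof (cases "st d F dvd 1")
      case False
      then have "weight_sum 1 1 ?m F 1 t = 0"
        unfolding weight_sum_1_1 using t F(2) by (simp add: is_unit_fps2_iff st_0_0_Slope)
      then have "weight_sum 1 1 ?m G 1 t \<noteq> 0"
        using nondegenerate_weight_sum[OF nd zero_less_one zero_less_one one_neq_zero t(2)] unfolding weight_1_1 by blast
      then have "coeff2 (transform ?m d G) 0 0 \<noteq> 0"
        unfolding weight_sum_1_1 t(1) by (simp add: coeff2_transform_Slope poly_0_coeff_0[symmetric] poly_pcompose)
      then show ?thesis by (metis imult_commute imult_unit is_unit_fps2_iff)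
    qed (rule imult_unit)
  qed
  have "imult F G = enat (?m * mult2 F) + (\<Sum>d\<in>S. ?i d)"
    by (rule imult_transform[OF F(1) S(1,2) nondegenerate_ord_ge[OF nd]]) auto
  also have "(\<Sum>d\<in>S. ?i d) = (\<Sum>d\<in>{Slope 0, Vertical}. ?i d)"
    by (rule sum.mono_neutral_right[OF S(1,3)]) (use zero in auto)
  finally show ?thesis using F(2) by (simp add: st_eq_transform add.assoc)
qed

section \<open>The recursion under blowing up\<close>

lemma at_y0_chart_Slope_0: "at_y0 (chart (Slope 0) f) = at_y0 f"
  by (rule fps_ext) (simp add: at_y0_def coeff2_chart_Slope_0)

lemma at_y0_st_Slope_0: "at_y0 g = fps_X ^ mult2 g * at_y0 (st (Slope 0) g)"
proof -
  have "at_y0 g = at_y0 (X2 ^ mult2 g * st (Slope 0) g)"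
    using at_y0_chart_Slope_0[of g] chart_eq_st[of "Slope 0" g] by simp
  moreover have "at_y0 (X2 ^ mult2 g) = (fps_X :: 'a fps) ^ mult2 g"
    by (simp add: at_y0_def X2_def)
  ultimately show ?thesis by simp
qed

lemma at_x0_st_Vertical: "at_x0 g = fps_X ^ mult2 g * at_x0 (st Vertical g)"
  using at_y0_st_Slope_0[of "swap2 g"]
  by (simp add: at_y0_swap2 st_Vertical at_x0_swap2 mult2_swap2)

text \<open>Nondegeneracy at the torus point (1, 1) for the weights (1, 1) gives F or G a nonzero
  form in degree \<open>mult2 g\<close>. The lemma decides which of the two takes the first place in
  \<open>imult_nondegenerate\<close>.\<close>

lemma nondegenerate_exists_order:
  assumes nd: "nondegenerate g {F, G}"
  shows "(F \<noteq> 0 \<and> mult2 F = mult2 g) \<or> (G \<noteq> 0 \<and> mult2 G = mult2 g)"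
proof -
  obtain h where h: "h \<in> {F, G}" "poly (tform (mult2 g) h) 1 \<noteq> 0"
    using nondegenerate_weight_sum[OF nd zero_less_one zero_less_one one_neq_zero one_neq_zero]
    unfolding weight_1_1 weight_sum_1_1 by blast
  then have "tform (mult2 g) h \<noteq> 0" by auto
  then obtain l where "coeff (tform (mult2 g) h) l \<noteq> 0" by (metis leading_coeff_0_iff)
  then have l: "l \<le> mult2 g" "coeff2 h (mult2 g - l) l \<noteq> 0" by (auto split: if_splits)
  then have "h \<noteq> 0" "mult2 h \<le> mult2 g" using mult2_le[OF l(2)] by auto
  moreover have "mult2 g \<le> mult2 h"
  proof (rule ccontr)
    assume "\<not> mult2 g \<le> mult2 h"
    then have "tform (mult2 h) h = 0"
      using nondegenerate_ord_ge[OF nd h(1)] by (intro poly_eqI) (auto simp: ord_ge_def)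
    then show False using tform_mult2_nonzero[OF \<open>h \<noteq> 0\<close>] by simp
  qed
  ultimately show ?thesis using h(1) by auto
qed

text \<open>The induction is on the sum of the intersection numbers of g with the axes. In the unit
  case all the numbers involved are 0.\<close>

theorem imult_nondegenerate_eq:
  fixes g F G :: "'k::alg_closed_field fps2"
  assumes "at_x0 g \<noteq> 0" "at_y0 g \<noteq> 0" "weakly_nondegenerate g" "nondegenerate g {F, G}"
  shows "\<exists>n r e. delta_invariant g = enat n \<and> prime_product g r \<and> imult F G = enat e \<and>
    e + r = 2 * n + subdegree (at_y0 g) + subdegree (at_x0 g)"
  using assms
proof (induction "subdegree (at_y0 g) + subdegree (at_x0 g)" arbitrary: g F G rule: less_induct)
  case less
  let ?m = "mult2 g"
  have g: "g \<noteq> 0" using less.prems(1) by auto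
  show ?case
  proof (cases "g dvd 1")
    case True
    then have m: "?m = 0" using mult2_eq_0_iff[OF g] by simp
    then have "F dvd 1 \<or> G dvd 1"
      using nondegenerate_exists_order[OF less.prems(4)] mult2_eq_0_iff by metis
    then have "imult F G = 0" using imult_unit imult_commute by metis
    moreover have "subdegree (at_y0 g) = 0" "subdegree (at_x0 g) = 0"
      using True by (simp_all add: is_unit_fps2_iff at_y0_def)
    moreover have "delta_invariant g = 0" using m by (simp add: delta_smooth)
    ultimately show ?thesis using prime_product_unit[OF True]
      by (intro exI[of _ 0]) (simp add: zero_enat_def)
  next
    case False
    let ?g0 = "st (Slope 0) g" and ?g1 = "st Vertical g"
    have m: "?m > 0" using False mult2_eq_0_iff[OF g] by blast
    obtain S' where S': "finite S'" "\<And>d. d \<notin> S' \<Longrightarrow> st d g dvd 1" using finite_tangents[OF g] by metis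
    define S where "S = S' \<union> {Slope 0, Vertical}"
    define T where "T = S - {Slope 0, Vertical}"
    have S: "finite S" "\<And>d. d \<notin> S \<Longrightarrow> st d g dvd 1" and T: "finite T" and ST: "S = insert (Slope 0) (insert Vertical T)"
      using S' by (auto simp: S_def T_def)
    have sumS: "sum h S = h (Slope 0) + h Vertical + sum h T" for h :: "'k direction \<Rightarrow> 'b::comm_monoid_add"
      unfolding ST using T by (simp add: T_def add.assoc)
    define c where "c d = (if st d g dvd 1 then 0 else 1 :: nat)" for d
    have torus: "subdegree (on_exc d (st d g)) = c d" "delta_invariant (st d g) = 0" "prime_product (st d g) (c d)"
      if d: "d \<in> T" for d
    proof -
      obtain t where t: "d = Slope t" "t \<noteq> 0" using d by (cases d) (auto simp: T_def)
      have "subdegree (on_exc d (st d g)) = c d \<and> prime_product (st d g) (c d)"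
      proof (cases "st d g dvd 1")
        case True
        then show ?thesis by (simp add: c_def is_unit_fps2_iff on_exc_nth_0 prime_product_unit)
      next
        case False
        then have 1: "subdegree (at_x0 (st d g)) = 1"
          using simple_torus_tangent[OF g less.prems(3) t(2)] t(1) by simp
        then show ?thesis
          using False t(1) prime_product_prime_mult[OF prime_elem_of_subdegree_1[OF 1] prime_product_unit[of 1]]
          by (simp add: c_def)
      qed
      then show 1: "subdegree (on_exc d (st d g)) = c d" "prime_product (st d g) (c d)" by blast+
      have "mult2 (st d g) \<le> 1"
        using mult2_le_subdegree[OF on_exc_st_nonzero[OF g], of d] 1(1) by (simp add: c_def split: if_splits)
      then show "delta_invariant (st d g) = 0" by (rule delta_smooth)
    qed
    define b0 where "b0 = subdegree (at_x0 ?g0)"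
    define a1 where "a1 = subdegree (at_y0 ?g1)"
    define a0 where "a0 = subdegree (at_y0 ?g0)"
    define b1 where "b1 = subdegree (at_x0 ?g1)"
    define N where "N = sum c T"
    have mN: "?m = b0 + a1 + N"
    proof -
      have "?m = (\<Sum>d\<in>S. subdegree (on_exc d (st d g)))" by (rule mult2_eq_sum) (use g S in auto)
      also have "\<dots> = b0 + a1 + (\<Sum>d\<in>T. subdegree (on_exc d (st d g)))"
        unfolding sumS b0_def a1_def by simp
      finally show ?thesis using torus(1) by (simp add: N_def)
    qed
    have ne: "at_x0 ?g0 \<noteq> 0" "at_y0 ?g1 \<noteq> 0" "at_y0 ?g0 \<noteq> 0" "at_x0 ?g1 \<noteq> 0"
      using on_exc_st_nonzero[OF g, of "Slope 0"] on_exc_st_nonzero[OF g, of Vertical]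
        less.prems(1,2) at_y0_st_Slope_0[of g] at_x0_st_Vertical[of g] by auto
    have ab: "subdegree (at_y0 g) = ?m + a0" "subdegree (at_x0 g) = ?m + b1"
      using ne arg_cong[OF at_y0_st_Slope_0[of g], of subdegree] arg_cong[OF at_x0_st_Vertical[of g], of subdegree]
      by (simp_all add: a0_def b1_def)
    define F0 where "F0 = transform ?m (Slope 0) F"
    define G0 where "G0 = transform ?m (Slope 0) G"
    define F1 where "F1 = transform ?m Vertical F"
    define G1 where "G1 = transform ?m Vertical G"
    have nd: "nondegenerate ?g0 {F0, G0}" "nondegenerate ?g1 {F1, G1}"
      using nondegenerate_transform[OF g less.prems(4)] nondegenerate_transform_Vertical[OF g less.prems(4)]
      by (simp_all add: F0_def G0_def F1_def G1_def)
    have eq: "imult F G = enat (?m * ?m) + imult F0 G0 + imult F1 G1"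
    proof -
      consider "F \<noteq> 0" "mult2 F = ?m" | "G \<noteq> 0" "mult2 G = ?m"
        using nondegenerate_exists_order[OF less.prems(4)] by blast
      then show ?thesis
      proof cases
        case 1
        then show ?thesis using imult_nondegenerate[OF less.prems(4)] by (simp add: F0_def G0_def F1_def G1_def)
      next
        case 2
        have "nondegenerate g {G, F}" using less.prems(4) by (simp add: insert_commute)
        then show ?thesis using imult_nondegenerate[of g G F] 2
          by (simp add: F0_def G0_def F1_def G1_def imult_commute[of F] imult_commute[of "transform _ _ F"])
      qed
    qed
    \<comment> \<open>The old sum is (m + a0) + (m + b1), and b0 is at most m, so it drops by at
      least m, which is positive.\<close>
    have "a0 + b0 < subdegree (at_y0 g) + subdegree (at_x0 g)" using ab mN m by linarith
    then obtain n0 r0 e0 where 0: "delta_invariant ?g0 = enat n0" "prime_product ?g0 r0" "imult F0 G0 = enat e0"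
      "e0 + r0 = 2 * n0 + a0 + b0"
      using less.hyps[of ?g0 F0 G0] ne nd(1) weakly_nondegenerate_st[OF g less.prems(3)]
      unfolding a0_def b0_def by blast
    have "a1 + b1 < subdegree (at_y0 g) + subdegree (at_x0 g)" using ab mN m by linarith
    then obtain n1 r1 e1 where 1: "delta_invariant ?g1 = enat n1" "prime_product ?g1 r1" "imult F1 G1 = enat e1"
      "e1 + r1 = 2 * n1 + a1 + b1"
      using less.hyps[of ?g1 F1 G1] ne nd(2) weakly_nondegenerate_st_Vertical[OF g less.prems(3)]
      unfolding a1_def b1_def by blast
    define k where "k = ?m * (?m - 1) div 2"
    have k: "2 * k = ?m * (?m - 1)"
    proof -
      have "even (?m * (?m - 1))" by (cases ?m) auto
      then show ?thesis by (simp add: k_def)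
    qed
    have "delta_invariant g = enat k + (\<Sum>d\<in>S. delta_invariant (st d g))"
      unfolding k_def by (rule delta_eq_sum) (use g S in auto)
    then have delta: "delta_invariant g = enat (k + n0 + n1)"
      unfolding sumS using 0(1) 1(1) torus(2) by (simp add: add.assoc)
    define r where "r d = (if d = Slope 0 then r0 else if d = Vertical then r1 else c d)" for d
    have "prime_product g (\<Sum>d\<in>S. r d)"
    proof (rule prime_product_sum[OF g S])
      fix d assume "d \<in> S"
      then show "prime_product (st d g) (r d)"
        using 0(2) 1(2) torus(3)[of d] by (auto simp: r_def ST)
    qed
    moreover have "(\<Sum>d\<in>S. r d) = r0 + r1 + N"
    proof -
      have "sum r T = N" unfolding N_def by (rule sum.cong) (auto simp: r_def T_def)
      moreover have "r (Slope 0) = r0" "r Vertical = r1" by (simp_all add: r_def)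
      ultimately show ?thesis unfolding sumS by simp
    qed
    ultimately have pp: "prime_product g (r0 + r1 + N)" by simp
    have e: "imult F G = enat (?m * ?m + e0 + e1)" using eq 0(3) 1(3) by simp
    \<comment> \<open>This splits the Noether term m^2 into twice the contribution k of the origin
      to delta and a remaining m.\<close>
    have mm: "?m * ?m = 2 * k + ?m" unfolding k using m by (cases ?m) auto
    then have "(?m * ?m + e0 + e1) + (r0 + r1 + N) = 2 * (k + n0 + n1) + subdegree (at_y0 g) + subdegree (at_x0 g)"
      using 0(4) 1(4) mN unfolding ab mm by presburger
    then show ?thesis using delta pp e by blast
  qed
qed

section \<open>Newton diagrams\<close>

text \<open>The union of the open half-space above the supporting hyperplane with the hull of the
  points on it is convex and contains S.\<close>

lemma convex_hull_face_points:
  fixes \<phi> :: "real \<times> real \<Rightarrow> real"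
  assumes lin: "linear \<phi>" and S: "\<And>p. p \<in> S \<Longrightarrow> n \<le> \<phi> p"
  shows "convex hull S \<inter> {p. \<phi> p = n} = convex hull (S \<inter> {p. \<phi> p = n})"
proof (intro subset_antisym)
  let ?H = "convex hull (S \<inter> {p. \<phi> p = n})"
  have cv: "\<phi> (s *\<^sub>R x + t *\<^sub>R y) = s * \<phi> x + t * \<phi> y" for s t x y
    using lin by (simp add: linear_add linear_scale)
  have "convex {p. \<phi> p = n}"
    by (rule convexI) (simp add: cv flip: distrib_right)
  then have H: "\<phi> p = n" if "p \<in> ?H" for p
    using that hull_minimal[of "S \<inter> {p. \<phi> p = n}" "{p. \<phi> p = n}" convex] by auto
  have "convex ({p. n < \<phi> p} \<union> ?H)"
  proof (rule convexI)
    fix x y and s t :: real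
    assume xy: "x \<in> {p. n < \<phi> p} \<union> ?H" "y \<in> {p. n < \<phi> p} \<union> ?H" and st: "0 \<le> s" "0 \<le> t" "s + t = 1"
    show "s *\<^sub>R x + t *\<^sub>R y \<in> {p. n < \<phi> p} \<union> ?H"
    proof (cases "s = 0 \<or> t = 0")
      case True
      then show ?thesis using xy st by auto
    next
      case False
      then have pos: "s > 0" "t > 0" using st by auto
      show ?thesis
      proof (cases "x \<in> ?H \<and> y \<in> ?H")
        case True
        then show ?thesis using st by (intro UnI2 convexD[OF convex_convex_hull]) auto
      next
        case False
        have le: "n \<le> \<phi> x" "n \<le> \<phi> y" using xy H[of x] H[of y] by auto
        have "n < \<phi> x \<or> n < \<phi> y" using False xy by auto
        then have "s * n + t * n < s * \<phi> x + t * \<phi> y"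
        proof
          assume "n < \<phi> x"
          then show ?thesis using le pos by (intro add_less_le_mono) auto
        next
          assume "n < \<phi> y"
          then show ?thesis using le pos by (intro add_le_less_mono) auto
        qed
        then show ?thesis using st by (simp add: cv flip: distrib_right)
      qed
    qed
  qed
  moreover have "S \<subseteq> {p. n < \<phi> p} \<union> ?H"
  proof
    fix p assume "p \<in> S"
    then show "p \<in> {p. n < \<phi> p} \<union> ?H" using S[of p] by (cases "\<phi> p = n") (auto intro: hull_inc)
  qed
  ultimately have "convex hull S \<subseteq> {p. n < \<phi> p} \<union> ?H" by (rule hull_minimal[rotated])
  then show "convex hull S \<inter> {p. \<phi> p = n} \<subseteq> ?H" by auto
  show "?H \<subseteq> convex hull S \<inter> {p. \<phi> p = n}"
    using H hull_mono[of "S \<inter> {p. \<phi> p = n}" S convex] by auto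
qed

text \<open>Both weights are positive, so adding a nonzero vector of the quadrant raises the weight.
  The generators of minimal weight are therefore support points, finitely many, and their hull is
  compact.\<close>

lemma weight_face:
  fixes f :: "'k::field fps2"
  assumes f: "f \<noteq> 0" and uv: "u > 0" "v > 0"
  defines "\<Delta> \<equiv> newton_polyhedron f \<inter> {p. real u * fst p + real v * snd p = real (weight u v f)}"
  shows "\<Delta> \<in> newton_faces f"
    and "coeff2 f i j \<noteq> 0 \<Longrightarrow> u * i + v * j = weight u v f \<Longrightarrow> (real i, real j) \<in> \<Delta>"
proof -
  let ?n = "weight u v f" and ?\<phi> = "\<lambda>p. real u * fst p + real v * snd p"
  let ?S = "{(real i + s, real j + t) | i j s t. coeff2 f i j \<noteq> 0 \<and> 0 \<le> s \<and> 0 \<le> t}"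
  have lin: "linear ?\<phi>" by (intro linearI) (simp_all add: algebra_simps)
  have le: "real ?n \<le> real u * real i + real v * real j" if "coeff2 f i j \<noteq> 0" for i j
    using weight_le[OF that, of u v] by (simp flip: of_nat_mult of_nat_add)
  have S: "real ?n \<le> ?\<phi> p" if p: "p \<in> ?S" for p
  proof -
    obtain i j s t where ij: "p = (real i + s, real j + t)" "coeff2 f i j \<noteq> 0" "0 \<le> s" "0 \<le> t" using p by blast
    have "0 \<le> real u * s" "0 \<le> real v * t" using ij by simp_all
    then show ?thesis using le[OF ij(2)] by (simp add: ij(1) distrib_left)
  qed
  have \<Delta>: "\<Delta> = convex hull (?S \<inter> {p. ?\<phi> p = real ?n})"
    unfolding \<Delta>_def newton_polyhedron_def by (rule convex_hull_face_points[OF lin S])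
  have "?S \<inter> {p. ?\<phi> p = real ?n} \<subseteq> (\<lambda>(i, j). (real i, real j)) ` {(i, j). u * i + v * j = ?n}"
  proof
    fix p assume p: "p \<in> ?S \<inter> {p. ?\<phi> p = real ?n}"
    then obtain i j s t where ij: "p = (real i + s, real j + t)" "coeff2 f i j \<noteq> 0" "0 \<le> s" "0 \<le> t" by blast
    have nn: "0 \<le> real u * s" "0 \<le> real v * t" using ij by simp_all
    have eq: "real u * real i + real v * real j + (real u * s + real v * t) = real ?n"
      using p by (simp add: ij(1) algebra_simps)
    then have "real u * s = 0" "real v * t = 0" using le[OF ij(2)] nn by linarith+
    then have st: "s = 0" "t = 0" using uv by simp_all
    then have "real (u * i + v * j) = real ?n" using eq by simp
    then have "u * i + v * j = ?n" by (simp only: of_nat_eq_iff)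
    then show "p \<in> (\<lambda>(i, j). (real i, real j)) ` {(i, j). u * i + v * j = ?n}"
      using st by (auto simp: ij(1))
  qed
  then have "finite (?S \<inter> {p. ?\<phi> p = real ?n})"
    using finite_weight[OF uv] by (meson finite_imageI finite_subset)
  then have compact: "compact \<Delta>" unfolding \<Delta> by (rule finite_imp_compact_convex_hull)
  have mem: "(real i, real j) \<in> \<Delta>" if "coeff2 f i j \<noteq> 0" "u * i + v * j = ?n" for i j
  proof -
    have "(real i, real j) \<in> ?S" using that(1)
      by (intro CollectI exI[of _ i] exI[of _ j] exI[of _ "0::real"]) simp
    moreover have "?\<phi> (real i, real j) = real ?n" using that(2) by (simp flip: of_nat_mult of_nat_add)
    ultimately show ?thesis unfolding \<Delta> by (intro hull_inc) simp
  qed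
  then show "coeff2 f i j \<noteq> 0 \<Longrightarrow> u * i + v * j = weight u v f \<Longrightarrow> (real i, real j) \<in> \<Delta>" .
  obtain i j where "coeff2 f i j \<noteq> 0" "?n = u * i + v * j" by (rule weight_witness[OF f])
  then have "(real i, real j) \<in> \<Delta>" by (intro mem) simp_all
  then have ne: "\<Delta> \<noteq> {}" by blast
  have "convex hull ?S \<subseteq> {p. real ?n \<le> ?\<phi> p}"
  proof (rule hull_minimal)
    show "convex {p. real ?n \<le> ?\<phi> p}"
      using convex_halfspace_ge[of "real ?n" "(real u, real v)"] by (simp add: inner_prod_def)
  qed (use S in blast)
  then have ge: "real ?n \<le> ?\<phi> p" if "p \<in> newton_polyhedron f" for p
    using that unfolding newton_polyhedron_def by blast
  have "newton_polyhedron f \<inter> {p. (real u, real v) \<bullet> p = real ?n} face_of newton_polyhedron f"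
    by (rule face_of_Int_supporting_hyperplane_ge) (use ge in \<open>auto simp: newton_polyhedron_def inner_prod_def\<close>)
  then have "\<Delta> face_of newton_polyhedron f" by (simp add: \<Delta>_def inner_prod_def)
  then show "\<Delta> \<in> newton_faces f" using compact ne by (simp add: newton_faces_def)
qed

lemma eval2_sum: "eval2 (\<Sum>x\<in>A. p x) a b = (\<Sum>x\<in>A. eval2 (p x) a b)"
  by (simp add: eval2_def poly_sum)

lemma eval2_monom: "eval2 (monom (monom c i) j) a b = c * a ^ i * b ^ j"
  by (simp add: eval2_def poly_monom poly_power)

lemma pderiv_sum: "pderiv (\<Sum>x\<in>A. p x) = (\<Sum>x\<in>A. pderiv (p x))"
  by (induction A rule: infinite_finite_induct) (simp_all add: pderiv_add)

lemma map_poly_pderiv_sum: "map_poly pderiv (\<Sum>x\<in>A. p x) = (\<Sum>x\<in>A. map_poly pderiv (p x))"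
  by (rule poly_eqI) (simp add: coeff_map_poly coeff_sum pderiv_sum)

lemma pderiv_monom_times: "x * (c * of_nat i) * x ^ (i - Suc 0) = of_nat i * c * (x :: 'a::comm_ring_1) ^ i"
  by (cases i) (simp_all add: mult_ac)

text \<open>Every lattice point of the face has minimal weight and every support point of minimal
  weight lies on it, so the weighted sums are sums over the face. In the torus, multiplication by a
  or b turns partial derivatives into logarithmic ones without changing their zeros.\<close>

lemma nondegenerate_of_NND:
  fixes f :: "'k::field fps2"
  assumes f: "f \<noteq> 0" and nnd: "NND f"
  shows "nondegenerate f {theta_x f, theta_y f}"
  unfolding nondegenerate_def
proof (intro allI impI conjI ballI)
  fix u v :: nat assume uv: "u > 0" "v > 0"
  show "weight u v f \<le> u * i + v * j" if "h \<in> {theta_x f, theta_y f}" "coeff2 h i j \<noteq> 0" for h i j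
    using that by (intro weight_le) auto
  fix a b :: 'k assume ab: "a \<noteq> 0" "b \<noteq> 0"
  let ?n = "weight u v f"
  define \<Delta> where "\<Delta> = newton_polyhedron f \<inter> {p. real u * fst p + real v * snd p = real ?n}"
  note face = weight_face[OF f uv, folded \<Delta>_def]
  define A where "A = {(i :: nat, j :: nat). (real i, real j) \<in> \<Delta>}"
  have A: "A \<subseteq> {(i, j). u * i + v * j = ?n}"
    by (auto simp: A_def \<Delta>_def simp flip: of_nat_mult of_nat_add)
  then have finA: "finite A" using finite_weight[OF uv] finite_subset by blast
  have weight_sum: "weight_sum u v ?n h a b = (\<Sum>(i, j)\<in>A. coeff2 h i j * a ^ i * b ^ j)" if h: "\<And>i j. coeff2 h i j \<noteq> 0 \<Longrightarrow> coeff2 f i j \<noteq> 0" for h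
    unfolding weight_sum_def
    by (rule sum.mono_neutral_right[OF finite_weight[OF uv] A]) (use h face(2) in \<open>force simp: A_def\<close>)
  have x: "a * eval2 (map_poly pderiv (in_face \<Delta> f)) a b = weight_sum u v ?n (theta_x f) a b"
  proof -
    have "a * eval2 (map_poly pderiv (in_face \<Delta> f)) a b
        = (\<Sum>(i, j)\<in>A. a * (coeff2 f i j * of_nat i) * a ^ (i - 1) * b ^ j)"
      unfolding in_face_def A_def[symmetric] map_poly_pderiv_sum eval2_sum sum_distrib_left
      by (rule sum.cong) (auto simp: map_poly_monom pderiv_monom eval2_monom mult_ac)
    also have "\<dots> = weight_sum u v ?n (theta_x f) a b"
      by (subst weight_sum) (auto simp: pderiv_monom_times)
    finally show ?thesis .
  qed
  have y: "b * eval2 (pderiv (in_face \<Delta> f)) a b = weight_sum u v ?n (theta_y f) a b"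
  proof -
    have mm: "pderiv (monom (monom c i) j) = monom (monom (of_nat j * c) i) (j - 1)" for c :: 'k and i j
      by (simp add: pderiv_monom of_nat_poly smult_monom flip: mult.assoc)
    have "b * eval2 (pderiv (in_face \<Delta> f)) a b
        = (\<Sum>(i, j)\<in>A. a ^ i * (b * (coeff2 f i j * of_nat j) * b ^ (j - 1)))"
      unfolding in_face_def A_def[symmetric] pderiv_sum eval2_sum sum_distrib_left
      by (rule sum.cong) (auto simp: mm eval2_monom mult_ac)
    also have "\<dots> = (\<Sum>(i, j)\<in>A. coeff2 (theta_y f) i j * a ^ i * b ^ j)"
      unfolding One_nat_def pderiv_monom_times coeff2_theta_y by (simp only: mult_ac)
    also have "\<dots> = weight_sum u v ?n (theta_y f) a b"
      by (rule weight_sum[symmetric]) auto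
    finally show ?thesis .
  qed
  have "\<not> (eval2 (map_poly pderiv (in_face \<Delta> f)) a b = 0 \<and> eval2 (pderiv (in_face \<Delta> f)) a b = 0)"
    using nnd face(1) ab unfolding NND_def by blast
  then have "weight_sum u v ?n (theta_x f) a b \<noteq> 0 \<or> weight_sum u v ?n (theta_y f) a b \<noteq> 0"
    using x y ab by (metis mult_eq_0_iff)
  then show "\<exists>h\<in>{theta_x f, theta_y f}. weight_sum u v ?n h a b \<noteq> 0" by blast
qed

section \<open>Monomial factors\<close>

lemma prime_elem_X2: "prime_elem (X2 :: 'k::field fps2)"
proof -
  have "\<not> X2 dvd (1 :: 'k fps2)" by (simp add: is_unit_fps2_iff X2_def)
  then show ?thesis unfolding prime_elem_def at_x0_eq_0_iff[symmetric] by simp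
qed

lemma prime_elem_Y2: "prime_elem (Y2 :: 'k::field fps2)"
proof -
  have "Y2 dvd f \<longleftrightarrow> at_y0 f = 0" for f :: "'k fps2" using exc_dvd_iff[of Vertical f] by simp
  moreover have "\<not> Y2 dvd (1 :: 'k fps2)" by (simp add: is_unit_fps2_iff Y2_def)
  ultimately show ?thesis unfolding prime_elem_def by simp
qed

lemma st_X2: "mult2 (X2 :: 'k::field fps2) = 1" "st Vertical X2 = (X2 :: 'k fps2)"
proof -
  have "chart Vertical X2 = exc Vertical ^ 1 * (X2 :: 'k fps2)" by (simp add: swap2_mult swap2_add)
  moreover have "on_exc Vertical (X2 :: 'k fps2) \<noteq> 0" by (simp add: at_y0_def X2_def)
  ultimately show "mult2 (X2 :: 'k fps2) = 1" "st Vertical X2 = (X2 :: 'k fps2)"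
    using strict_transform_unique by blast+
qed

lemma st_Y2: "mult2 (Y2 :: 'k::field fps2) = 1" "st (Slope 0) Y2 = (Y2 :: 'k fps2)"
proof -
  have "chart (Slope 0) Y2 = exc (Slope 0) ^ 1 * (Y2 :: 'k fps2)" by simp
  moreover have "on_exc (Slope 0) (Y2 :: 'k fps2) \<noteq> 0"
  proof
    assume "on_exc (Slope 0) (Y2 :: 'k fps2) = 0"
    then have "at_x0 (Y2 :: 'k fps2) $ 1 = 0" by simp
    then show False by (simp add: Y2_def)
  qed
  ultimately show "mult2 (Y2 :: 'k fps2) = 1" "st (Slope 0) Y2 = (Y2 :: 'k fps2)"
    using strict_transform_unique by blast+
qed

lemma monomial_decomposition:
  fixes f :: "'k::field fps2"
  assumes "f \<noteq> 0"
  obtains \<alpha> \<beta> g where "f = X2 ^ \<alpha> * Y2 ^ \<beta> * g" "at_x0 g \<noteq> 0" "at_y0 g \<noteq> 0"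
proof -
  have "\<exists>\<alpha> \<beta> g. f = X2 ^ \<alpha> * Y2 ^ \<beta> * g \<and> at_x0 g \<noteq> 0 \<and> at_y0 g \<noteq> 0"
    using assms
  proof (induction "mult2 f" arbitrary: f rule: less_induct)
    case less
    consider "X2 dvd f" | "Y2 dvd f" | "at_x0 f \<noteq> 0" "at_y0 f \<noteq> 0"
      using exc_dvd_iff[of Vertical f] at_x0_eq_0_iff[of f] by auto
    then show ?case
    proof cases
      case 1
      then obtain h where h: "f = X2 * h" by (rule dvdE)
      then have "h \<noteq> 0" using less.prems by auto
      moreover from this have "mult2 h < mult2 f" by (simp add: h mult2_mult st_X2)
      ultimately obtain \<alpha> \<beta> g where "h = X2 ^ \<alpha> * Y2 ^ \<beta> * g" "at_x0 g \<noteq> 0" "at_y0 g \<noteq> 0"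
        using less.hyps by blast
      then show ?thesis by (intro exI[of _ "Suc \<alpha>"] exI[of _ \<beta>] exI[of _ g]) (simp add: h mult_ac)
    next
      case 2
      then obtain h where h: "f = Y2 * h" by (rule dvdE)
      then have "h \<noteq> 0" using less.prems by auto
      moreover from this have "mult2 h < mult2 f" by (simp add: h mult2_mult st_Y2)
      ultimately obtain \<alpha> \<beta> g where "h = X2 ^ \<alpha> * Y2 ^ \<beta> * g" "at_x0 g \<noteq> 0" "at_y0 g \<noteq> 0"
        using less.hyps by blast
      then show ?thesis by (intro exI[of _ \<alpha>] exI[of _ "Suc \<beta>"] exI[of _ g]) (simp add: h mult_ac)
    next
      case 3
      then show ?thesis by (intro exI[of _ 0] exI[of _ f]) simp
    qed
  qed
  then show thesis using that by blast
qed

section \<open>Cancelling monomials and restricting to the axes\<close>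

lemma coeff2_monomial_mult:
  "coeff2 (X2 ^ \<alpha> * Y2 ^ \<beta> * g) i j = (if \<alpha> \<le> i \<and> \<beta> \<le> j then coeff2 g (i - \<alpha>) (j - \<beta>) else 0)"
  by (simp add: mult.assoc)

lemma weight_monomial_mult:
  assumes "g \<noteq> 0" shows "weight u v (X2 ^ \<alpha> * Y2 ^ \<beta> * g) = weight u v g + u * \<alpha> + v * \<beta>"
proof -
  obtain i j where ij: "coeff2 g i j \<noteq> 0" "weight u v g = u * i + v * j" by (rule weight_witness[OF assms])
  have "weight u v (X2 ^ \<alpha> * Y2 ^ \<beta> * g) = u * (i + \<alpha>) + v * (j + \<beta>)"
  proof (rule weight_eqI)
    show "coeff2 (X2 ^ \<alpha> * Y2 ^ \<beta> * g) (i + \<alpha>) (j + \<beta>) \<noteq> 0"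
      using ij(1) unfolding coeff2_monomial_mult by simp
    fix i' j' assume "coeff2 (X2 ^ \<alpha> * Y2 ^ \<beta> * g) i' j' \<noteq> 0"
    then have le: "\<alpha> \<le> i'" "\<beta> \<le> j'" and nz: "coeff2 g (i' - \<alpha>) (j' - \<beta>) \<noteq> 0"
      unfolding coeff2_monomial_mult by (auto split: if_splits)
    have "u * i + v * j \<le> u * (i' - \<alpha>) + v * (j' - \<beta>)" using weight_le[OF nz, of u v] ij(2) by simp
    then have "u * (i + \<alpha>) + v * (j + \<beta>) \<le> u * ((i' - \<alpha>) + \<alpha>) + v * ((j' - \<beta>) + \<beta>)"
      unfolding distrib_left by linarith
    then show "u * (i + \<alpha>) + v * (j + \<beta>) \<le> u * i' + v * j'" using le by simp
  qed
  then show ?thesis using ij(2) by (simp add: distrib_left)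
qed

lemma weight_sum_monomial_mult:
  assumes uv: "u > 0" "v > 0"
  shows "weight_sum u v (n + u * \<alpha> + v * \<beta>) (X2 ^ \<alpha> * Y2 ^ \<beta> * h) a b = a ^ \<alpha> * b ^ \<beta> * weight_sum u v n h a b"
proof -
  let ?f = "X2 ^ \<alpha> * Y2 ^ \<beta> * h"
  let ?B = "{(i, j). u * i + v * j = n + u * \<alpha> + v * \<beta> \<and> \<alpha> \<le> i \<and> \<beta> \<le> j}"
  have "weight_sum u v (n + u * \<alpha> + v * \<beta>) ?f a b = (\<Sum>(i, j)\<in>?B. coeff2 ?f i j * a ^ i * b ^ j)"
    unfolding weight_sum_def coeff2_monomial_mult
    by (rule sum.mono_neutral_right[OF finite_weight[OF uv]]) (auto split: if_splits)
  also have "\<dots> = (\<Sum>(i, j)\<in>{(i, j). u * i + v * j = n}. a ^ \<alpha> * b ^ \<beta> * (coeff2 h i j * a ^ i * b ^ j))"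
  proof (rule sum.reindex_bij_witness[of _ "\<lambda>(i, j). (i + \<alpha>, j + \<beta>)" "\<lambda>(i, j). (i - \<alpha>, j - \<beta>)"], goal_cases)
    case (2 p)
    then obtain i j where p: "p = (i, j)" "u * i + v * j = n + u * \<alpha> + v * \<beta>" "\<alpha> \<le> i" "\<beta> \<le> j" by blast
    have "u * (i - \<alpha>) + u * \<alpha> = u * i" "v * (j - \<beta>) + v * \<beta> = v * j" using p by (simp_all flip: distrib_left)
    then have "u * (i - \<alpha>) + v * (j - \<beta>) = n" using p(2) by linarith
    then show ?case using p by simp
  next
    case (5 p)
    then obtain i j where p: "p = (i, j)" "\<alpha> \<le> i" "\<beta> \<le> j" by blast
    then have pw: "a ^ i = a ^ \<alpha> * a ^ (i - \<alpha>)" "b ^ j = b ^ \<beta> * b ^ (j - \<beta>)" by (simp_all flip: power_add)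
    have c: "coeff2 ?f i j = coeff2 h (i - \<alpha>) (j - \<beta>)" unfolding coeff2_monomial_mult using p by simp
    show ?case unfolding p(1) split c pw by (simp only: mult_ac)
  qed (auto simp: distrib_left)
  also have "\<dots> = a ^ \<alpha> * b ^ \<beta> * weight_sum u v n h a b"
    by (simp add: weight_sum_def sum_distrib_left case_prod_unfold)
  finally show ?thesis .
qed

text \<open>A common monomial factor translates all exponents by the same vector and multiplies the
  initial forms by a function without zeros in the torus.\<close>

lemma nondegenerate_monomial_cancel:
  assumes g: "g \<noteq> 0" and nd: "nondegenerate (X2 ^ \<alpha> * Y2 ^ \<beta> * g) ((\<lambda>h. X2 ^ \<alpha> * Y2 ^ \<beta> * h) ` L)"
  shows "nondegenerate g L"
  unfolding nondegenerate_def
proof (intro allI impI conjI ballI)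
  fix u v :: nat assume uv: "u > 0" "v > 0"
  show "weight u v g \<le> u * i + v * j" if h: "h \<in> L" "coeff2 h i j \<noteq> 0" for h i j
  proof -
    have "coeff2 (X2 ^ \<alpha> * Y2 ^ \<beta> * h) (i + \<alpha>) (j + \<beta>) \<noteq> 0"
      unfolding coeff2_monomial_mult using h(2) by simp
    then have "weight u v (X2 ^ \<alpha> * Y2 ^ \<beta> * g) \<le> u * (i + \<alpha>) + v * (j + \<beta>)"
      using nondegenerate_le[OF nd _ _ uv] h(1) by blast
    then show ?thesis unfolding weight_monomial_mult[OF g] by (simp add: distrib_left)
  qed
  fix a b :: 'a assume ab: "a \<noteq> 0" "b \<noteq> 0"
  obtain h where h: "h \<in> L" "weight_sum u v (weight u v (X2 ^ \<alpha> * Y2 ^ \<beta> * g)) (X2 ^ \<alpha> * Y2 ^ \<beta> * h) a b \<noteq> 0"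
    using nondegenerate_weight_sum[OF nd uv ab] by blast
  then show "\<exists>h\<in>L. weight_sum u v (weight u v g) h a b \<noteq> 0"
    unfolding weight_monomial_mult[OF g] weight_sum_monomial_mult[OF uv] by auto
qed

text \<open>The point (0, b), with b the order of g(0, y), is a vertex of the Newton diagram. As F
  has no monomial there, nondegeneracy at this vertex forces G to have one.\<close>

lemma subdegree_at_x0_nondegenerate:
  assumes nd: "nondegenerate g {F, G}" and g: "at_x0 g \<noteq> 0" and F: "at_x0 F = 0"
  shows "imult X2 G = enat (subdegree (at_x0 g))"
proof -
  let ?b = "subdegree (at_x0 g)"
  have gb: "coeff2 g 0 ?b \<noteq> 0" using nth_subdegree_nonzero[OF g] by simp
  have low: "coeff2 g 0 j = 0" if "j < ?b" for j using nth_less_subdegree_zero[OF that] by simp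
  \<comment> \<open>With weight b + 1 on x, any monomial divisible by x outweighs y^b, so the face
    consists of the vertex alone.\<close>
  have "weight (?b + 1) 1 g = (?b + 1) * 0 + 1 * ?b"
  proof (rule weight_eqI[OF gb])
    fix i j assume "coeff2 g i j \<noteq> 0"
    then have "i = 0 \<Longrightarrow> ?b \<le> j" using low by (metis not_less)
    then show "(?b + 1) * 0 + 1 * ?b \<le> (?b + 1) * i + 1 * j" by (cases i) auto
  qed
  then have w: "weight (?b + 1) 1 g = ?b" by simp
  have set: "{(i, j). (?b + 1) * i + 1 * j = ?b} = {(0, ?b)}"
  proof -
    have "(?b + 1) * i + 1 * j = ?b \<longleftrightarrow> i = 0 \<and> j = ?b" for i j by (cases i) auto
    then show ?thesis by auto
  qed
  have ws: "weight_sum (?b + 1) 1 ?b h 1 1 = coeff2 h 0 ?b" for h :: "'a fps2"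
    unfolding weight_sum_def set by simp
  obtain h where h: "h \<in> {F, G}" "coeff2 h 0 ?b \<noteq> 0"
    using nondegenerate_weight_sum[OF nd _ _ one_neq_zero one_neq_zero, of "?b + 1" 1] unfolding w ws by auto
  moreover have "coeff2 F 0 ?b = 0" using F by (metis at_x0_nth fps_zero_nth)
  ultimately have Gb: "coeff2 G 0 ?b \<noteq> 0" by auto
  have "coeff2 G 0 j = 0" if "j < ?b" for j
    using nondegenerate_le[OF nd, where h = G and i = 0 and j = j and u = "?b + 1" and v = 1] that
    unfolding w by auto
  then have "subdegree (at_x0 G) = ?b" using Gb by (intro subdegreeI) simp_all
  moreover have "at_x0 G \<noteq> 0" using Gb by (metis at_x0_nth fps_zero_nth)
  ultimately show ?thesis by (simp add: imult_X2)
qed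

lemma imult_Y2: "at_y0 h \<noteq> 0 \<Longrightarrow> imult Y2 h = enat (subdegree (at_y0 h))"
  using imult_exc[of Vertical h] by simp

lemma subdegree_at_y0_nondegenerate:
  assumes nd: "nondegenerate g {F, G}" and g: "at_y0 g \<noteq> 0" and F: "at_y0 F = 0"
  shows "imult Y2 G = enat (subdegree (at_y0 g))"
proof -
  have "nondegenerate (swap2 g) {swap2 F, swap2 G}" using nondegenerate_swap2[OF nd] by simp
  then have "imult X2 (swap2 G) = enat (subdegree (at_x0 (swap2 g)))"
    by (rule subdegree_at_x0_nondegenerate) (use g F in \<open>simp_all add: at_x0_swap2\<close>)
  then show ?thesis using imult_swap2[of X2 "swap2 G"] by (simp add: at_x0_swap2)
qed

text \<open>The ideal is contained in (x, y^n) for every n, and that ideal has colength n.\<close>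

lemma imult_X2_infinite:
  fixes A B :: "'k::field fps2"
  shows "imult (X2 * A) (X2 * B) = \<infinity>"
proof -
  have "enat n \<le> imult (X2 * A) (X2 * B)" for n
  proof -
    have "ideal2 (X2 * A) (X2 * B) \<subseteq> ideal2 X2 (Y2 ^ n)"
    proof (rule ideal2_mono)
      fix a b show "a * (X2 * A) + b * (X2 * B) \<in> ideal2 X2 (Y2 ^ n)"
        by (rule ideal2I[of _ "a * A + b * B" _ 0]) (simp add: algebra_simps)
    qed
    then have "imult X2 (Y2 ^ n :: 'k fps2) \<le> imult (X2 * A) (X2 * B)" by (rule imult_mono)
    then show ?thesis by (simp add: imult_power imult_X2_Y2)
  qed
  then show ?thesis by (metis Suc_ile_eq enat.exhaust linorder_not_less order_refl)
qed

lemma deriv_X2_square: "\<exists>A B. deriv_x (X2 ^ 2 * h) = X2 * A \<and> deriv_y (X2 ^ 2 * h) = X2 * B"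
proof -
  have "at_x0 (deriv_x (X2 ^ 2 * h)) = 0"
    by (rule fps_ext) (simp add: deriv_x_def)
  moreover have "at_x0 (deriv_y (X2 ^ 2 * h)) = 0"
  proof (rule fps_ext)
    fix j
    have "coeff2 (X2 ^ 2 * h) 0 (Suc j) = 0" by simp
    then have "coeff2 (theta_y (X2 ^ 2 * h)) 0 (Suc j) = 0" by (simp only: coeff2_theta_y mult_zero_right)
    then show "at_x0 (deriv_y (X2 ^ 2 * h)) $ j = 0 $ j" by (simp add: theta_y_def)
  qed
  ultimately show ?thesis by (auto simp: at_x0_eq_0_iff elim!: dvdE)
qed

lemma deriv_swap2: "deriv_x (swap2 f) = swap2 (deriv_y f)" "deriv_y (swap2 f) = swap2 (deriv_x f)"
proof -
  have *: "coeff2 (deriv_y f) i j = of_nat (Suc j) * coeff2 f i (Suc j)" for f :: "'a fps2" and i j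
    using coeff2_theta_y[where f = f and i = i and j = "Suc j"] by (simp add: theta_y_def)
  have x: "coeff2 (deriv_x f) i j = of_nat (Suc i) * coeff2 f (Suc i) j" for f :: "'a fps2" and i j
    by (simp add: deriv_x_def)
  show "deriv_x (swap2 f) = swap2 (deriv_y f)" "deriv_y (swap2 f) = swap2 (deriv_x f)"
    by (rule fps2_eqI; simp only: * x coeff2_swap2)+
qed

lemma milnor_number_swap2: "milnor_number (swap2 f) = milnor_number f"
  by (simp add: milnor_number_eq_imult deriv_swap2 imult_swap2 imult_commute)

lemma milnor_delta_infinite:
  fixes h :: "'k::alg_closed_field fps2"
  assumes "h \<noteq> 0"
  shows "milnor_number (X2 ^ 2 * h) = \<infinity>" "delta_invariant (X2 ^ 2 * h) = \<infinity>"
    "milnor_number (Y2 ^ 2 * h) = \<infinity>" "delta_invariant (Y2 ^ 2 * h) = \<infinity>"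
proof -
  have X: "milnor_number (X2 ^ 2 * h) = \<infinity>" for h :: "'k fps2"
    unfolding milnor_number_eq_imult using deriv_X2_square[of h] imult_X2_infinite by metis
  show "milnor_number (X2 ^ 2 * h) = \<infinity>" by (rule X)
  show "milnor_number (Y2 ^ 2 * h) = \<infinity>"
    using X[of "swap2 h"] milnor_number_swap2[of "Y2 ^ 2 * h"] by (simp add: swap2_mult swap2_power)
  show "delta_invariant (X2 ^ 2 * h) = \<infinity>"
    by (rule delta_infinite[of X2 Vertical]) (use assms in \<open>simp_all add: st_X2\<close>)
  show "delta_invariant (Y2 ^ 2 * h) = \<infinity>"
    by (rule delta_infinite[of Y2 "Slope 0"]) (use assms in \<open>simp_all add: st_Y2\<close>)
qed

text \<open>i(F, G) and i(f_x, f_y) differ by intersection numbers with the axes, which are a, b or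
  1. Which of them occur depends on the axes contained in f, hence the four cases; the matching
  changes of delta come from \<open>delta_mult\<close>.\<close>

lemma milnor_delta_branches_finite:
  fixes g :: "'k::alg_closed_field fps2"
  assumes f: "f = X2 ^ \<alpha> * Y2 ^ \<beta> * g" "\<alpha> \<le> 1" "\<beta> \<le> 1" and nonunit: "\<not> f dvd 1"
    and g: "at_x0 g \<noteq> 0" "at_y0 g \<noteq> 0" and nd: "nondegenerate f {theta_x f, theta_y f}"
  shows "\<exists>\<mu> n. milnor_number f = enat \<mu> \<and> delta_invariant f = enat n \<and> \<mu> + num_branches f = 2 * n + 1"
proof -
  have g0: "g \<noteq> 0" using g by auto
  let ?a = "subdegree (at_y0 g)" and ?b = "subdegree (at_x0 g)"
  define F where "F = theta_x g + const2 (of_nat \<alpha>) * g"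
  define G where "G = theta_y g + const2 (of_nat \<beta>) * g"
  have thx: "theta_x f = X2 ^ \<alpha> * Y2 ^ \<beta> * F" and thy: "theta_y f = X2 ^ \<alpha> * Y2 ^ \<beta> * G"
    unfolding f(1)
    by (rule fps2_eqI; simp only: coeff2_theta_x coeff2_theta_y coeff2_monomial_mult;
      simp add: F_def G_def left_diff_distrib of_nat_diff)+
  have nd': "nondegenerate g {F, G}"
    using nd unfolding thx thy unfolding f(1)
    by (intro nondegenerate_monomial_cancel[OF g0, of \<alpha> \<beta>]) simp
  have weak: "weakly_nondegenerate g"
    unfolding nondegenerate_def
  proof (intro allI impI conjI ballI)
    fix u v :: nat assume uv: "u > 0" "v > 0"
    show "weight u v g \<le> u * i + v * j" if "h \<in> {g, theta_x g, theta_y g}" "coeff2 h i j \<noteq> 0" for h i j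
      using that by (intro weight_le) auto
    fix a b :: 'k assume ab: "a \<noteq> 0" "b \<noteq> 0"
    obtain h where "h \<in> {F, G}" "weight_sum u v (weight u v g) h a b \<noteq> 0"
      using nondegenerate_weight_sum[OF nd' uv ab] by blast
    then show "\<exists>h\<in>{g, theta_x g, theta_y g}. weight_sum u v (weight u v g) h a b \<noteq> 0"
      by (auto simp: F_def G_def weight_sum_add weight_sum_const2_mult)
  qed
  obtain n r e where nre: "delta_invariant g = enat n" "prime_product g r" "imult F G = enat e"
    "e + r = 2 * n + ?a + ?b"
    using imult_nondegenerate_eq[OF g weak nd'] by blast
  have X2g: "imult X2 g = enat ?b" and Y2g: "imult Y2 g = enat ?a"
    using imult_X2[OF g(1)] imult_Y2[OF g(2)] by simp_all
  have dX: "delta_invariant (X2 :: 'k fps2) = 0" and dY: "delta_invariant (Y2 :: 'k fps2) = 0"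
    by (simp_all add: delta_smooth st_X2 st_Y2)
  have dYg: "delta_invariant (Y2 * g) = enat (n + ?a)"
    using delta_mult[OF Y2_nonzero g0 Y2g] by (simp add: dY nre(1) Y2g)
  have YX: "imult Y2 (X2 :: 'k fps2) = 1" using imult_X2_Y2 imult_commute by metis
  have aF: "at_x0 (theta_x g) = 0" and aG: "at_y0 (theta_y g) = 0"
    by (simp_all add: theta_x_def theta_y_def at_x0_eq_0_iff at_y0_def Y2_def)
  \<comment> \<open>If x divides f, then F restricts to g on x = 0. Otherwise F vanishes there, and
    nondegeneracy determines the order of G instead.\<close>
  have bF: "imult X2 F = enat ?b" if "\<alpha> = 1"
    using that imult_X2[of F] g(1) by (simp add: F_def aF)
  have aG': "imult Y2 G = enat ?a" if "\<beta> = 1"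
    using that imult_Y2[of G] g(2) by (simp add: G_def aG)
  have bG: "imult X2 G = enat ?b" if "\<alpha> = 0"
    by (rule subdegree_at_x0_nondegenerate[OF nd' g(1)]) (simp add: F_def aF that)
  have aF': "imult Y2 F = enat ?a" if "\<beta> = 0"
    by (rule subdegree_at_y0_nondegenerate[of g G F]) (use nd' g(2) in \<open>simp_all add: insert_commute G_def aG that\<close>)
  have dx: "X2 * deriv_x f = X2 ^ \<alpha> * Y2 ^ \<beta> * F" and dy: "Y2 * deriv_y f = X2 ^ \<alpha> * Y2 ^ \<beta> * G"
    using thx thy by (simp_all add: theta_x_def theta_y_def)
  consider "\<alpha> = 0" "\<beta> = 0" | "\<alpha> = 0" "\<beta> = 1" | "\<alpha> = 1" "\<beta> = 0" | "\<alpha> = 1" "\<beta> = 1"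
    using f(2,3) by linarith
  then show ?thesis
  proof cases
    case 1
    have F: "F = X2 * deriv_x f" and G: "G = Y2 * deriv_y f" using dx dy 1 by simp_all
    have "enat e = enat ?b + (imult (deriv_x f) Y2 + milnor_number f)"
      using nre(3) bG[OF 1(1)] imult_mult_left[of X2 "deriv_x f" G] imult_mult[of "deriv_x f" Y2 "deriv_y f"]
      by (simp add: F[symmetric] G[symmetric] milnor_number_eq_imult)
    \<comment> \<open>Since F = x f_x, one of the a intersections of F with y = 0 comes from the
      factor x; this is the origin of the summand 1 in the formula.\<close>
    moreover have "enat ?a = 1 + imult (deriv_x f) Y2"
      using aF'[OF 1(2)] imult_mult[of Y2 X2 "deriv_x f"] YX by (simp add: F imult_commute[of _ Y2])
    ultimately obtain \<mu> where \<mu>: "milnor_number f = enat \<mu>" "e + 1 = ?a + ?b + \<mu>"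
      by (cases "imult (deriv_x f) Y2"; cases "milnor_number f") (auto simp: one_enat_def)
    have "f = g" using f(1) 1 by simp
    then show ?thesis using \<mu> nre num_branches_eq[OF nre(2)] by auto
  next
    case 2
    have fg: "f = Y2 * g" using f(1) 2 by simp
    have G: "deriv_y f = G" using dy 2 by simp
    have F: "F = X2 * deriv_x g" using 2 by (simp add: F_def theta_x_def)
    have "X2 * deriv_x f = X2 * (Y2 * deriv_x g)" using dx 2 by (simp add: F mult_ac)
    then have D: "deriv_x f = Y2 * deriv_x g" by simp
    have "enat e = enat ?b + imult (deriv_x g) G"
      using nre(3) bG[OF 2(1)] by (simp add: F imult_mult_left)
    moreover have "milnor_number f = enat ?a + imult (deriv_x g) G"
      using aG'[OF 2(2)] by (simp add: milnor_number_eq_imult D G imult_mult_left)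
    ultimately obtain \<mu> where \<mu>: "milnor_number f = enat \<mu>" "e + ?a = ?b + \<mu>"
      by (cases "imult (deriv_x g) G") auto
    have "num_branches f = Suc r"
      unfolding fg by (rule num_branches_eq[OF prime_product_prime_mult[OF prime_elem_Y2 nre(2)]])
    then have "\<mu> + num_branches f = 2 * (n + ?a) + 1" using \<mu>(2) nre(4) by simp
    then show ?thesis using \<mu>(1) dYg fg by blast
  next
    case 3
    have fg: "f = X2 * g" using f(1) 3 by simp
    have F: "deriv_x f = F" using dx 3 by simp
    have G: "G = Y2 * deriv_y g" using 3 by (simp add: G_def theta_y_def)
    have "Y2 * deriv_y f = Y2 * (X2 * deriv_y g)" using dy 3 by (simp add: G mult_ac)
    then have D: "deriv_y f = X2 * deriv_y g" by simp
    have "enat e = enat ?a + imult F (deriv_y g)"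
      using nre(3) aF'[OF 3(2)] by (simp add: G imult_mult imult_commute[of F Y2])
    moreover have "milnor_number f = enat ?b + imult F (deriv_y g)"
      using bF[OF 3(1)] by (simp add: milnor_number_eq_imult D F imult_mult imult_commute[of F X2])
    ultimately obtain \<mu> where \<mu>: "milnor_number f = enat \<mu>" "e + ?b = ?a + \<mu>"
      by (cases "imult F (deriv_y g)") auto
    have delta: "delta_invariant f = enat (n + ?b)"
      unfolding fg using delta_mult[OF X2_nonzero g0 X2g] by (simp add: dX nre(1) X2g)
    have "num_branches f = Suc r"
      unfolding fg by (rule num_branches_eq[OF prime_product_prime_mult[OF prime_elem_X2 nre(2)]])
    then have "\<mu> + num_branches f = 2 * (n + ?b) + 1" using \<mu>(2) nre(4) by simp
    then show ?thesis using \<mu>(1) delta by blast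
  next
    case 4
    have fg: "f = X2 * (Y2 * g)" using f(1) 4 by (simp add: mult.assoc)
    have "X2 * deriv_x f = X2 * (Y2 * F)" "Y2 * deriv_y f = Y2 * (X2 * G)"
      using dx dy 4 by (simp_all add: mult_ac)
    then have D: "deriv_x f = Y2 * F" "deriv_y f = X2 * G" by simp_all
    have "milnor_number f = 1 + enat ?a + (enat ?b + enat e)"
      using aG'[OF 4(2)] bF[OF 4(1)] nre(3)
      by (simp add: milnor_number_eq_imult D imult_mult imult_mult_left YX imult_commute[of F X2])
    then have \<mu>: "milnor_number f = enat (1 + ?a + (?b + e))" by (simp add: one_enat_def)
    have XYg: "imult X2 (Y2 * g) = enat (1 + ?b)"
      by (simp add: imult_mult imult_X2_Y2 X2g one_enat_def)
    have "Y2 * g \<noteq> 0" using g0 by simp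
    then have delta: "delta_invariant f = enat (n + ?a + (1 + ?b))"
      unfolding fg using delta_mult[OF X2_nonzero _ XYg] by (simp add: dX dYg XYg)
    have "num_branches f = Suc (Suc r)"
      unfolding fg
      by (rule num_branches_eq[OF prime_product_prime_mult[OF prime_elem_X2 prime_product_prime_mult[OF prime_elem_Y2 nre(2)]]])
    then have "(1 + ?a + (?b + e)) + num_branches f = 2 * (n + ?a + (1 + ?b)) + 1" using nre(4) by simp
    then show ?thesis using \<mu> delta by blast
  qed
qed

theorem theorem4p13:
  fixes f :: "'k::alg_closed_field fps2"
  assumes "f \<noteq> 0" and "f \<in> ideal2 X2 Y2" and "NND f"
  shows "ereal_of_enat (milnor_number f) =
    2 * ereal_of_enat (delta_invariant f) - ereal (real (num_branches f)) + 1"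
proof -
  obtain \<alpha> \<beta> g where f: "f = X2 ^ \<alpha> * Y2 ^ \<beta> * g" "at_x0 g \<noteq> 0" "at_y0 g \<noteq> 0"
    by (rule monomial_decomposition[OF assms(1)])
  have g: "g \<noteq> 0" using f by auto
  have nonunit: "\<not> f dvd 1"
    using assms(2) by (auto elim!: ideal2E simp: is_unit_fps2_iff X2_def Y2_def)
  show ?thesis
  proof (cases "\<alpha> \<le> 1 \<and> \<beta> \<le> 1")
    case True
    obtain \<mu> n where "milnor_number f = enat \<mu>" "delta_invariant f = enat n" "\<mu> + num_branches f = 2 * n + 1"
      using milnor_delta_branches_finite[OF f(1) _ _ nonunit f(2,3) nondegenerate_of_NND[OF assms(1,3)]] True by blast
    moreover from this have "real \<mu> = 2 * real n - real (num_branches f) + 1" by linarith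
    ultimately show ?thesis by (simp flip: one_ereal_def add: numeral_eq_ereal)
  next
    case False
    then consider h where "f = X2 ^ 2 * h" | h where "f = Y2 ^ 2 * h"
    proof (cases "\<alpha> \<le> 1")
      case False
      then have "\<alpha> = 2 + (\<alpha> - 2)" by simp
      then have "X2 ^ \<alpha> = X2 ^ 2 * (X2 ^ (\<alpha> - 2) :: 'k fps2)" by (metis power_add)
      then have "f = X2 ^ 2 * (X2 ^ (\<alpha> - 2) * Y2 ^ \<beta> * g)" by (simp add: f(1) mult.assoc)
      then show thesis using that by blast
    next
      case True
      then have "\<beta> = 2 + (\<beta> - 2)" using False by simp
      then have "Y2 ^ \<beta> = Y2 ^ 2 * (Y2 ^ (\<beta> - 2) :: 'k fps2)" by (metis power_add)
      then have "f = Y2 ^ 2 * (X2 ^ \<alpha> * Y2 ^ (\<beta> - 2) * g)" by (simp add: f(1) mult_ac)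
      then show thesis using that by blast
    qed
    then have "milnor_number f = \<infinity> \<and> delta_invariant f = \<infinity>"
    proof cases
      case (1 h)
      then show ?thesis using milnor_delta_infinite(1,2)[of h] assms(1) by auto
    next
      case (2 h)
      then show ?thesis using milnor_delta_infinite(3,4)[of h] assms(1) by auto
    qed
    \<comment> \<open>Both sides are infinite in the extended reals, because the number of branches
      is finite.\<close>
    then show ?thesis by simp
  qed
qed

end
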